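(* Let $\mathfrak g$ and $\mathfrak h$ be nilpotent Lie algebras over a field of characteristic zero. The universal enveloping algebras $U\mathfrak g$ and $U\mathfrak h$ are isomorphic as associative algebras if and only if $\mathfrak g$ and $\mathfrak h$ are isomorphic as Lie algebras.
   Context: Lie algebras here are ordinary (ungraded, no differential) Lie algebras, of arbitrary dimension. A Lie algebra $\mathfrak g$ is nilpotent if some term of its lower central series $L^1\mathfrak g=\mathfrak g$, $L^n\mathfrak g=[\mathfrak g,L^{n-1}\mathfrak g]$ vanishes. The isomorphism $U\mathfrak g\cong U\mathfrak h$ is only one of associative algebras; it is not required to be compatible with coproducts or augmentations. *)

theory Defs
  imports Complex_Main "HOL-Algebra.QuotRing" "HOL-Algebra.Module" "HOL-Library.Poly_Mapping"
begin

section \<open>Lie algebras\<close>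

locale lie_algebra = vector_space scale
  for scale :: "'k::field \<Rightarrow> 'g::ab_group_add \<Rightarrow> 'g" +
  fixes bracket :: "'g \<Rightarrow> 'g \<Rightarrow> 'g"
  assumes bracket_add_left: "bracket (x + y) z = bracket x z + bracket y z"
    and bracket_add_right: "bracket x (y + z) = bracket x y + bracket x z"
    and bracket_scale_left: "bracket (scale c x) y = scale c (bracket x y)"
    and bracket_scale_right: "bracket x (scale c y) = scale c (bracket x y)"
    and bracket_self: "bracket x x = 0"
    and jacobi: "bracket x (bracket y z) + bracket y (bracket z x) + bracket z (bracket x y) = 0"
begin

text \<open>The usual indexing of the lower central series starts at \<open>L\<^sup>1 = \<gg>\<close>;
  here \<open>lower_central n\<close> is \<open>L\<^sup>n\<^sup>+\<^sup>1\<close>.\<close>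

primrec lower_central :: "nat \<Rightarrow> 'g set" where
  "lower_central 0 = UNIV"
| "lower_central (Suc n) = span {bracket x y | x y. y \<in> lower_central n}"

end

locale nilpotent_lie_algebra = lie_algebra +
  assumes nilpotent: "\<exists>n. lower_central n = {0}"

definition lie_isomorphic ::
  "('k::field \<Rightarrow> 'g::ab_group_add \<Rightarrow> 'g) \<Rightarrow> ('g \<Rightarrow> 'g \<Rightarrow> 'g) \<Rightarrow>
   ('k \<Rightarrow> 'h::ab_group_add \<Rightarrow> 'h) \<Rightarrow> ('h \<Rightarrow> 'h \<Rightarrow> 'h) \<Rightarrow> bool" where
  "lie_isomorphic scale_g bracket_g scale_h bracket_h \<longleftrightarrow>
     (\<exists>f. Vector_Spaces.linear scale_g scale_h f \<and> bij f \<and>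
          (\<forall>x y. f (bracket_g x y) = bracket_h (f x) (f y)))"


section \<open>Isomorphism of associative algebras\<close>

text \<open>The library's \<open>algebra\<close> locale is restricted to commutative algebras, but its record type
  serves equally well for noncommutative ones. Elements of \<open>ring_iso\<close> preserve the unit.\<close>

definition algebra_isomorphic :: "('k, 'a) module \<Rightarrow> ('k, 'b) module \<Rightarrow> bool" where
  "algebra_isomorphic A B \<longleftrightarrow>
     (\<exists>\<phi> \<in> ring_iso A B. \<forall>c. \<forall>x \<in> carrier A. \<phi> (c \<odot>\<^bsub>A\<^esub> x) = c \<odot>\<^bsub>B\<^esub> \<phi> x)"


section \<open>The universal enveloping algebra\<close>

text \<open>The free monoid on \<open>'a\<close>, written additively because \<open>Poly_Mapping\<close> builds the
  monoid algebra \<open>'m \<Rightarrow>\<^sub>0 'k\<close> from an additive, not necessarily commutative, monoid \<open>'m\<close>.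
  A separate type avoids imposing a \<open>plus\<close> instance on lists.\<close>

datatype 'a free_monoid = Word (letters: "'a list")

instantiation free_monoid :: (type) monoid_add
begin

definition zero_free_monoid :: "'a free_monoid" where
  "zero_free_monoid = Word []"

definition plus_free_monoid :: "'a free_monoid \<Rightarrow> 'a free_monoid \<Rightarrow> 'a free_monoid" where
  "plus_free_monoid u v = Word (letters u @ letters v)"

instance
  by standard (simp_all add: zero_free_monoid_def plus_free_monoid_def)

end

text \<open>Noncommutative polynomials over \<open>'k\<close> with one indeterminate for each element of \<open>'g\<close>.\<close>

type_synonym ('g, 'k) ncpoly = "'g free_monoid \<Rightarrow>\<^sub>0 'k"

definition const :: "'k \<Rightarrow> ('g, 'k::field) ncpoly" where
  "const c = Poly_Mapping.single 0 c"

definition indet :: "'g \<Rightarrow> ('g, 'k::field) ncpoly" where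
  "indet x = Poly_Mapping.single (Word [x]) 1"

definition free_algebra :: "('g, 'k::field) ncpoly ring" where
  "free_algebra = \<lparr>carrier = UNIV, mult = (*), one = 1, zero = 0, add = (+)\<rparr>"

text \<open>The linear relations turn the free algebra on the set \<open>'g\<close> into the tensor algebra of
  the vector space \<open>'g\<close>. The commutator relations are those defining the enveloping algebra as
  a quotient of the tensor algebra. \<open>genideal\<close> generates two-sided ideals.\<close>

definition linear_relations ::
  "('k::field \<Rightarrow> 'g::ab_group_add \<Rightarrow> 'g) \<Rightarrow> ('g, 'k) ncpoly set" where
  "linear_relations scale =
     {indet (x + y) - indet x - indet y | x y. True} \<union>
     {indet (scale c x) - const c * indet x | c x. True}"

definition commutator_relations :: "('g \<Rightarrow> 'g \<Rightarrow> 'g) \<Rightarrow> ('g, 'k::field) ncpoly set" where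
  "commutator_relations bracket =
     {indet x * indet y - indet y * indet x - indet (bracket x y) | x y. True}"

definition enveloping_ideal ::
  "('k::field \<Rightarrow> 'g::ab_group_add \<Rightarrow> 'g) \<Rightarrow> ('g \<Rightarrow> 'g \<Rightarrow> 'g) \<Rightarrow> ('g, 'k) ncpoly set" where
  "enveloping_ideal scale bracket =
     Idl\<^bsub>free_algebra\<^esub> (linear_relations scale \<union> commutator_relations bracket)"

definition universal_enveloping_algebra ::
  "('k::field \<Rightarrow> 'g::ab_group_add \<Rightarrow> 'g) \<Rightarrow> ('g \<Rightarrow> 'g \<Rightarrow> 'g) \<Rightarrow> ('k, ('g, 'k) ncpoly set) module" where
  "universal_enveloping_algebra scale bracket =
     (let I = enveloping_ideal scale bracket; Q = free_algebra Quot I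
      in ring.extend Q
           (module.fields (\<lambda>c X. (I +>\<^bsub>free_algebra\<^esub> const c) \<otimes>\<^bsub>Q\<^esub> X)))"

lemma ring_free_algebra: "ring (free_algebra :: ('g, 'k::field) ncpoly ring)"
proof (rule ringI)
  show "abelian_group (free_algebra :: ('g, 'k) ncpoly ring)"
  proof (rule abelian_groupI)
    show "\<exists>y \<in> carrier free_algebra. y \<oplus>\<^bsub>free_algebra\<^esub> x = \<zero>\<^bsub>free_algebra\<^esub>"
      for x :: "('g, 'k) ncpoly"
      by (rule bexI[of _ "- x"]) (simp_all add: free_algebra_def)
  qed (simp_all add: free_algebra_def ac_simps)
  show "monoid (free_algebra :: ('g, 'k) ncpoly ring)"
    by (rule monoidI) (simp_all add: free_algebra_def mult.assoc)
qed (simp_all add: free_algebra_def algebra_simps)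

lemma ideal_enveloping_ideal: "ideal (enveloping_ideal scale bracket) free_algebra"
  unfolding enveloping_ideal_def
  by (rule ring.genideal_ideal[OF ring_free_algebra]) (simp add: free_algebra_def)

lemma universal_enveloping_algebra_simps:
  fixes scale :: "'k::field \<Rightarrow> 'g::ab_group_add \<Rightarrow> 'g" and bracket :: "'g \<Rightarrow> 'g \<Rightarrow> 'g"
  defines "I \<equiv> enveloping_ideal scale bracket"
  defines "U \<equiv> universal_enveloping_algebra scale bracket"
  shows "carrier U = carrier (free_algebra Quot I)"
    and "mult U = mult (free_algebra Quot I)"
    and "one U = one (free_algebra Quot I)"
    and "zero U = zero (free_algebra Quot I)"
    and "add U = add (free_algebra Quot I)"
    and "c \<odot>\<^bsub>U\<^esub> (I +>\<^bsub>free_algebra\<^esub> p) = I +>\<^bsub>free_algebra\<^esub> (const c * p)"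
proof -
  have 1: "p \<in> carrier free_algebra" for p :: "('g, 'k) ncpoly"
    by (simp add: free_algebra_def)
  show "c \<odot>\<^bsub>U\<^esub> (I +>\<^bsub>free_algebra\<^esub> p) = I +>\<^bsub>free_algebra\<^esub> (const c * p)"
    using ideal.rcoset_mult_add[OF ideal_enveloping_ideal 1 1, of scale bracket "const c" p]
    by (simp add: U_def I_def universal_enveloping_algebra_def Let_def ring.defs module.defs
        FactRing_def free_algebra_def)
qed (simp_all add: U_def I_def universal_enveloping_algebra_def Let_def ring.defs module.defs)

end

theory Submission
  imports Defs "HOL-Library.Product_Plus"
begin

text \<open>
  Let \<open>T\<close> be the free algebra on the set \<open>\<gg>\<close> and \<open>L \<subseteq> T\<close> the Lie
  algebra generated by the letters. In characteristic zero \<open>T\<close> splits \<open>L\<close>-equivariantly as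
  \<open>L \<oplus> K\<close>, where \<open>L\<close> is the eigenspace for the eigenvalue \<open>2\<close> of the
  Adams operation \<open>\<mu> \<circ> \<Delta>\<close>; the projection to \<open>L\<close> maps the two-sided ideal
  \<open>(R)\<close> generated by a Lie ideal \<open>R\<close> of \<open>L\<close> into \<open>R\<close>. The algebra
  \<open>U\<gg>\<close> is \<open>T/(R)\<close>, where \<open>R\<close> is the kernel of the evaluation \<open>L
  \<rightarrow> \<gg>\<close>. Modulo long words, which nilpotency allows us to ignore, an isomorphism \<open>U\<gg>
  \<cong> U\<hh>\<close>, made compatible with augmentations, has the form \<open>q \<circ> exp D\<close>, where
  \<open>q\<close> sends letters to letters and \<open>D\<close> is a derivation of \<open>T\<close> of positive
  degree with \<open>D L \<subseteq> K\<close>. Hence \<open>exp D\<close> maps \<open>(R)\<close> onto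
  \<open>(S)\<close>, where \<open>S\<close> is the kernel of the evaluation \<open>L \<rightarrow> \<hh>\<close>
  through \<open>q\<close>. For \<open>r \<in> R\<close> the term \<open>D r\<close> of \<open>exp D r\<close> lies in
  \<open>K\<close>, and an induction on word length shows that the higher terms contribute nothing new after
  projection to \<open>L\<close>, so \<open>R = S\<close> and \<open>q\<close> induces \<open>\<gg> \<cong>
  \<hh>\<close>.
\<close>

section \<open>Monoid algebras as vector spaces\<close>

text \<open>The obstacle is that \<open>R\<close> and \<open>S\<close> are not homogeneous, so the
  effect of \<open>exp D\<close> cannot be read off degree by degree. Instead the two generated
  ideals are compared modulo words of length at least \<open>m\<close>, for growing
  \<open>m\<close>. The condition \<open>D L \<subseteq> K\<close> is what makes equality of
  \<open>R\<close> and \<open>S\<close> attainable: a Lie part of \<open>D\<close> could move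
  \<open>R\<close> itself. The condition can be imposed because in \<open>U\<hh>\<close> every Lie
  element equals a single letter, so a Lie part of the correction is absorbed by changing
  \<open>q\<close>. The letters are all elements of \<gg>, so \<open>q\<close> starts as a mere
  function from \<gg> to \<hh>. Linearity and compatibility with brackets come last: the relations
  that express them are Lie elements of value 0 in \<gg>, hence in \<open>R\<close>, hence in
  \<open>S\<close>. The eigenvalues come from counting factors: on a product of \<open>k\<close> Lie
  elements \<open>\<mu> \<circ> \<Delta>\<close> acts as 2 to the power \<open>k\<close>, up to
  shorter products. The projection onto \<open>L\<close> is the polynomial in
  \<open>\<mu> \<circ> \<Delta>\<close> that interpolates 1 at the eigenvalue 2 and 0 at the others
  that occur in bounded length.\<close>

abbreviation "lookup \<equiv> Poly_Mapping.lookup"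
abbreviation "keys \<equiv> Poly_Mapping.keys"
abbreviation "single \<equiv> Poly_Mapping.single"

text \<open>Scaling is defined for every monoid algebra, so that one vector space structure serves
  the free algebra and its tensor square alike.\<close>

definition sc :: "'k::field \<Rightarrow> ('m::monoid_add \<Rightarrow>\<^sub>0 'k) \<Rightarrow> ('m \<Rightarrow>\<^sub>0 'k)" where
  "sc c p = single 0 c * p"

lemma lookup_sc [simp]: "lookup (sc c p) w = c * lookup p w"
  by (simp add: sc_def mult_map_scale_conv_mult[symmetric] Poly_Mapping.map.rep_eq when_def)

lemma sc_mult_left: "sc c p * q = sc c (p * q)"
  by (simp add: sc_def mult.assoc)

lemma mult_single_0_commute:
  fixes p :: "'m::monoid_add \<Rightarrow>\<^sub>0 'k::field"
  shows "p * single 0 c = single 0 c * p"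
proof (induction p rule: update_induct)
  case const
  then show ?case by simp
next
  case (update p a b)
  have "Poly_Mapping.update a b p = p + single a b"
    using update(1) by (intro poly_mapping_eqI)
      (auto simp: lookup_update lookup_add lookup_single when_def in_keys_iff)
  then show ?case
    using update(3) by (simp add: distrib_left distrib_right mult_single mult.commute)
qed

lemma sc_mult_right: "p * sc c q = sc c (p * q)"
  by (metis mult.assoc mult_single_0_commute sc_def)

lemmas sc_mult = sc_mult_left sc_mult_right

global_interpretation pm: vector_space "sc :: 'k::field \<Rightarrow> ('m::monoid_add \<Rightarrow>\<^sub>0 'k) \<Rightarrow> _"
  by standard (auto intro!: poly_mapping_eqI simp: lookup_add algebra_simps)

global_interpretation pmp: vector_space_pair
  "sc :: 'k::field \<Rightarrow> ('m::monoid_add \<Rightarrow>\<^sub>0 'k) \<Rightarrow> _" "sc :: 'k::field \<Rightarrow> ('n::monoid_add \<Rightarrow>\<^sub>0 'k) \<Rightarrow> _"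
  by standard

abbreviation plinear :: "(('m::monoid_add \<Rightarrow>\<^sub>0 'k::field) \<Rightarrow> ('n::monoid_add \<Rightarrow>\<^sub>0 'k)) \<Rightarrow> bool" where
  "plinear \<equiv> Vector_Spaces.linear sc sc"

lemma plinearI:
  assumes "\<And>p q. f (p + q) = f p + f q" "\<And>c p. f (sc c p) = sc c (f p)"
  shows "plinear f"
  using assms by unfold_locales

lemma plinear_const_mult: "plinear (\<lambda>p. a * p)" and plinear_mult_const: "plinear (\<lambda>p. p * a)"
  by (auto intro!: plinearI simp: algebra_simps sc_mult)

lemma plinear_id: "plinear (\<lambda>p. p)"
  by (auto intro!: plinearI)

lemma plinear_comp: "plinear f \<Longrightarrow> plinear g \<Longrightarrow> plinear (\<lambda>p. f (g p))"
  using Vector_Spaces.linear_compose[of sc sc g sc f] by (simp add: o_def)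

lemma poly_mapping_sum_single:
  fixes p :: "'m::monoid_add \<Rightarrow>\<^sub>0 'k::field"
  shows "p = (\<Sum>w\<in>keys p. sc (lookup p w) (single w 1))"
  by (rule poly_mapping_eqI)
    (simp add: lookup_sum lookup_single when_def if_distrib[of "(*) _"] sum.delta' in_keys_iff cong: if_cong)

lemma pm_subspace_induct:
  assumes "pm.subspace V" and "\<And>w. w \<in> keys p \<Longrightarrow> single w 1 \<in> V"
  shows "p \<in> V"
  by (subst poly_mapping_sum_single)
    (intro pm.subspace_sum pm.subspace_scale assms)

lemma subspace_vimage: "plinear f \<Longrightarrow> pm.subspace V \<Longrightarrow> pm.subspace {p. f p \<in> V}"
  by (rule pmp.linear_subspace_vimage[unfolded vimage_def])

lemma plinear_span_subset:
  assumes "plinear f" "pm.subspace V" "\<And>x. x \<in> S \<Longrightarrow> f x \<in> V" "p \<in> pm.span S"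
  shows "f p \<in> V"
  using pm.span_minimal[of S "{p. f p \<in> V}"] subspace_vimage[OF assms(1,2)] assms by blast

lemma plinear_in_subspace:
  assumes "plinear f" "pm.subspace V" "\<And>w. w \<in> keys p \<Longrightarrow> f (single w 1) \<in> V"
  shows "f p \<in> V"
  using pm_subspace_induct[of "{p. f p \<in> V}" p] subspace_vimage[OF assms(1,2)] assms by blast

lemma plinear_eqI:
  assumes "plinear f" "plinear g"
    and "\<And>w. f (single w 1) = g (single w 1)"
  shows "f p = g p"
  using plinear_in_subspace[OF pmp.linear_compose_sub[OF assms(1,2)] pm.subspace_single_0, of p]
  by (simp add: assms(3))

lemma plinear_eq_on_span:
  assumes "plinear f" "plinear g" "\<And>x. x \<in> S \<Longrightarrow> f x = g x" "p \<in> pm.span S"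
  shows "f p = g p"
  using plinear_span_subset[OF pmp.linear_compose_sub[OF assms(1,2)] pm.subspace_single_0, of S p]
    assms(3,4) by simp

text \<open>Linear extension from monoid elements. The target is given by its scaling, because both
  monoid algebras and the Lie algebra itself occur as targets.\<close>

definition vlin :: "('k \<Rightarrow> 'b \<Rightarrow> 'b::ab_group_add) \<Rightarrow> ('m \<Rightarrow> 'b) \<Rightarrow> ('m \<Rightarrow>\<^sub>0 'k::zero) \<Rightarrow> 'b" where
  "vlin s f p = (\<Sum>w\<in>keys p. s (lookup p w) (f w))"

context vector_space
begin

lemma vlin_superset:
  assumes "finite A" "keys p \<subseteq> A"
  shows "vlin scale f p = (\<Sum>w\<in>A. scale (lookup p w) (f w))"
  unfolding vlin_def using assms by (intro sum.mono_neutral_left) (auto simp: in_keys_iff)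

lemma vlin_add: "vlin scale f (p + q) = vlin scale f p + vlin scale f q"
  using keys_add[of p q]
  by (simp add: vlin_superset[of "keys p \<union> keys q"] lookup_add scale_left_distrib sum.distrib)

lemma vlin_sc: "vlin scale f (sc c p) = scale c (vlin scale f p)"
proof -
  have "keys (sc c p) \<subseteq> keys p"
    by (auto simp: in_keys_iff)
  then show ?thesis
    by (simp add: vlin_superset[of "keys p"] scale_sum_right)
qed

lemma vlin_single [simp]: "vlin scale f (single w c) = scale c (f w)"
  by (simp add: vlin_def)

lemma linear_vlin: "Vector_Spaces.linear sc scale (vlin scale f)"
  by unfold_locales (simp_all add: vlin_add vlin_sc)

end

abbreviation "lin f \<equiv> vlin sc f"

lemma plinear_lin: "plinear (lin f)"
  by (rule pm.linear_vlin)

lemma lin_add: "lin f (p + q) = lin f p + lin f q"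
  by (rule pm.vlin_add)

lemma lin_sc: "lin f (sc c p) = sc c (lin f p)"
  by (rule pm.vlin_sc)

lemma lin_single_1 [simp]: "lin f (single w 1) = f w"
  by simp

lemma lin_0 [simp]: "lin f 0 = 0"
  by (simp add: vlin_def)

lemma lin_diff:
  fixes p q :: "'m::monoid_add \<Rightarrow>\<^sub>0 'k::field"
  shows "lin f (p - q) = lin f p - lin f q"
  by (rule pmp.linear_diff[OF plinear_lin])

lemma lin_mult:
  assumes "\<And>u v. f (u + v) = f u * f v"
  shows "lin f (p * q) = lin f p * lin f q"
proof (rule plinear_eqI[of "\<lambda>p. lin f (p * q)" "\<lambda>p. lin f p * lin f q"])
  fix u
  show "lin f (single u 1 * q) = lin f (single u 1) * lin f q"
  proof (rule plinear_eqI[of "\<lambda>q. lin f (single u 1 * q)"])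
    show "lin f (single u 1 * single w 1)
      = lin f (single u 1) * lin f (single w 1)" for w
      using assms by (simp add: mult_single)
  qed (rule plinear_comp[OF plinear_lin plinear_const_mult] plinear_comp[OF plinear_const_mult plinear_lin])+
qed (rule plinear_comp[OF plinear_lin plinear_mult_const] plinear_comp[OF plinear_mult_const plinear_lin])+

section \<open>The free algebra\<close>

definition word :: "'a list \<Rightarrow> ('a, 'k::field) ncpoly" where
  "word l = single (Word l) 1"

lemma single_word: "single w 1 = word (letters w)"
  by (simp add: word_def)

lemma word_append: "word (l @ m) = word l * word m"
  by (simp add: word_def mult_single plus_free_monoid_def)

lemma word_Nil [simp]: "word [] = 1"
  by (simp add: word_def zero_free_monoid_def[symmetric])

lemma indet_word: "indet x = word [x]"
  by (simp add: indet_def word_def)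

lemma word_Cons: "word (x # l) = indet x * word l"
  using word_append[of "[x]" l] by (simp add: indet_word)

lemma const_mult: "const c * p = sc c p"
  by (simp add: const_def sc_def)

lemma plinear_eq_words:
  fixes f g :: "('a, 'k::field) ncpoly \<Rightarrow> ('m::monoid_add \<Rightarrow>\<^sub>0 'k)"
  assumes "plinear f" "plinear g" "\<And>l. f (word l) = g (word l)"
  shows "f p = g p"
  by (rule plinear_eqI[OF assms(1,2)]) (simp add: single_word assms(3))

text \<open>The universal property of the free algebra. The target is an arbitrary monoid algebra,
  so that the coproduct is an instance too.\<close>

definition subst :: "('a \<Rightarrow> ('m::monoid_add \<Rightarrow>\<^sub>0 'k::field)) \<Rightarrow> ('a, 'k) ncpoly \<Rightarrow> ('m \<Rightarrow>\<^sub>0 'k)" where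
  "subst v = lin (\<lambda>w. prod_list (map v (letters w)))"

lemma plinear_subst: "plinear (subst v)"
  by (simp add: subst_def plinear_lin)

lemma subst_word [simp]: "subst v (word l) = prod_list (map v l)"
  by (simp add: subst_def word_def)

lemma subst_indet [simp]: "subst v (indet x) = v x"
  by (simp add: indet_word)

lemma subst_mult: "subst v (p * q) = subst v p * subst v q"
  unfolding subst_def by (rule lin_mult) (simp add: plus_free_monoid_def)

lemma subst_add: "subst v (p + q) = subst v p + subst v q"
  by (simp add: subst_def lin_add)

lemma subst_diff: "subst v (p - q) = subst v p - subst v q"
  by (simp add: subst_def lin_diff)

lemma subst_sc: "subst v (sc c p) = sc c (subst v p)"
  by (simp add: subst_def lin_sc)

lemma subst_1 [simp]: "subst v 1 = 1"
  using subst_word[of v "[]"] by (simp del: subst_word)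

lemma subst_0 [simp]: "subst v 0 = 0"
  by (simp add: subst_def)

lemma subst_prod_list: "subst v (prod_list l) = prod_list (map (subst v) l)"
  by (induction l) (simp_all add: subst_mult)

lemma subst_subst: "subst u (subst v p) = subst (\<lambda>x. subst u (v x)) p"
  by (rule plinear_eq_words)
    (simp_all add: plinear_comp plinear_subst subst_prod_list o_def)

lemma prod_list_map_indet: "prod_list (map indet l) = word l"
  by (induction l) (simp_all add: word_Cons)

lemma subst_indet_id [simp]: "subst indet p = p"
  by (rule plinear_eq_words) (simp_all add: plinear_subst plinear_id prod_list_map_indet)

section \<open>The filtration by word length\<close>

text \<open>The \<open>n\<close>-th power of the augmentation ideal.\<close>

definition deg_ge :: "nat \<Rightarrow> ('a, 'k::field) ncpoly set" where
  "deg_ge n = {p. \<forall>w\<in>keys p. n \<le> length (letters w)}"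

lemma subspace_deg_ge: "pm.subspace (deg_ge n :: ('a, 'k::field) ncpoly set)"
proof (rule pm.subspaceI)
  fix p q :: "('a, 'k) ncpoly" assume "p \<in> deg_ge n" "q \<in> deg_ge n"
  then show "p + q \<in> deg_ge n"
    using keys_add[of p q] by (auto simp: deg_ge_def)
qed (auto simp: deg_ge_def in_keys_iff)

lemma word_deg_ge: "n \<le> length l \<Longrightarrow> word l \<in> deg_ge n"
  by (simp add: deg_ge_def word_def)

lemma indet_deg_ge: "indet x \<in> deg_ge 1"
  by (simp add: indet_word word_deg_ge)

lemma deg_ge_antimono: "m \<le> n \<Longrightarrow> p \<in> deg_ge n \<Longrightarrow> p \<in> deg_ge m"
  by (auto simp: deg_ge_def)

lemma deg_ge_0 [simp]: "p \<in> deg_ge 0"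
  by (simp add: deg_ge_def)

lemma plinear_deg_ge:
  fixes f :: "('a, 'k::field) ncpoly \<Rightarrow> ('m::monoid_add \<Rightarrow>\<^sub>0 'k)"
  assumes "plinear f" "pm.subspace V" "\<And>l. n \<le> length l \<Longrightarrow> f (word l) \<in> V" "p \<in> deg_ge n"
  shows "f p \<in> V"
  by (rule plinear_in_subspace[OF assms(1,2)])
    (use assms(4) in \<open>simp add: deg_ge_def single_word assms(3)\<close>)

lemma deg_ge_mult:
  assumes "p \<in> deg_ge m" "q \<in> deg_ge n"
  shows "p * q \<in> deg_ge (m + n)"
  unfolding deg_ge_def
proof clarify
  fix w assume "w \<in> keys (p * q)"
  then obtain u v where "w = u + v" "u \<in> keys p" "v \<in> keys q"
    using keys_mult[of p q] by blast
  then show "m + n \<le> length (letters w)"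
    using assms by (fastforce simp: deg_ge_def plus_free_monoid_def)
qed

lemma deg_ge_mult_left: "q \<in> deg_ge n \<Longrightarrow> p * q \<in> deg_ge n"
  using deg_ge_mult[of p 0 q n] by simp

lemma deg_ge_mult_right: "p \<in> deg_ge n \<Longrightarrow> p * q \<in> deg_ge n"
  using deg_ge_mult[of p n q 0] by simp

lemma diff_const_deg_ge_1: "p - sc (lookup p 0) 1 \<in> deg_ge 1"
  unfolding deg_ge_def
proof clarify
  fix w assume *: "w \<in> keys (p - sc (lookup p 0) 1)"
  then have "letters w \<noteq> []"
    by (cases w) (auto simp: in_keys_iff lookup_minus zero_free_monoid_def[symmetric])
  then show "1 \<le> length (letters w)"
    by (cases "letters w") auto
qed

lemma deg_ge_1_iff: "p \<in> deg_ge 1 \<longleftrightarrow> lookup p 0 = 0"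
proof
  assume "p \<in> deg_ge 1"
  then show "lookup p 0 = 0"
    by (force simp: deg_ge_def in_keys_iff zero_free_monoid_def)
next
  assume "lookup p 0 = 0"
  then show "p \<in> deg_ge 1"
    using diff_const_deg_ge_1[of p] by simp
qed

lemma prod_list_deg_ge:
  "(\<And>x. x \<in> set l \<Longrightarrow> x \<in> deg_ge 1) \<Longrightarrow> prod_list l \<in> deg_ge (length l)"
  using deg_ge_mult[of _ 1] by (induction l) auto

lemma subst_deg_ge:
  assumes "\<And>x. v x \<in> deg_ge 1" "p \<in> deg_ge n"
  shows "subst v p \<in> deg_ge n"
proof (rule plinear_deg_ge[OF plinear_subst subspace_deg_ge _ assms(2)])
  fix l :: "'a list" assume "n \<le> length l"
  then show "subst v (word l) \<in> deg_ge n"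
    using prod_list_deg_ge[of "map v l"] assms(1) deg_ge_antimono by auto
qed

section \<open>Coproduct and the second Adams operation\<close>

definition inl1 :: "('m::monoid_add \<Rightarrow>\<^sub>0 'k::field) \<Rightarrow> ('m \<times> 'm \<Rightarrow>\<^sub>0 'k)" where
  "inl1 = lin (\<lambda>w. single (w, 0) 1)"

definition inl2 :: "('m::monoid_add \<Rightarrow>\<^sub>0 'k::field) \<Rightarrow> ('m \<times> 'm \<Rightarrow>\<^sub>0 'k)" where
  "inl2 = lin (\<lambda>w. single (0, w) 1)"

definition mu :: "('m::monoid_add \<times> 'm \<Rightarrow>\<^sub>0 'k::field) \<Rightarrow> ('m \<Rightarrow>\<^sub>0 'k)" where
  "mu = lin (\<lambda>(u, v). single (u + v) 1)"

lemma plinear_inl1: "plinear inl1" and plinear_inl2: "plinear inl2" and plinear_mu: "plinear mu"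
  by (simp_all add: inl1_def inl2_def mu_def plinear_lin)

lemma inl1_mult: "inl1 (a * b) = inl1 a * inl1 b" and inl2_mult: "inl2 (a * b) = inl2 a * inl2 b"
  unfolding inl1_def inl2_def by (rule lin_mult, simp add: mult_single)+

lemma inl1_1 [simp]: "inl1 1 = 1" and inl2_1 [simp]: "inl2 1 = 1"
  using lin_single_1[of _ 0] by (simp_all add: inl1_def inl2_def single_one[symmetric]
      zero_prod_def del: single_one)

lemma single_tensor: "single (u, v) 1 = inl1 (single u 1) * inl2 (single v 1)"
  by (simp add: inl1_def inl2_def mult_single)

lemma inl1_inl2_commute: "inl2 b * inl1 a = inl1 a * inl2 b"
proof (rule plinear_eqI[of "\<lambda>a. inl2 b * inl1 a" "\<lambda>a. inl1 a * inl2 b"])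
  fix u
  show "inl2 b * inl1 (single u 1) = inl1 (single u 1) * inl2 b"
    by (rule plinear_eqI[of "\<lambda>b. inl2 b * inl1 (single u 1)"])
      (simp_all add: inl1_def inl2_def mult_single plinear_lin
        plinear_comp[OF plinear_mult_const plinear_lin] plinear_comp[OF plinear_const_mult plinear_lin])
qed (rule plinear_comp[OF plinear_mult_const plinear_inl1]
      plinear_comp[OF plinear_const_mult plinear_inl1])+

lemma inl1_inl2_commute_left: "inl2 b * (inl1 a * z) = inl1 a * (inl2 b * z)"
  by (simp add: mult.assoc[symmetric] inl1_inl2_commute)

lemma mu_inl1_mult: "mu (inl1 a * z) = a * mu z"
proof (rule plinear_eqI[of "\<lambda>a. mu (inl1 a * z)" "\<lambda>a. a * mu z"])
  fix u
  show "mu (inl1 (single u 1) * z) = single u 1 * mu z"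
  proof (rule plinear_eqI[of "\<lambda>z. mu (inl1 (single u 1) * z)"])
    show "mu (inl1 (single u 1) * single w 1) = single u 1 * mu (single w 1)" for w
      by (cases w) (simp add: inl1_def mu_def mult_single add.assoc)
  qed (rule plinear_comp[OF plinear_mu plinear_const_mult] plinear_comp[OF plinear_const_mult plinear_mu])+
qed (rule plinear_comp[OF plinear_mu plinear_comp[OF plinear_mult_const plinear_inl1]] plinear_mult_const)+

lemma mu_mult_inl2: "mu (z * inl2 a) = mu z * a"
proof (rule plinear_eqI[of "\<lambda>a. mu (z * inl2 a)" "\<lambda>a. mu z * a"])
  fix u
  show "mu (z * inl2 (single u 1)) = mu z * single u 1"
  proof (rule plinear_eqI[of "\<lambda>z. mu (z * inl2 (single u 1))"])
    show "mu (single w 1 * inl2 (single u 1)) = mu (single w 1) * single u 1" for w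
      by (cases w) (simp add: inl2_def mu_def mult_single add.assoc)
  qed (rule plinear_comp[OF plinear_mu plinear_mult_const] plinear_comp[OF plinear_mult_const plinear_mu])+
qed (rule plinear_comp[OF plinear_mu plinear_comp[OF plinear_const_mult plinear_inl2]] plinear_const_mult)+

lemma mu_1 [simp]: "mu 1 = 1"
  using lin_single_1[of _ 0] by (simp add: mu_def single_one[symmetric] zero_prod_def del: single_one)

lemma mu_inl1 [simp]: "mu (inl1 a) = a" and mu_inl2 [simp]: "mu (inl2 a) = a"
  using mu_inl1_mult[of a 1] mu_mult_inl2[of 1 a] by simp_all

lemma mu_inl1_inl2: "mu (inl1 a * inl2 b) = a * b"
  by (simp add: mu_inl1_mult)

text \<open>Both sides send \<open>z = u \<otimes> v\<close> to \<open>u * y * v\<close>: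
  multiplying inside the tensor sign can be done from either neighbour.\<close>

lemma mu_inl2_mult: "mu (inl2 y * z) = mu (z * inl1 y)"
proof (rule plinear_eqI[of "\<lambda>z. mu (inl2 y * z)" "\<lambda>z. mu (z * inl1 y)"])
  fix w :: "'a \<times> 'a"
  obtain u v where w: "w = (u, v)" by (cases w)
  have "inl2 y * single w 1 = inl1 (single u 1) * inl2 (y * single v 1)"
    by (simp add: w single_tensor inl2_mult inl1_inl2_commute mult.assoc[symmetric])
  moreover have "single w 1 * inl1 y = inl1 (single u 1 * y) * inl2 (single v 1)"
    by (simp add: w single_tensor inl1_mult inl1_inl2_commute mult.assoc)
  ultimately show "mu (inl2 y * single w 1) = mu (single w 1 * inl1 y)"
    by (simp add: mu_inl1_inl2 mult.assoc)
qed (rule plinear_comp[OF plinear_mu plinear_const_mult] plinear_comp[OF plinear_mu plinear_mult_const])+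

definition Delta :: "('a, 'k::field) ncpoly \<Rightarrow> ('a free_monoid \<times> 'a free_monoid \<Rightarrow>\<^sub>0 'k)" where
  "Delta = subst (\<lambda>x. inl1 (indet x) + inl2 (indet x))"

lemma plinear_Delta: "plinear Delta"
  by (simp add: Delta_def plinear_subst)

lemma Delta_mult: "Delta (p * q) = Delta p * Delta q"
  by (simp add: Delta_def subst_mult)

lemma Delta_1 [simp]: "Delta 1 = 1"
  by (simp add: Delta_def)

text \<open>The convolution square of the identity.\<close>

definition adams :: "('a, 'k::field) ncpoly \<Rightarrow> ('a, 'k) ncpoly" where
  "adams p = mu (Delta p)"

lemma plinear_adams: "plinear adams"
  unfolding adams_def by (rule plinear_comp[OF plinear_mu plinear_Delta])

lemma adams_1 [simp]: "adams 1 = 1"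
  by (simp add: adams_def)

subsection \<open>Lie elements\<close>

abbreviation comm :: "'r::ring \<Rightarrow> 'r \<Rightarrow> 'r" where
  "comm a b \<equiv> a * b - b * a"

lemma plinear_comm_left: "plinear (\<lambda>a. comm a b)" and plinear_comm_right: "plinear (comm a)"
  by (auto intro!: plinearI simp: algebra_simps sc_mult pm.scale_right_diff_distrib)

text \<open>The degree is an index because evaluation divides by it later. It is not a function of
  the element: 0 arises as a commutator in several degrees.\<close>

inductive lie_mono :: "nat \<Rightarrow> ('a, 'k::field) ncpoly \<Rightarrow> bool" where
  lie_mono_indet: "lie_mono 1 (indet x)"
| lie_mono_comm: "lie_mono m a \<Longrightarrow> lie_mono n b \<Longrightarrow> lie_mono (m + n) (comm a b)"

definition lie_elems :: "('a, 'k::field) ncpoly set" where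
  "lie_elems = pm.span {a. \<exists>n. lie_mono n a}"

lemma subspace_lie_elems: "pm.subspace lie_elems"
  by (simp add: lie_elems_def)

lemma lie_mono_lie_elems: "lie_mono n a \<Longrightarrow> a \<in> lie_elems"
  unfolding lie_elems_def by (rule pm.span_base) blast

lemma indet_lie_elems: "indet x \<in> lie_elems"
  by (rule lie_mono_lie_elems[OF lie_mono_indet])

lemma comm_lie_elems:
  assumes "a \<in> lie_elems" "b \<in> lie_elems"
  shows "comm a b \<in> lie_elems"
proof (rule plinear_span_subset[OF plinear_comm_left subspace_lie_elems _ assms(1)[unfolded lie_elems_def]])
  fix x :: "('a, 'b) ncpoly" assume "x \<in> {a. \<exists>n. lie_mono n a}"
  then obtain m where x: "lie_mono m x" by blast
  show "comm x b \<in> lie_elems"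
  proof (rule plinear_span_subset[OF plinear_comm_right subspace_lie_elems _ assms(2)[unfolded lie_elems_def]])
    fix y :: "('a, 'b) ncpoly" assume "y \<in> {a. \<exists>n. lie_mono n a}"
    then show "comm x y \<in> lie_elems"
      using lie_mono_comm[OF x] lie_mono_lie_elems by blast
  qed
qed

lemma lie_elems_induct [consumes 1, case_names mono add scale]:
  assumes "a \<in> lie_elems"
    and "\<And>n a. lie_mono n a \<Longrightarrow> P a"
    and "\<And>a b. a \<in> lie_elems \<Longrightarrow> b \<in> lie_elems \<Longrightarrow> P a \<Longrightarrow> P b \<Longrightarrow> P (a + b)"
    and "\<And>c a. a \<in> lie_elems \<Longrightarrow> P a \<Longrightarrow> P (sc c a)"
  shows "P a"
proof -
  have "lie_elems \<subseteq> {a \<in> lie_elems. P a}"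
    unfolding lie_elems_def
  proof (rule pm.span_minimal)
    show "pm.subspace {a \<in> pm.span {a. \<exists>n. lie_mono n a}. P a}"
    proof (rule pm.subspaceI)
      have "P (sc 0 (indet undefined))"
        using assms(2)[OF lie_mono_indet] assms(4)[OF indet_lie_elems] by blast
      then show "0 \<in> {a \<in> pm.span {a. \<exists>n. lie_mono n a}. P a}"
        by (simp add: pm.span_zero)
    qed (auto simp: lie_elems_def[symmetric] assms intro: pm.subspace_add pm.subspace_scale subspace_lie_elems)
  qed (use assms(2) in \<open>auto intro: pm.span_base\<close>)
  then show ?thesis using assms(1) by blast
qed

lemma lie_mono_deg_ge: "lie_mono n a \<Longrightarrow> a \<in> deg_ge n"
proof (induction rule: lie_mono.induct)
  case (lie_mono_comm m a n b)
  then show ?case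
    using pm.subspace_diff[OF subspace_deg_ge] deg_ge_mult[of a m b n] deg_ge_mult[of b n a m]
    by (simp add: add.commute)
qed (rule indet_deg_ge)

lemma lie_mono_pos: "lie_mono n a \<Longrightarrow> n \<ge> 1"
  by (induction rule: lie_mono.induct) auto

lemma lie_elems_deg_ge: "a \<in> lie_elems \<Longrightarrow> a \<in> deg_ge 1"
proof (induction rule: lie_elems_induct)
  case (mono n a)
  then show ?case using lie_mono_deg_ge lie_mono_pos deg_ge_antimono by blast
qed (auto intro: pm.subspace_add pm.subspace_scale subspace_deg_ge)

lemma Delta_lie:
  assumes "a \<in> lie_elems"
  shows "Delta a = inl1 a + inl2 a"
proof (rule plinear_eq_on_span[OF plinear_Delta _ _ assms[unfolded lie_elems_def]])
  show "plinear (\<lambda>a. inl1 a + inl2 a)"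
    by (rule pmp.linear_compose_add[OF plinear_inl1 plinear_inl2])
  fix x :: "('a, 'b) ncpoly" assume "x \<in> {a. \<exists>n. lie_mono n a}"
  then obtain n where "lie_mono n x" by blast
  then show "Delta x = inl1 x + inl2 x"
  proof (induction rule: lie_mono.induct)
    case (lie_mono_comm m a n b)
    then show ?case
      by (simp add: pmp.linear_diff[OF plinear_Delta] pmp.linear_diff[OF plinear_inl1]
          pmp.linear_diff[OF plinear_inl2] Delta_mult inl1_mult inl2_mult
          distrib_left distrib_right inl1_inl2_commute)
  qed (simp add: Delta_def)
qed

lemma adams_lie: "a \<in> lie_elems \<Longrightarrow> adams a = sc 2 a"
  using pm.scale_left_distrib[of 1 1 a]
  by (simp add: adams_def Delta_lie pmp.linear_add[OF plinear_mu])

text \<open>As \<open>x\<close> is primitive, the commutator with \<open>inl1 x + inl2 x\<close> has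
  four terms. In two of them \<open>mu\<close> puts \<open>x\<close> at an outer end, which gives
  the commutator with \<open>adams a\<close>. In the other two \<open>x\<close> lands between the
  tensor factors, and these cancel by \<open>mu_inl2_mult\<close>. This is the equivariance under
  \<open>L\<close>.\<close>

lemma adams_comm:
  assumes "x \<in> lie_elems"
  shows "adams (comm a x) = comm (adams a) x"
  by (simp add: adams_def pmp.linear_diff[OF plinear_Delta] Delta_mult Delta_lie[OF assms]
      distrib_left distrib_right pmp.linear_diff[OF plinear_mu] pmp.linear_add[OF plinear_mu]
      mu_mult_inl2 mu_inl1_mult mu_inl2_mult)

text \<open>The coproduct of a product of primitive elements unshuffles it: each factor goes to one
  of the two sides and the order is kept. Membership in the span suffices for all uses;
  multiplicities are not recorded.\<close>

lemma Delta_prod_list: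
  assumes "\<And>x. x \<in> set l \<Longrightarrow> f x \<in> lie_elems"
  shows "Delta (prod_list (map f l)) \<in>
    pm.span {inl1 (prod_list (map f u)) * inl2 (prod_list (map f v)) | u v. l \<in> shuffles u v}"
  using assms
proof (induction l)
  case Nil
  show ?case
    by (rule pm.span_base) (auto intro!: exI[of _ "[]"])
next
  case (Cons y l)
  let ?S = "\<lambda>l. {inl1 (prod_list (map f u)) * inl2 (prod_list (map f v)) | u v. l \<in> shuffles u v}"
  have "(inl1 (f y) + inl2 (f y)) * Delta (prod_list (map f l)) \<in> pm.span (?S (y # l))"
  proof (rule plinear_span_subset[OF plinear_const_mult pm.subspace_span])
    show "Delta (prod_list (map f l)) \<in> pm.span (?S l)"
      using Cons by simp
    fix z assume "z \<in> ?S l"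
    then obtain u v where z: "z = inl1 (prod_list (map f u)) * inl2 (prod_list (map f v))"
      and uv: "l \<in> shuffles u v" by blast
    have "inl1 (f y) * z = inl1 (prod_list (map f (y # u))) * inl2 (prod_list (map f v))"
      by (simp add: z inl1_mult mult.assoc)
    then have 1: "inl1 (f y) * z \<in> ?S (y # l)"
      using Cons_in_shuffles_leftI[OF uv] by (intro CollectI exI conjI)
    have "inl2 (f y) * z = inl1 (prod_list (map f u)) * inl2 (prod_list (map f (y # v)))"
      by (simp add: z inl2_mult mult.assoc[symmetric] inl1_inl2_commute)
    then have 2: "inl2 (f y) * z \<in> ?S (y # l)"
      using Cons_in_shuffles_rightI[OF uv] by (intro CollectI exI conjI)
    show "(inl1 (f y) + inl2 (f y)) * z \<in> pm.span (?S (y # l))"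
      using pm.span_add[OF pm.span_base[OF 1] pm.span_base[OF 2]] by (simp add: distrib_right)
  qed
  then show ?case
    using Cons.prems by (simp add: Delta_mult Delta_lie)
qed

lemma adams_prod_list:
  assumes "\<And>x. x \<in> set l \<Longrightarrow> f x \<in> lie_elems" "pm.subspace V"
    and "\<And>u v. l \<in> shuffles u v \<Longrightarrow> prod_list (map f u) * prod_list (map f v) \<in> V"
  shows "adams (prod_list (map f l)) \<in> V"
  unfolding adams_def
  by (rule plinear_span_subset[OF plinear_mu assms(2) _ Delta_prod_list[of l f, OF assms(1)]])
    (auto simp: mu_inl1_inl2 assms(3))

lemma adams_deg_ge:
  assumes "p \<in> deg_ge n"
  shows "adams p \<in> deg_ge n"
proof (rule plinear_deg_ge[OF plinear_adams subspace_deg_ge _ assms])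
  fix l :: "'a list" assume l: "n \<le> length l"
  have "adams (prod_list (map indet l)) \<in> (deg_ge n :: ('a, 'b) ncpoly set)"
  proof (rule adams_prod_list[OF indet_lie_elems subspace_deg_ge])
    fix u v assume "l \<in> shuffles u v"
    then have "length (u @ v) = length l"
      by (simp add: length_shuffles)
    then show "prod_list (map indet u) * prod_list (map indet v) \<in> (deg_ge n :: ('a, 'b) ncpoly set)"
      using l by (simp add: prod_list_map_indet word_append[symmetric] word_deg_ge)
  qed
  then show "adams (word l) \<in> (deg_ge n :: ('a, 'b) ncpoly set)"
    by (simp add: prod_list_map_indet)
qed

lemma one_tensor_word:
  "(1 :: 'a free_monoid \<times> 'b free_monoid \<Rightarrow>\<^sub>0 'k::field) = single (Word [], Word []) 1"
  by (simp add: zero_prod_def[symmetric] zero_free_monoid_def[symmetric])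

text \<open>Renaming letters is a bialgebra map. Its purpose is that \<open>q\<close> commutes with
  the projection onto Lie elements.\<close>

lemma Delta_subst_indet:
  fixes w :: "'a \<Rightarrow> 'b" and p :: "('a, 'c::field) ncpoly"
  shows "Delta (subst (\<lambda>x. indet (w x)) p)
    = lin (\<lambda>(u, v). single (Word (map w (letters u)), Word (map w (letters v))) 1) (Delta p)"
  (is "_ = ?Q (Delta p)")
proof -
  let ?q = "subst (\<lambda>x. indet (w x)) :: ('a, 'c) ncpoly \<Rightarrow> ('b, 'c) ncpoly"
  have Q_mult: "?Q (y * z) = ?Q y * ?Q z" for y z
    by (rule lin_mult) (auto simp: plus_free_monoid_def mult_single)
  have "Delta (?q (word l)) = ?Q (Delta (word l))" for l
  proof (induction l)
    case Nil
    have "?Q 1 = 1"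
      by (simp add: one_tensor_word)
    then show ?case by simp
  next
    case (Cons x l)
    have "Delta (?q (indet x)) = ?Q (Delta (indet x))"
      by (simp add: Delta_def lin_add inl1_def inl2_def) (simp add: indet_def zero_free_monoid_def)
    then show ?case
      using Cons by (simp add: word_Cons subst_mult Delta_mult Q_mult)
  qed
  then show ?thesis
    by (rule plinear_eq_words[OF plinear_comp[OF plinear_Delta plinear_subst]
          plinear_comp[OF plinear_lin plinear_Delta]])
qed

lemma adams_subst_indet:
  fixes w :: "'a \<Rightarrow> 'b" and p :: "('a, 'c::field) ncpoly"
  shows "adams (subst (\<lambda>x. indet (w x)) p) = subst (\<lambda>x. indet (w x)) (adams p)"
proof -
  let ?q = "subst (\<lambda>x. indet (w x)) :: ('a, 'c) ncpoly \<Rightarrow> ('b, 'c) ncpoly"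
  let ?Q = "lin (\<lambda>(u, v). single (Word (map w (letters u)), Word (map w (letters v))) (1::'c))"
  have "mu (?Q z) = ?q (mu z)" for z
  proof (rule plinear_eqI[of "\<lambda>z. mu (?Q z)" "\<lambda>z. ?q (mu z)"])
    fix uv :: "'a free_monoid \<times> 'a free_monoid"
    have "(\<lambda>x. indet (w x)) = (indet :: _ \<Rightarrow> ('b, 'c) ncpoly) \<circ> w" by auto
    then show "mu (?Q (single uv 1)) = ?q (mu (single uv 1))"
      by (cases uv) (simp add: mu_def plus_free_monoid_def single_word
          map_map[symmetric] prod_list_map_indet word_append subst_mult del: map_map)
  qed (rule plinear_comp[OF plinear_mu plinear_lin] plinear_comp[OF plinear_subst plinear_mu])+
  then show ?thesis
    by (simp add: adams_def Delta_subst_indet)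
qed

section \<open>Lie ideals and the ideals they generate\<close>

definition lie_ideal :: "('a, 'k::field) ncpoly set \<Rightarrow> bool" where
  "lie_ideal R \<longleftrightarrow> pm.subspace R \<and> R \<subseteq> lie_elems \<and> (\<forall>r\<in>R. \<forall>x\<in>lie_elems. comm r x \<in> R)"

lemma lie_ideal_lie_elems: "lie_ideal lie_elems"
  by (simp add: lie_ideal_def subspace_lie_elems comm_lie_elems)

lemma lie_idealD:
  assumes "lie_ideal R"
  shows "pm.subspace R" "r \<in> R \<Longrightarrow> r \<in> lie_elems" "r \<in> R \<Longrightarrow> x \<in> lie_elems \<Longrightarrow> comm r x \<in> R"
  using assms by (auto simp: lie_ideal_def)

lemma lie_ideal_comm_right: "lie_ideal R \<Longrightarrow> r \<in> R \<Longrightarrow> x \<in> lie_elems \<Longrightarrow> comm x r \<in> R"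
  using pm.subspace_neg[of R "comm r x"] by (simp add: lie_ideal_def)

text \<open>A Poincare-Birkhoff-Witt type filtration by the number of Lie factors, restricted to
  products inside the ideal generated by \<open>R\<close>. At \<open>k = 0\<close> it is the zero
  space, since the empty product has no factor in \<open>R\<close>.\<close>

definition lie_products :: "('a, 'k::field) ncpoly set \<Rightarrow> nat \<Rightarrow> ('a, 'k) ncpoly set" where
  "lie_products R k = pm.span {prod_list l | l. length l \<le> k \<and> set l \<subseteq> lie_elems \<and> set l \<inter> R \<noteq> {}}"

lemma subspace_lie_products: "pm.subspace (lie_products R k)"
  by (simp add: lie_products_def)

lemma prod_list_lie_products:
  "length l \<le> k \<Longrightarrow> set l \<subseteq> lie_elems \<Longrightarrow> set l \<inter> R \<noteq> {} \<Longrightarrow> prod_list l \<in> lie_products R k"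
  unfolding lie_products_def by (rule pm.span_base) blast

lemma lie_products_mono: "j \<le> k \<Longrightarrow> p \<in> lie_products R j \<Longrightarrow> p \<in> lie_products R k"
  unfolding lie_products_def by (erule pm.span_mono[THEN subsetD, rotated]) auto

lemma lie_products_1:
  assumes "lie_ideal R"
  shows "lie_products R (Suc 0) = R"
proof
  show "lie_products R (Suc 0) \<subseteq> R"
    unfolding lie_products_def
  proof (rule pm.span_minimal[OF _ lie_idealD(1)[OF assms]], clarify)
    fix l :: "('a, 'b) ncpoly list" assume "length l \<le> Suc 0" "set l \<inter> R \<noteq> {}"
    then show "prod_list l \<in> R"
      by (cases l) auto
  qed
  show "R \<subseteq> lie_products R (Suc 0)"
  proof
    fix r assume "r \<in> R"
    then show "r \<in> lie_products R (Suc 0)"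
      using prod_list_lie_products[of "[r]" "Suc 0" R] lie_idealD(2)[OF assms] by simp
  qed
qed

lemma mult_lie_products:
  assumes "p \<in> lie_products R k" "y \<in> lie_elems"
  shows "y * p \<in> lie_products R (Suc k)"
proof (rule plinear_span_subset[OF plinear_const_mult subspace_lie_products _ assms(1)[unfolded lie_products_def]],
    clarify)
  fix l :: "('a, 'b) ncpoly list" assume l: "length l \<le> k" "set l \<subseteq> lie_elems" "set l \<inter> R \<noteq> {}"
  then show "y * prod_list l \<in> lie_products R (Suc k)"
    using prod_list_lie_products[of "y # l" "Suc k" R] assms(2) by auto
qed

lemma mult_lie_products_lie_elems:
  assumes "p \<in> lie_products lie_elems k" "y \<in> lie_elems" "y \<in> R"
  shows "y * p \<in> lie_products R (Suc k)"
proof (rule plinear_span_subset[OF plinear_const_mult subspace_lie_products _ assms(1)[unfolded lie_products_def]],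
    clarify)
  fix l :: "('a, 'b) ncpoly list" assume l: "length l \<le> k" "set l \<subseteq> lie_elems"
  then show "y * prod_list l \<in> lie_products R (Suc k)"
    using prod_list_lie_products[of "y # l" "Suc k" R] assms(2,3) by auto
qed

lemma comm_prod_list:
  fixes y :: "'r::ring_1"
  shows "comm (prod_list u) y = (\<Sum>i<length u. prod_list (u[i := comm (u ! i) y]))"
proof (induction u)
  case (Cons a u)
  have "comm (prod_list (a # u)) y = comm a y * prod_list u + a * comm (prod_list u) y"
    by (simp add: algebra_simps)
  also have "\<dots> = (\<Sum>i<length (a # u). prod_list ((a # u)[i := comm ((a # u) ! i) y]))"
    by (simp add: Cons sum.lessThan_Suc_shift sum_distrib_left del: sum.lessThan_Suc)
  finally show ?case .
qed simp

text \<open>The commutator with \<open>y\<close> is a derivation, so \<open>y\<close> is absorbed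
  into one factor and the number of factors stays that of \<open>u @ v\<close>. A factor in
  \<open>R\<close> survives: either the new commutator is in \<open>R\<close> because one of its
  entries is, or the factor in \<open>R\<close> stands elsewhere and is untouched.\<close>

lemma comm_mult_lie_products:
  assumes R: "lie_ideal R" and y: "y \<in> lie_elems"
    and l: "length (u @ v) \<le> k" "set (u @ v) \<subseteq> lie_elems" "y \<in> R \<or> set (u @ v) \<inter> R \<noteq> {}"
  shows "comm (prod_list u) y * prod_list v \<in> lie_products R k"
proof -
  have "prod_list (u[i := comm (u ! i) y] @ v) \<in> lie_products R k" if i: "i < length u" for i
  proof (rule prod_list_lie_products)
    have ui: "u ! i \<in> lie_elems" using l(2) i by auto
    have cm: "comm (u ! i) y \<in> lie_elems" using comm_lie_elems[OF ui y] .
    show "set (u[i := comm (u ! i) y] @ v) \<subseteq> lie_elems"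
      using l(2) cm set_update_subset_insert[of u i "comm (u ! i) y"] by auto
    have in_set: "comm (u ! i) y \<in> set (u[i := comm (u ! i) y])"
      using i by (simp add: set_update_memI)
    show "set (u[i := comm (u ! i) y] @ v) \<inter> R \<noteq> {}"
    proof (cases "comm (u ! i) y \<in> R")
      case True
      then show ?thesis using in_set by auto
    next
      case False
      then have "y \<notin> R" "u ! i \<notin> R"
        using lie_idealD(3)[OF R _ y] lie_ideal_comm_right[OF R _ ui] by auto
      then obtain r where r: "r \<in> set (u @ v)" "r \<in> R" using l(3) by blast
      have "r \<in> set (u[i := comm (u ! i) y] @ v)"
      proof (cases "r \<in> set u")
        case True
        then obtain j where j: "j < length u" "u ! j = r"
          by (auto simp: in_set_conv_nth)
        then have "j \<noteq> i" using r \<open>u ! i \<notin> R\<close> by auto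
        then have "u[i := comm (u ! i) y] ! j = r" using j by simp
        then have "r \<in> set (u[i := comm (u ! i) y])"
          using j by (metis length_list_update nth_mem)
        then show ?thesis by simp
      qed (use r in auto)
      then show ?thesis using r by blast
    qed
  qed (use l(1) in simp)
  then show ?thesis
    by (simp add: comm_prod_list sum_distrib_right)
      (intro pm.subspace_sum subspace_lie_products, simp)
qed

text \<open>Splitting off the first factor \<open>y\<close> gives
  \<open>adams (y * b) = 2 * y * adams b\<close> plus an error made of commutators with
  \<open>y\<close>, which have one factor fewer than \<open>y * b\<close>. The ideal
  \<open>R\<close> is generalised in the induction, since \<open>y\<close> may be the only factor in
  \<open>R\<close>.\<close>

lemma adams_prod_list_top:
  assumes "lie_ideal R" "set l \<subseteq> lie_elems" "set l \<inter> R \<noteq> {}" "length l = Suc k"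
  shows "adams (prod_list l) - sc (2 ^ Suc k) (prod_list l) \<in> lie_products R k"
  using assms
proof (induction l arbitrary: R k)
  case (Cons y l)
  note R = Cons.prems(1)
  have y: "y \<in> lie_elems" using Cons.prems by simp
  show ?case
  proof (cases l)
    case Nil
    then show ?thesis
      using Cons.prems adams_lie[OF y] by (simp add: pm.subspace_0 subspace_lie_products)
  next
    case (Cons y' l')
    then obtain k' where k': "k = Suc k'" "length l = Suc k'" using Cons.prems by auto
    define b where "b = prod_list l"
    \<comment> \<open>The cost of having \<open>y\<close> between the two tensor factors instead of
      in front of them; on an unshuffled product it is
      \<open>comm (prod_list u) y * prod_list v\<close>.\<close>
    define eta where "eta z = mu (inl2 y * z) - mu (inl1 y * z)" for z
    have "plinear eta"
      unfolding eta_def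
      by (intro pmp.linear_compose_sub plinear_comp[OF plinear_mu plinear_const_mult])
    then have eta: "eta (Delta b) \<in> lie_products R k"
    proof (rule plinear_span_subset[OF _ subspace_lie_products])
      show "Delta b \<in> pm.span {inl1 (prod_list (map (\<lambda>x. x) u)) * inl2 (prod_list (map (\<lambda>x. x) v)) |
          u v. l \<in> shuffles u v}"
        using Delta_prod_list[of l "\<lambda>x. x"] Cons.prems by (auto simp: b_def)
    next
      fix z assume "z \<in> {inl1 (prod_list (map (\<lambda>x. x) u)) * inl2 (prod_list (map (\<lambda>x. x) v)) |
          u v. l \<in> shuffles u v}"
      then obtain u v where z: "z = inl1 (prod_list u) * inl2 (prod_list v)" and uv: "l \<in> shuffles u v"
        by auto
      have len: "length (u @ v) = length l" and sets: "set (u @ v) = set l"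
        using uv by (simp_all add: length_shuffles set_shuffles)
      have "mu (inl2 y * z) = prod_list u * y * prod_list v"
        by (simp add: z inl1_inl2_commute_left inl2_mult[symmetric] mu_inl1_inl2 mult.assoc)
      moreover have "mu (inl1 y * z) = y * prod_list u * prod_list v"
        by (simp add: z mu_inl1_mult mult.assoc)
      ultimately have "eta z = comm (prod_list u) y * prod_list v"
        by (simp add: eta_def left_diff_distrib)
      moreover have "comm (prod_list u) y * prod_list v \<in> lie_products R k"
        using Cons.prems k' len sets by (intro comm_mult_lie_products[OF R y]) auto
      ultimately show "eta z \<in> lie_products R k" by simp
    qed
    have "adams (y * b) = mu (inl1 y * Delta b) + mu (inl2 y * Delta b)"
      by (simp add: adams_def Delta_mult Delta_lie[OF y] distrib_right pmp.linear_add[OF plinear_mu])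
    also have "\<dots> = sc 2 (y * adams b) + eta (Delta b)"
      using pm.scale_left_distrib[of 1 1 "y * adams b"] by (simp add: eta_def mu_inl1_mult adams_def)
    finally have eq: "adams (y * b) - sc (2 ^ Suc k) (y * b)
        = sc 2 (y * (adams b - sc (2 ^ Suc k') b)) + eta (Delta b)"
      by (simp add: right_diff_distrib pm.scale_right_diff_distrib sc_mult k')
    have "y * (adams b - sc (2 ^ Suc k') b) \<in> lie_products R k"
    proof (cases "set l \<inter> R \<noteq> {}")
      case True
      then have "adams b - sc (2 ^ Suc k') b \<in> lie_products R k'"
        using Cons.IH[OF R _ True k'(2)] Cons.prems by (simp add: b_def)
      then show ?thesis using mult_lie_products y k' by blast
    next
      \<comment> \<open>Here \<open>y\<close> itself is the factor in \<open>R\<close>, and the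
        induction hypothesis is used with the Lie ideal \<open>lie_elems\<close> for the remaining
        factors.\<close>
      case False
      then have "adams b - sc (2 ^ Suc k') b \<in> lie_products lie_elems k'"
        using Cons.IH[OF lie_ideal_lie_elems _ _ k'(2)] Cons.prems \<open>l = y' # l'\<close> by (simp add: b_def)
      then show ?thesis
        using mult_lie_products_lie_elems y k' False Cons.prems by auto
    qed
    then have "adams (y * b) - sc (2 ^ Suc k) (y * b) \<in> lie_products R k"
      unfolding eq using eta by (intro pm.subspace_add pm.subspace_scale subspace_lie_products)
    then show ?thesis
      by (simp add: b_def del: power_Suc)
  qed
qed simp

lemma adams_lie_products:
  assumes "lie_ideal R" "p \<in> lie_products R (Suc k)"
  shows "adams p - sc (2 ^ Suc k) p \<in> lie_products R k"
proof (rule plinear_span_subset[OF _ subspace_lie_products _ assms(2)[unfolded lie_products_def]])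
  show "plinear (\<lambda>p. adams p - sc (2 ^ Suc k) p)"
    by (intro pmp.linear_compose_sub plinear_adams pmp.linear_compose_scale_right plinear_id)
  fix x :: "('a, 'b) ncpoly"
  assume "x \<in> {prod_list l |l. length l \<le> Suc k \<and> set l \<subseteq> lie_elems \<and> set l \<inter> R \<noteq> {}}"
  then obtain l where x: "x = prod_list l"
    and l: "length l \<le> Suc k" "set l \<subseteq> lie_elems" "set l \<inter> R \<noteq> {}" by blast
  from l(3) obtain j where j: "length l = Suc j" by (cases l) auto
  have top: "adams x - sc (2 ^ Suc j) x \<in> lie_products R j"
    unfolding x by (rule adams_prod_list_top[OF assms(1) l(2,3) j])
  show "adams x - sc (2 ^ Suc k) x \<in> lie_products R k"
  proof (cases "j = k")
    case False
    then have jk: "Suc j \<le> k" using l j by simp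
    have "x \<in> lie_products R k"
      unfolding x using l j jk by (intro prod_list_lie_products) auto
    moreover have "adams x - sc (2 ^ Suc k) x = (adams x - sc (2 ^ Suc j) x)
        + (sc (2 ^ Suc j) x - sc (2 ^ Suc k) x)" by simp
    ultimately show ?thesis
      using lie_products_mono[OF _ top, of k] jk
      by (metis Suc_leD pm.subspace_add pm.subspace_diff pm.subspace_scale subspace_lie_products)
  qed (use top in simp)
qed

section \<open>The projection onto Lie elements\<close>

definition adams_factor :: "'k::field \<Rightarrow> ('a, 'k) ncpoly \<Rightarrow> ('a, 'k) ncpoly" where
  "adams_factor c p = sc (1 / (2 - c)) (adams p - sc c p)"

text \<open>Lagrange interpolation in \<open>adams\<close>: value 1 at the eigenvalue 2, value 0 at
  1 (constants) and at the powers of 2 from the second to the \<open>(n + 1)\<close>-st. On products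
  of at most \<open>n + 1\<close> Lie elements this is the projection onto Lie elements.\<close>

primrec lie_proj :: "nat \<Rightarrow> ('a, 'k::field_char_0) ncpoly \<Rightarrow> ('a, 'k) ncpoly" where
  "lie_proj 0 p = adams_factor 1 p"
| "lie_proj (Suc n) p = lie_proj n (adams_factor (2 ^ Suc (Suc n)) p)"

lemma plinear_adams_factor: "plinear (adams_factor c)"
  unfolding adams_factor_def
  by (intro pmp.linear_compose_scale_right pmp.linear_compose_sub plinear_adams plinear_id)

lemma plinear_lie_proj: "plinear (lie_proj n)"
proof (induction n)
  case (Suc n)
  then show ?case
    using plinear_comp[OF Suc plinear_adams_factor] by (simp add: fun_eq_iff)
qed (simp add: plinear_adams_factor)

lemma lie_proj_closed:
  assumes "pm.subspace V" "\<And>p. p \<in> V \<Longrightarrow> adams p \<in> V" "p \<in> V"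
  shows "lie_proj n p \<in> V"
proof -
  have *: "adams_factor c p \<in> V" if "p \<in> V" for c p
    unfolding adams_factor_def using assms that
    by (intro pm.subspace_scale[OF assms(1)] pm.subspace_diff[OF assms(1)])
  show ?thesis
    using assms(3) by (induction n arbitrary: p) (simp_all add: *)
qed

text \<open>Characteristic zero enters here: it separates the eigenvalue 2 from the higher ones, so
  that the denominators \<open>2 - c\<close> are invertible.\<close>

lemma two_power_neq_two: "(2::'k::field_char_0) ^ Suc (Suc n) \<noteq> 2"
proof
  assume "(2::'k) ^ Suc (Suc n) = 2"
  then have "of_nat (2 ^ Suc (Suc n)) = (of_nat 2 :: 'k)" by simp
  then have "(2::nat) ^ Suc (Suc n) = 2" by (simp only: of_nat_eq_iff)
  moreover have "(2::nat) ^ Suc (Suc n) > 2" by (induction n) auto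
  ultimately show False by simp
qed

lemma lie_proj_lie:
  assumes "r \<in> lie_elems"
  shows "lie_proj n r = r"
proof -
  have *: "adams_factor c r = r" if "c \<noteq> 2" for c
    using that by (simp add: adams_factor_def adams_lie[OF assms] pm.scale_left_diff_distrib[symmetric])
  show ?thesis
    by (induction n) (simp_all add: * two_power_neq_two del: power_Suc)
qed

lemma lie_proj_comm:
  assumes "x \<in> lie_elems"
  shows "lie_proj n (comm a x) = comm (lie_proj n a) x"
proof -
  have *: "adams_factor c (comm a x) = comm (adams_factor c a) x" for c a
    by (simp add: adams_factor_def adams_comm[OF assms] sc_mult algebra_simps
        pm.scale_right_diff_distrib)
  show ?thesis
    by (induction n arbitrary: a) (simp_all add: *)
qed

lemma lie_proj_const: "lie_proj n (sc c 1) = 0"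
proof -
  have *: "adams_factor d (sc c 1) = sc (c * (1 - d) / (2 - d)) 1" for c d :: 'b
    by (simp add: adams_factor_def pmp.linear_scale[OF plinear_adams] pm.scale_left_diff_distrib[symmetric]
        right_diff_distrib mult.commute)
  show ?thesis
    by (induction n arbitrary: c) (simp_all add: * del: power_Suc)
qed

text \<open>Each interpolation factor removes the top eigenvalue and so lowers the filtration by one
  step, until a single factor is left. That factor is in \<open>R\<close> and is fixed by the factor
  for the eigenvalue 1.\<close>

lemma lie_proj_lie_products:
  assumes "lie_ideal R" "p \<in> lie_products R (Suc n)"
  shows "lie_proj n p \<in> R"
  using assms(2)
proof (induction n arbitrary: p)
  case 0
  then have "p \<in> R" using lie_products_1[OF assms(1)] by simp
  then show ?case
    using lie_proj_lie[of p 0] lie_idealD(2)[OF assms(1)] by auto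
next
  case (Suc n)
  have "adams_factor (2 ^ Suc (Suc n)) p \<in> lie_products R (Suc n)"
    unfolding adams_factor_def
    by (intro pm.subspace_scale subspace_lie_products adams_lie_products[OF assms(1) Suc.prems])
  then show ?case using Suc.IH by simp
qed

lemma lie_proj_deg_ge: "p \<in> deg_ge m \<Longrightarrow> lie_proj n p \<in> deg_ge m"
  by (rule lie_proj_closed[OF subspace_deg_ge adams_deg_ge])

lemma lie_proj_subst_indet:
  fixes w :: "'a \<Rightarrow> 'b" and p :: "('a, 'k::field_char_0) ncpoly"
  shows "lie_proj n (subst (\<lambda>x. indet (w x)) p) = subst (\<lambda>x. indet (w x)) (lie_proj n p)"
proof -
  have *: "adams_factor c (subst (\<lambda>x. indet (w x)) p) = subst (\<lambda>x. indet (w x)) (adams_factor c p)"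
    for c :: 'k and p
    by (simp add: adams_factor_def adams_subst_indet subst_diff subst_sc)
  show ?thesis
    by (induction n arbitrary: p) (simp_all add: *)
qed

lemma diff_lie_proj_deg_ge_2:
  assumes "p \<in> deg_ge 1"
  shows "p - lie_proj n p \<in> deg_ge 2"
proof (rule plinear_deg_ge[OF _ subspace_deg_ge _ assms])
  show "plinear (\<lambda>p. p - lie_proj n p :: ('a, 'b) ncpoly)"
    by (intro pmp.linear_compose_sub plinear_id plinear_lie_proj)
  fix l :: "'a list" assume l: "1 \<le> length l"
  show "word l - lie_proj n (word l) \<in> (deg_ge 2 :: ('a, 'b) ncpoly set)"
  proof (cases "length l = 1")
    case True
    then obtain x where "l = [x]" by (cases l) auto
    then have "word l \<in> (lie_elems :: ('a, 'b) ncpoly set)"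
      using indet_lie_elems by (simp add: indet_word[symmetric])
    then show ?thesis
      by (simp add: lie_proj_lie pm.subspace_0[OF subspace_deg_ge])
  next
    case False
    then have "word l \<in> (deg_ge 2 :: ('a, 'b) ncpoly set)"
      using l by (intro word_deg_ge) simp
    then show ?thesis
      using lie_proj_deg_ge by (intro pm.subspace_diff[OF subspace_deg_ge])
  qed
qed

subsection \<open>Generated ideals\<close>

text \<open>The two-sided ideal as finite sums of \<open>a * r * b\<close>. Scalars are absorbed
  into \<open>a\<close>, so a linear map needs to be examined on such products only.\<close>

inductive_set idl :: "'r::ring_1 set \<Rightarrow> 'r set" for A where
  idl_zero: "0 \<in> idl A"
| idl_step: "x \<in> idl A \<Longrightarrow> r \<in> A \<Longrightarrow> x + a * r * b \<in> idl A"

lemma idl_gen: "r \<in> A \<Longrightarrow> a * r * b \<in> idl A"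
  using idl_step[OF idl_zero] by fastforce

lemma idl_base: "r \<in> A \<Longrightarrow> r \<in> idl A"
  using idl_gen[of r A 1 1] by simp

lemma idl_add:
  assumes "x \<in> idl A" "y \<in> idl A"
  shows "x + y \<in> idl A"
  using assms(2,1) by (induction rule: idl.induct) (auto simp: add.assoc[symmetric] intro: idl_step)

lemma idl_mult_left: "x \<in> idl A \<Longrightarrow> c * x \<in> idl A"
  by (induction rule: idl.induct)
    (auto simp: distrib_left mult.assoc[symmetric] intro: idl_step idl_zero)

lemma idl_mult_right: "x \<in> idl A \<Longrightarrow> x * c \<in> idl A"
proof (induction rule: idl.induct)
  case (idl_step x r a b)
  then show ?case
    using idl.idl_step[of "x * c" A r a "b * c"] by (simp add: distrib_right mult.assoc)
qed (simp add: idl_zero)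

lemma idl_minus: "x \<in> idl A \<Longrightarrow> - x \<in> idl A"
  using idl_mult_left[of x A "-1"] by simp

lemma idl_diff: "x \<in> idl A \<Longrightarrow> y \<in> idl A \<Longrightarrow> x - y \<in> idl A"
  using idl_add[OF _ idl_minus[of y A], of x] by simp

lemma idl_subset:
  assumes "A \<subseteq> idl B"
  shows "idl A \<subseteq> idl B"
proof
  fix x assume "x \<in> idl A"
  then show "x \<in> idl B"
  proof (induction rule: idl.induct)
    case (idl_step x r a b)
    then have "a * r * b \<in> idl B" using assms idl_mult_left idl_mult_right by blast
    then show ?case using idl_step idl_add by blast
  qed (rule idl_zero)
qed

lemma idl_mono: "A \<subseteq> B \<Longrightarrow> x \<in> idl A \<Longrightarrow> x \<in> idl B"
  using idl_subset[of A B] idl_base by blast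

lemma idl_idl [simp]: "idl (idl A) = idl A"
  using idl_subset[of "idl A" A] idl_base by blast

lemma subspace_idl: "pm.subspace (idl A)"
  by (rule pm.subspaceI) (auto simp: idl_zero sc_def intro: idl_add idl_mult_left)

lemma plinear_idl:
  assumes "plinear f" "pm.subspace V" "\<And>a r b. r \<in> A \<Longrightarrow> f (a * r * b) \<in> V" "p \<in> idl A"
  shows "f p \<in> V"
  using assms(4)
  by (induction rule: idl.induct)
    (auto simp: pmp.linear_0[OF assms(1)] pmp.linear_add[OF assms(1)] assms(3)
      pm.subspace_0[OF assms(2)] intro: pm.subspace_add[OF assms(2)])

lemma subst_idl:
  assumes "p \<in> idl A" "\<And>r. r \<in> A \<Longrightarrow> subst v r \<in> idl B"
  shows "subst v p \<in> idl B"
  by (rule plinear_idl[OF plinear_subst subspace_idl _ assms(1)])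
    (simp add: subst_mult idl_mult_left idl_mult_right assms(2))

lemma subst_diff_idl:
  assumes "\<And>x. u x - v x \<in> idl A"
  shows "subst u p - subst v p \<in> idl A"
proof (rule plinear_in_subspace[of "\<lambda>p. subst u p - subst v p", OF _ subspace_idl])
  show "plinear (\<lambda>p. subst u p - subst v p)"
    by (rule pmp.linear_compose_sub[OF plinear_subst plinear_subst])
  have "subst u (word l) - subst v (word l) \<in> idl A" for l
  proof (induction l)
    case (Cons x l)
    have "subst u (word (x # l)) - subst v (word (x # l))
        = (u x - v x) * subst u (word l) + v x * (subst u (word l) - subst v (word l))"
      by (simp add: algebra_simps)
    then show ?case
      using Cons assms by (metis idl_add idl_mult_left idl_mult_right)
  qed (simp add: idl_zero)
  then show "subst u (single w 1) - subst v (single w 1) \<in> idl A" for w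
    by (simp add: single_word)
qed

lemma bilinear_words:
  fixes a b r :: "('a, 'k::field) ncpoly"
  assumes "pm.subspace V" "a \<in> deg_ge i" "b \<in> deg_ge j"
    and "\<And>u v. i \<le> length u \<Longrightarrow> j \<le> length v \<Longrightarrow> word u * r * word v \<in> V"
  shows "a * r * b \<in> V"
proof -
  have "word u * r * b \<in> V" if "i \<le> length u" for u
    using plinear_deg_ge[OF plinear_const_mult assms(1) _ assms(3), of "word u * r"] assms(4)[OF that] .
  then show ?thesis
    using plinear_deg_ge[OF plinear_mult_const assms(1) _ assms(2), of "r * b"] by (simp add: mult.assoc)
qed

text \<open>A product \<open>word u * r * word v\<close> has \<open>length u + 1 + length v\<close>
  Lie factors. With at most \<open>N + 1\<close> of them it is covered by
  \<open>lie_proj_lie_products\<close>; with more, its words are long and remain so under the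
  projection. As Lie elements are fixed, the ideal generated by \<open>R\<close> meets
  \<open>lie_elems\<close> only in \<open>R\<close>, up to long words.\<close>

lemma lie_proj_idl:
  assumes R: "lie_ideal R" and p: "p \<in> idl (R \<union> deg_ge N)"
  obtains r where "r \<in> R" "lie_proj N p - r \<in> deg_ge N"
proof -
  let ?V = "{p. \<exists>r\<in>R. p - r \<in> deg_ge N}"
  have V: "pm.subspace ?V"
  proof (rule pm.subspaceI)
    have R0: "pm.subspace R" using lie_idealD[OF R] by blast
    show "0 \<in> ?V"
      using pm.subspace_0[OF R0] pm.subspace_0[OF subspace_deg_ge[of N]] by force
    show "x + y \<in> ?V" if "x \<in> ?V" "y \<in> ?V" for x y
    proof -
      from that obtain r s where rs: "r \<in> R" "s \<in> R" "x - r \<in> deg_ge N" "y - s \<in> deg_ge N" by blast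
      then show ?thesis
        using pm.subspace_add[OF R0, of r s] pm.subspace_add[OF subspace_deg_ge rs(3,4)]
        by (auto intro!: bexI[of _ "r + s"] simp: algebra_simps)
    qed
    show "sc c x \<in> ?V" if "x \<in> ?V" for c x
    proof -
      from that obtain r where r: "r \<in> R" "x - r \<in> deg_ge N" by blast
      then show ?thesis
        using pm.subspace_scale[OF R0 r(1), of c] pm.subspace_scale[OF subspace_deg_ge r(2), of c]
        by (auto intro!: bexI[of _ "sc c r"] simp: pm.scale_right_diff_distrib)
    qed
  qed
  have big: "lie_proj N p \<in> ?V" if "p \<in> deg_ge N" for p
    using lie_proj_deg_ge[OF that, of N] pm.subspace_0[OF lie_idealD(1)[OF R]]
    by (auto intro!: bexI[of _ 0])
  have "lie_proj N (a * r * b) \<in> ?V" if "r \<in> R \<union> deg_ge N" for a r b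
    using that
  proof
    assume "r \<in> deg_ge N"
    then show ?thesis
      by (intro big deg_ge_mult_left deg_ge_mult_right)
  next
    assume r: "r \<in> R"
    have "a * r * b \<in> {p. lie_proj N p \<in> ?V}"
    proof (rule bilinear_words[OF subspace_vimage[OF plinear_lie_proj V], of _ 0 _ 0])
      fix u v :: "'a list"
      show "word u * r * word v \<in> {p. lie_proj N p \<in> ?V}"
      proof (cases "length u + 1 + length v \<le> Suc N")
        case True
        have "prod_list (map indet u @ [r] @ map indet v) \<in> lie_products R (Suc N)"
          using True r lie_idealD(2)[OF R] indet_lie_elems by (intro prod_list_lie_products) auto
        then have "lie_proj N (word u * r * word v) \<in> R"
          using lie_proj_lie_products[OF R] by (simp add: prod_list_map_indet mult.assoc)
        then show ?thesis
          using pm.subspace_0[OF subspace_deg_ge] by force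
      next
        case False
        have "word u * r * word v \<in> deg_ge (length u + 1 + length v)"
          using lie_elems_deg_ge lie_idealD(2)[OF R] r by (intro deg_ge_mult word_deg_ge) auto
        then have "word u * r * word v \<in> deg_ge N"
          using False by (intro deg_ge_antimono[of N "length u + 1 + length v"]) auto
        then show ?thesis
          using big by blast
      qed
    qed simp_all
    then show ?thesis by simp
  qed
  then have "lie_proj N p \<in> ?V"
    by (intro plinear_idl[OF plinear_lie_proj V _ p])
  then show thesis using that by blast
qed

text \<open>This is \<open>lie_proj_idl\<close> for \<open>R = lie_elems\<close>: that ideal
  contains every polynomial without constant term, and constants are killed by the
  projection.\<close>

lemma lie_proj_lie_elems:
  obtains l where "l \<in> lie_elems" "lie_proj N p - l \<in> deg_ge N"
proof -
  have "p - sc (lookup p 0) 1 \<in> deg_ge 1"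
    by (rule diff_const_deg_ge_1)
  moreover have "word l \<in> idl (lie_elems \<union> deg_ge N)" if "1 \<le> length l" for l
  proof -
    obtain x l' where "l = x # l'" using \<open>1 \<le> length l\<close> by (cases l) auto
    then show ?thesis
      using idl_gen[where a = 1 and b = "word l'", OF UnI1[OF indet_lie_elems]]
      by (simp add: word_Cons)
  qed
  ultimately have *: "p - sc (lookup p 0) 1 \<in> idl (lie_elems \<union> deg_ge N)"
    using plinear_deg_ge[OF plinear_id subspace_idl] by blast
  have "lie_proj N (p - sc (lookup p 0) 1) = lie_proj N p"
    by (simp add: pmp.linear_diff[OF plinear_lie_proj] lie_proj_const)
  then show thesis
    using lie_proj_idl[OF lie_ideal_lie_elems *] that by metis
qed

text \<open>With \<open>I\<close> the ideal generated by \<open>R\<close> and \<open>T\<close> the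
  augmentation ideal, this is \<open>T I + I T\<close>, up to words of length \<open>m\<close>. It
  complements \<open>R\<close> inside the truncated ideal: \<open>r\<close> is accompanied by at
  least one letter, and this letter is what improves length bounds by one.\<close>

definition aug_idl :: "('a, 'k::field) ncpoly set \<Rightarrow> nat \<Rightarrow> ('a, 'k) ncpoly set" where
  "aug_idl R m = pm.span ({word u * r * word v | u r v. r \<in> R \<and> (u \<noteq> [] \<or> v \<noteq> [])} \<union> deg_ge m)"

lemma subspace_aug_idl: "pm.subspace (aug_idl R m)"
  by (simp add: aug_idl_def)

lemma deg_ge_aug_idl: "p \<in> deg_ge m \<Longrightarrow> p \<in> aug_idl R m"
  unfolding aug_idl_def by (rule pm.span_base) simp

lemma word_aug_idl: "r \<in> R \<Longrightarrow> u \<noteq> [] \<or> v \<noteq> [] \<Longrightarrow> word u * r * word v \<in> aug_idl R m"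
  unfolding aug_idl_def by (rule pm.span_base) blast

lemma aug_idl_left: "r \<in> R \<Longrightarrow> a \<in> deg_ge 1 \<Longrightarrow> a * r * b \<in> aug_idl R m"
  by (rule bilinear_words[OF subspace_aug_idl, of _ 1 _ 0]) (auto intro!: word_aug_idl)

lemma aug_idl_right: "r \<in> R \<Longrightarrow> b \<in> deg_ge 1 \<Longrightarrow> a * r * b \<in> aug_idl R m"
  by (rule bilinear_words[OF subspace_aug_idl, of _ 0 _ 1]) (auto intro!: word_aug_idl)

lemma aug_idl_antimono: "m \<le> n \<Longrightarrow> p \<in> aug_idl R n \<Longrightarrow> p \<in> aug_idl R m"
  unfolding aug_idl_def by (erule pm.span_mono[THEN subsetD, rotated]) (auto intro: deg_ge_antimono)

lemma plinear_aug_idl: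
  assumes "plinear f" "pm.subspace V"
    and "\<And>u r v. r \<in> R \<Longrightarrow> u \<noteq> [] \<or> v \<noteq> [] \<Longrightarrow> f (word u * r * word v) \<in> V"
    and "\<And>p. p \<in> deg_ge m \<Longrightarrow> f p \<in> V" "p \<in> aug_idl R m"
  shows "f p \<in> V"
  by (rule plinear_span_subset[OF assms(1,2) _ assms(5)[unfolded aug_idl_def]]) (use assms(3,4) in auto)

lemma aug_idl_idl: "p \<in> aug_idl R m \<Longrightarrow> p \<in> idl (R \<union> deg_ge m)"
  by (rule plinear_aug_idl[OF plinear_id subspace_idl]) (auto intro: idl_gen idl_base)

lemma aug_idl_mult_left: "p \<in> aug_idl R m \<Longrightarrow> a \<in> deg_ge 1 \<Longrightarrow> a * p \<in> aug_idl R (Suc m)"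
proof (rule plinear_aug_idl[OF plinear_const_mult subspace_aug_idl])
  fix u v r assume "a \<in> deg_ge 1" "r \<in> R"
  then show "a * (word u * r * word v) \<in> aug_idl R (Suc m)"
    using aug_idl_left[of r R "a * word u" "word v" "Suc m"] deg_ge_mult_right[of a 1 "word u"] by (simp add: mult.assoc)
next
  fix p :: "('a, 'b) ncpoly" assume "a \<in> deg_ge 1" "p \<in> deg_ge m"
  then show "a * p \<in> aug_idl R (Suc m)"
    using deg_ge_mult[of a 1 p m] by (simp add: deg_ge_aug_idl)
qed

lemma aug_idl_mult_right: "p \<in> aug_idl R m \<Longrightarrow> a \<in> deg_ge 1 \<Longrightarrow> p * a \<in> aug_idl R (Suc m)"
proof (rule plinear_aug_idl[OF plinear_mult_const subspace_aug_idl])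
  fix u v r assume "a \<in> deg_ge 1" "r \<in> R"
  then show "word u * r * word v * a \<in> aug_idl R (Suc m)"
    using aug_idl_right[of r R "word v * a" "word u" "Suc m"] deg_ge_mult_left[of a 1 "word v"] by (simp add: mult.assoc)
next
  fix p :: "('a, 'b) ncpoly" assume "a \<in> deg_ge 1" "p \<in> deg_ge m"
  then show "p * a \<in> aug_idl R (Suc m)"
    using deg_ge_mult[of p m a 1] by (simp add: deg_ge_aug_idl)
qed

text \<open>The coproduct distributes the letters of \<open>u\<close> and \<open>v\<close> over both
  sides and puts the primitive \<open>r\<close> on one of them. After multiplication all these
  letters are still present, so \<open>r\<close> does not stand alone.\<close>

lemma adams_aug_idl:
  fixes R :: "('a, 'k::field) ncpoly set"
  assumes R: "R \<subseteq> lie_elems" and p: "p \<in> aug_idl R m"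
  shows "adams p \<in> aug_idl R m"
proof (rule plinear_aug_idl[OF plinear_adams subspace_aug_idl _ _ p])
  fix u v :: "'a list" and r assume r: "r \<in> R" and uv: "u \<noteq> [] \<or> v \<noteq> []"
  let ?S = "\<lambda>l. {inl1 (prod_list (map indet a)) * inl2 (prod_list (map indet b)) | a b. l \<in> shuffles a b}
      :: ('a free_monoid \<times> 'a free_monoid \<Rightarrow>\<^sub>0 'k) set"
  let ?r = "inl1 r + inl2 r"
  have D: "Delta (word l) \<in> pm.span (?S l)" for l
    using Delta_prod_list[of l indet, OF indet_lie_elems] by (simp add: prod_list_map_indet)
  have *: "mu (x * ?r * y) \<in> aug_idl R m" if xy: "x \<in> ?S u" "y \<in> ?S v" for x y
  proof -
    from xy obtain a b where x: "x = inl1 (word a) * inl2 (word b)" "u \<in> shuffles a b"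
      by (auto simp: prod_list_map_indet)
    from xy obtain c d where y: "y = inl1 (word c) * inl2 (word d)" "v \<in> shuffles c d"
      by (auto simp: prod_list_map_indet)
    have sets: "set a \<union> set b = set u" "set c \<union> set d = set v"
      using set_shuffles[OF x(2)] set_shuffles[OF y(2)] by auto
    have ne: "a @ b @ c @ d \<noteq> []"
      using uv sets by (metis Un_empty append_is_Nil_conv set_empty)
    have "x * inl1 r * y = inl1 (word a * r * word c) * inl2 (word b * word d)"
      by (simp add: x y inl1_mult inl2_mult mult.assoc inl1_inl2_commute inl1_inl2_commute_left)
    then have 1: "mu (x * inl1 r * y) = word a * r * word (c @ b @ d)"
      by (simp add: mu_inl1_inl2 word_append mult.assoc)
    have "x * inl2 r * y = inl1 (word a * word c) * inl2 (word b * r * word d)"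
      by (simp add: x y inl1_mult inl2_mult mult.assoc inl1_inl2_commute inl1_inl2_commute_left)
    then have 2: "mu (x * inl2 r * y) = word (a @ c @ b) * r * word d"
      by (simp add: mu_inl1_inl2 word_append mult.assoc)
    have "mu (x * ?r * y) = word a * r * word (c @ b @ d) + word (a @ c @ b) * r * word d"
      by (simp add: distrib_left distrib_right pmp.linear_add[OF plinear_mu] 1 2)
    moreover have "word a * r * word (c @ b @ d) \<in> aug_idl R m" "word (a @ c @ b) * r * word d \<in> aug_idl R m"
      using r ne by (auto intro!: word_aug_idl)
    ultimately show ?thesis
      by (simp add: pm.subspace_add[OF subspace_aug_idl])
  qed
  have "mu (Delta (word u) * (?r * y)) \<in> aug_idl R m" if y: "y \<in> ?S v" for y
    by (rule plinear_span_subset[OF plinear_comp[OF plinear_mu plinear_mult_const] subspace_aug_idl _ D])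
      (use *[OF _ y] in \<open>simp only: mult.assoc\<close>)
  then have "mu (Delta (word u) * ?r * Delta (word v)) \<in> aug_idl R m"
    by (intro plinear_span_subset[OF plinear_comp[OF plinear_mu plinear_const_mult] subspace_aug_idl _ D])
      (simp only: mult.assoc)
  then show "adams (word u * r * word v) \<in> aug_idl R m"
    using r R by (simp add: adams_def Delta_mult Delta_lie subsetD[OF R])
qed (simp add: deg_ge_aug_idl adams_deg_ge)

lemma lie_proj_aug_idl: "R \<subseteq> lie_elems \<Longrightarrow> p \<in> aug_idl R m \<Longrightarrow> lie_proj n p \<in> aug_idl R m"
  by (rule lie_proj_closed[OF subspace_aug_idl adams_aug_idl])

text \<open>The truncated ideal is spanned by \<open>R\<close>, on which the difference vanishes,
  and by \<open>aug_idl R m\<close>, which the projection preserves.\<close>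

lemma diff_lie_proj_aug_idl:
  assumes R: "lie_ideal R" and p: "p \<in> idl (R \<union> deg_ge m)"
  shows "p - lie_proj n p \<in> aug_idl R m"
proof (rule plinear_idl[OF _ subspace_aug_idl _ p])
  show lin: "plinear (\<lambda>p. p - lie_proj n p)"
    by (intro pmp.linear_compose_sub plinear_id plinear_lie_proj)
  have RL: "R \<subseteq> lie_elems" using lie_idealD(2)[OF R] by blast
  have closed: "p - lie_proj n p \<in> aug_idl R m" if "p \<in> aug_idl R m" for p
    using that lie_proj_aug_idl[OF RL] by (intro pm.subspace_diff[OF subspace_aug_idl])
  fix a r b :: "('a, 'b) ncpoly" assume "r \<in> R \<union> deg_ge m"
  then show "a * r * b - lie_proj n (a * r * b) \<in> aug_idl R m"
  proof
    assume "r \<in> deg_ge m"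
    then show ?thesis
      by (intro closed deg_ge_aug_idl deg_ge_mult_left deg_ge_mult_right)
  next
    assume r: "r \<in> R"
    have "a * r * b \<in> {p. p - lie_proj n p \<in> aug_idl R m}"
    proof (rule bilinear_words[OF subspace_vimage[OF lin subspace_aug_idl], of _ 0 _ 0])
      fix u v
      show "word u * r * word v \<in> {p. p - lie_proj n p \<in> aug_idl R m}"
      proof (cases "u = [] \<and> v = []")
        case True
        then show ?thesis
          using lie_proj_lie[of r n] RL r by (auto simp: pm.subspace_0[OF subspace_aug_idl])
      qed (use r in \<open>auto intro!: closed word_aug_idl\<close>)
    qed simp_all
    then show ?thesis by simp
  qed
qed

section \<open>Derivations and truncated exponentials\<close>

text \<open>Since \<open>D\<close> lengthens words, the terms of \<open>exp D\<close> from the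
  \<open>N\<close>-th on lie in \<open>deg_ge N\<close>, and finite sums replace the series.\<close>

locale raising_derivation =
  fixes D :: "('a, 'k::field_char_0) ncpoly \<Rightarrow> ('a, 'k) ncpoly"
  assumes linear: "plinear D"
    and leibniz: "D (p * q) = D p * q + p * D q"
    and raising: "p \<in> deg_ge n \<Longrightarrow> D p \<in> deg_ge (Suc n)"
begin

text \<open>Divided powers, for which the iterated Leibniz rule has no binomial
  coefficients.\<close>

definition dpow :: "nat \<Rightarrow> ('a, 'k) ncpoly \<Rightarrow> ('a, 'k) ncpoly" where
  "dpow n p = sc (1 / fact n) ((D ^^ n) p)"

definition texp :: "nat \<Rightarrow> ('a, 'k) ncpoly \<Rightarrow> ('a, 'k) ncpoly" where
  "texp N p = (\<Sum>n<N. dpow n p)"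

lemma plinear_funpow: "plinear (D ^^ n)"
proof (induction n)
  case 0
  then show ?case using plinear_id by (simp add: id_def)
next
  case (Suc n)
  then show ?case using plinear_comp[OF linear Suc] by (simp add: o_def)
qed

lemma plinear_dpow: "plinear (dpow n)"
  unfolding dpow_def by (rule pmp.linear_compose_scale_right[OF plinear_funpow])

lemma plinear_texp: "plinear (texp N)"
  unfolding texp_def by (rule pmp.linear_compose_sum) (simp add: plinear_dpow)

lemma funpow_deg_ge: "p \<in> deg_ge m \<Longrightarrow> (D ^^ n) p \<in> deg_ge (m + n)"
  by (induction n) (auto dest: raising)

lemma dpow_deg_ge: "p \<in> deg_ge m \<Longrightarrow> dpow n p \<in> deg_ge (m + n)"
  unfolding dpow_def by (intro pm.subspace_scale subspace_deg_ge funpow_deg_ge)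

lemma dpow_0 [simp]: "dpow 0 p = p" and dpow_1: "dpow (Suc 0) p = D p"
  by (simp_all add: dpow_def)

lemma dpow_Suc: "D (dpow n p) = sc (of_nat (Suc n)) (dpow (Suc n) p)"
proof -
  have "of_nat (Suc n) * (1 / fact (Suc n)) = (1 / fact n :: 'k)"
    using of_nat_neq_0[of n, where 'a = 'k] by (simp add: divide_simps del: of_nat_Suc)
  then show ?thesis
    by (simp add: dpow_def pmp.linear_scale[OF linear] del: of_nat_Suc fact_Suc)
qed

lemma dpow_mult: "dpow n (p * q) = (\<Sum>i\<le>n. dpow i p * dpow (n - i) q)"
proof (induction n)
  case (Suc n)
  let ?t = "\<lambda>i j. dpow i p * dpow j q"
  have "sc (of_nat (Suc n)) (dpow (Suc n) (p * q)) = D (\<Sum>i\<le>n. ?t i (n - i))"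
    by (simp add: dpow_Suc[symmetric] Suc del: of_nat_Suc)
  also have "\<dots> = (\<Sum>i\<le>n. sc (of_nat (Suc i)) (?t (Suc i) (n - i)))
      + (\<Sum>i\<le>n. sc (of_nat (Suc (n - i))) (?t i (Suc (n - i))))"
    by (simp add: pmp.linear_sum[OF linear] leibniz dpow_Suc sc_mult sum.distrib del: of_nat_Suc)
  also have "(\<Sum>i\<le>n. sc (of_nat (Suc i)) (?t (Suc i) (n - i)))
      = (\<Sum>i\<le>Suc n. sc (of_nat i) (?t i (Suc n - i)))"
    by (simp only: sum.atMost_Suc_shift) simp
  also have "(\<Sum>i\<le>n. sc (of_nat (Suc (n - i))) (?t i (Suc (n - i))))
      = (\<Sum>i\<le>Suc n. sc (of_nat (Suc n - i)) (?t i (Suc n - i)))"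
    by (simp add: Suc_diff_le del: of_nat_Suc of_nat_diff)
  \<comment> \<open>Both sums now run over the same products; their weights \<open>i\<close> and
    \<open>Suc n - i\<close> add up to the constant \<open>Suc n\<close>, which is cancelled at the
    end.\<close>
  also have "(\<Sum>i\<le>Suc n. sc (of_nat i) (?t i (Suc n - i)))
      + (\<Sum>i\<le>Suc n. sc (of_nat (Suc n - i)) (?t i (Suc n - i)))
      = (\<Sum>i\<le>Suc n. sc (of_nat (Suc n)) (?t i (Suc n - i)))"
    unfolding sum.distrib[symmetric] pm.scale_left_distrib[symmetric] of_nat_add[symmetric]
    by (intro sum.cong refl) (simp only: atMost_iff le_add_diff_inverse)
  also have "\<dots> = sc (of_nat (Suc n)) (\<Sum>i\<le>Suc n. ?t i (Suc n - i))"
    by (simp only: pm.scale_sum_right)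
  finally show ?case
    using of_nat_neq_0[of n, where 'a = 'k] by (simp only: pm.scale_cancel_left) blast
qed simp

text \<open>A product of two truncated series is a sum over a square, the truncated product series
  one over a triangle. The terms in the square but outside the triangle have
  \<open>i + j \<ge> N\<close> and are long.\<close>

lemma triangle_sum_deg_ge:
  assumes "\<And>i j. t i j \<in> deg_ge (i + j)"
  shows "(\<Sum>n<N. \<Sum>i\<le>n. t i (n - i)) - (\<Sum>i<N. \<Sum>j<N. t i j) \<in> deg_ge N"
proof -
  let ?A = "{(i, j). i + j < N}" and ?B = "{..<N} \<times> {..<N}"
  have "?A \<subseteq> ?B" by auto
  then have "(\<Sum>(i, j)\<in>?B. t i j) = (\<Sum>(i, j)\<in>?B - ?A. t i j) + (\<Sum>(i, j)\<in>?A. t i j)"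
    by (intro sum.subset_diff) auto
  then have "(\<Sum>n<N. \<Sum>i\<le>n. t i (n - i)) - (\<Sum>i<N. \<Sum>j<N. t i j) = - (\<Sum>(i, j)\<in>?B - ?A. t i j)"
    by (simp add: sum.triangle_reindex sum.cartesian_product)
  also have "\<dots> \<in> deg_ge N"
  proof (intro pm.subspace_neg[OF subspace_deg_ge] pm.subspace_sum[OF subspace_deg_ge])
    fix x assume "x \<in> ?B - ?A"
    then show "(case x of (i, j) \<Rightarrow> t i j) \<in> deg_ge N"
      using deg_ge_antimono[OF _ assms[of "fst x" "snd x"], of N] by (auto split: prod.splits)
  qed
  finally show ?thesis .
qed

lemma texp_mult: "texp N (p * q) - texp N p * texp N q \<in> deg_ge N"
proof -
  have "dpow i p * dpow j q \<in> deg_ge (i + j)" for i j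
    using deg_ge_mult[OF dpow_deg_ge[of p 0 i] dpow_deg_ge[of q 0 j]] by simp
  from triangle_sum_deg_ge[of "\<lambda>i j. dpow i p * dpow j q" N, OF this]
  show ?thesis
    by (simp add: texp_def dpow_mult sum_product)
qed

lemma texp_deg_ge: "p \<in> deg_ge m \<Longrightarrow> texp N p \<in> deg_ge m"
  unfolding texp_def
  by (intro pm.subspace_sum[OF subspace_deg_ge] deg_ge_antimono[OF le_add1 dpow_deg_ge])

lemma texp_diff:
  assumes "p \<in> deg_ge m" "1 \<le> N"
  shows "texp N p - p \<in> deg_ge (Suc m)"
proof -
  obtain N' where N: "N = Suc N'" using assms(2) by (cases N) auto
  have "texp N p - p = (\<Sum>n<N'. dpow (Suc n) p)"
    by (simp add: texp_def N sum.lessThan_Suc_shift del: sum.lessThan_Suc)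
  also have "\<dots> \<in> deg_ge (Suc m)"
    by (intro pm.subspace_sum[OF subspace_deg_ge] deg_ge_antimono[OF _ dpow_deg_ge[OF assms(1)]]) simp
  finally show ?thesis .
qed

text \<open>Downward induction on word length: all words of \<open>exp D v - v\<close> are longer than the shortest
  words of \<open>v\<close>.\<close>

lemma texp_preserves_imp:
  assumes V: "pm.subspace V" "deg_ge m \<subseteq> V" "m \<le> N"
    and texp: "\<And>v. v \<in> V \<Longrightarrow> texp N v \<in> V" and v: "v \<in> V"
  shows "D v \<in> V"
proof (cases "m \<le> 1")
  case True
  have "D v \<in> deg_ge 1" using raising[of v 0] by simp
  then show ?thesis using True V(2) deg_ge_antimono by blast
next
  case False
  \<comment> \<open>With \<open>N \<ge> 2\<close> the truncated exponential contains the linear term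
    \<open>D v\<close>, which is to be isolated.\<close>
  then obtain N' where N: "N = Suc (Suc N')" using V(3) by (metis Suc_le_D not_less_eq_eq One_nat_def)
  have "D v \<in> V" if "v \<in> V" "v \<in> deg_ge (m - d)" for d v
    using that
  proof (induction d arbitrary: v)
    case 0
    then show ?case using raising[of v m] deg_ge_antimono[of m "Suc m"] V(2) by auto
  next
    case (Suc d)
    show ?case
    proof (cases "m \<le> d")
      case True
      then show ?thesis using Suc by simp
    next
      case md: False
      define y where "y = texp N v - v"
      have y: "y \<in> V" "y \<in> deg_ge (m - d)"
        using texp_diff[OF Suc.prems(2), of N] Suc.prems(1) texp[of v] md V(1)
        by (auto simp: y_def N Suc_diff_Suc intro: pm.subspace_diff)
      have Dy: "(D ^^ i) y \<in> V" for i
      proof (induction i)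
        case (Suc i)
        have "(D ^^ i) y \<in> deg_ge (m - d)"
          by (rule deg_ge_antimono[OF le_add1 funpow_deg_ge[OF y(2)]])
        then show ?case using Suc.IH Suc.prems \<open>\<And>v. v \<in> V \<Longrightarrow> v \<in> deg_ge (m - d) \<Longrightarrow> D v \<in> V\<close> by simp
      qed (use y in simp)
      have y_eq: "y = D v + (\<Sum>n<N'. dpow (Suc (Suc n)) v)"
        by (simp add: y_def texp_def N sum.lessThan_Suc_shift dpow_1 del: sum.lessThan_Suc)
      \<comment> \<open>A second downward induction, on the power of \<open>D\<close>: in
        \<open>(D ^^ i) y\<close> every term except \<open>(D ^^ Suc i) v\<close> carries a higher
        power, and powers beyond \<open>m\<close> give long words. The case \<open>i = 0\<close> is
        the claim.\<close>
      have "(D ^^ Suc i) v \<in> V" if "m - e \<le> i" for e i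
        using that
      proof (induction e arbitrary: i)
        case 0
        have "(D ^^ Suc i) v \<in> deg_ge m"
          using funpow_deg_ge[of v 0 "Suc i"] 0 deg_ge_antimono[of m "Suc i"] by simp
        then show ?case using V(2) by blast
      next
        case (Suc e)
        have comb: "(D ^^ i) ((D ^^ k) v) = (D ^^ (k + i)) v" for k
          by (simp add: add.commute[of k i] funpow_add)
        have "(D ^^ i) y = (D ^^ Suc i) v
            + (\<Sum>n<N'. sc (1 / fact (Suc (Suc n))) ((D ^^ Suc (Suc n + i)) v))"
          unfolding y_eq pmp.linear_add[OF plinear_funpow] pmp.linear_sum[OF plinear_funpow]
            dpow_def pmp.linear_scale[OF plinear_funpow] comb
          by (simp add: funpow_swap1 del: fact_Suc)
        moreover have "(D ^^ Suc (Suc n + i)) v \<in> V" for n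
          using Suc by (intro Suc.IH) simp
        ultimately show ?case
          using Dy[of i] V(1)
          by (metis (no_types, lifting) add_diff_cancel_right' pm.subspace_diff pm.subspace_scale pm.subspace_sum)
      qed
      from this[of m 0] show ?thesis by simp
    qed
  qed
  from this[of v m] show ?thesis using v by simp
qed

text \<open>By \<open>lie_proj_comm\<close> the polynomials with long projection are stable under
  brackets with Lie elements, so the condition \<open>D L \<subseteq> K\<close> can be checked on
  letters.\<close>

lemma lie_proj_lie_elems_deg_ge:
  assumes "\<And>x. lie_proj n (D (indet x)) \<in> deg_ge N" "r \<in> lie_elems"
  shows "lie_proj n (D r) \<in> deg_ge N"
  using assms(2)
proof (induction rule: lie_elems_induct)
  case (mono k a)
  then show ?case
  proof (induction rule: lie_mono.induct)
    case (lie_mono_comm k a l b)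
    have "D (comm a b) = comm (D a) b - comm (D b) a"
      by (simp add: pmp.linear_diff[OF linear] leibniz)
    moreover have "a \<in> lie_elems" "b \<in> lie_elems"
      using lie_mono_comm.hyps lie_mono_lie_elems by auto
    ultimately show ?case
      using lie_mono_comm.IH
      by (simp add: pmp.linear_diff[OF plinear_lie_proj, of n "comm (D a) b" "comm (D b) a"] lie_proj_comm
          pm.subspace_diff[OF subspace_deg_ge] deg_ge_mult_left deg_ge_mult_right)
  qed (rule assms(1))
qed (simp_all add: pmp.linear_add[OF linear] pmp.linear_scale[OF linear]
    pmp.linear_add[OF plinear_lie_proj] pmp.linear_scale[OF plinear_lie_proj]
    pm.subspace_add[OF subspace_deg_ge] pm.subspace_scale[OF subspace_deg_ge])

end

lemma raising_derivation_uminus: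
  assumes "raising_derivation D"
  shows "raising_derivation (\<lambda>p. - D p)"
proof -
  interpret raising_derivation D by fact
  show ?thesis
    by unfold_locales
      (auto simp: pmp.linear_add[OF linear] pmp.linear_scale[OF linear] leibniz
        intro: pm.subspace_neg[OF subspace_deg_ge] raising)
qed

text \<open>Collecting equal powers of \<open>D\<close>, the coefficient of
  \<open>(D ^^ n) p\<close> is an alternating sum of binomial coefficients divided by
  \<open>fact n\<close>, which is zero for positive \<open>n\<close>.\<close>

lemma texp_uminus_texp:
  assumes "raising_derivation D"
  shows "raising_derivation.texp (\<lambda>p. - D p) N (raising_derivation.texp D N p) - p \<in> deg_ge N"
proof (cases "N = 0")
  case False
  interpret raising_derivation D by fact
  interpret neg: raising_derivation "\<lambda>p. - D p" by (rule raising_derivation_uminus) fact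
  have neg: "neg.dpow n q = sc ((-1) ^ n) (dpow n q)" for n q
  proof -
    have "((\<lambda>p. - D p) ^^ n) q = sc ((-1) ^ n) ((D ^^ n) q)"
      by (induction n) (simp_all add: pmp.linear_scale[OF linear])
    then show ?thesis by (simp add: neg.dpow_def dpow_def mult.commute)
  qed
  let ?t = "\<lambda>i j. neg.dpow i (dpow j p)"
  have t: "?t i j = sc ((-1) ^ i * (1 / fact i) * (1 / fact j)) ((D ^^ (i + j)) p)" for i j
    by (simp add: neg dpow_def pmp.linear_scale[OF plinear_funpow] funpow_add)
  have "(\<Sum>i\<le>n. ?t i (n - i)) = (if n = 0 then p else 0)" for n
  proof -
    have "(\<Sum>i\<le>n. ?t i (n - i))
        = sc (\<Sum>i\<le>n. (-1) ^ i * (1 / fact i) * (1 / fact (n - i))) ((D ^^ n) p)"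
      by (simp add: t pm.scale_sum_left)
    also have "(\<Sum>i\<le>n. (-1) ^ i * (1 / fact i) * (1 / fact (n - i)))
        = (\<Sum>i\<le>n. (-1) ^ i * of_nat (n choose i)) / (fact n :: 'b)"
      by (simp add: sum_divide_distrib binomial_fact)
    also have "\<dots> = (if n = 0 then 1 else 0)"
      using choose_alternating_sum[of n, where 'a = 'b] by auto
    finally show ?thesis by (cases "n = 0") simp_all
  qed
  then have tri: "(\<Sum>n<N. \<Sum>i\<le>n. ?t i (n - i)) = p"
    using False by (simp add: sum.delta)
  have sq: "(\<Sum>i<N. \<Sum>j<N. ?t i j) = neg.texp N (texp N p)"
    unfolding neg.texp_def texp_def by (simp add: pmp.linear_sum[OF neg.plinear_dpow])
  have "?t i j \<in> deg_ge (i + j)" for i j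
    using neg.dpow_deg_ge[OF dpow_deg_ge[of p 0 j], of i] by (simp add: add.commute)
  from triangle_sum_deg_ge[of ?t N, OF this] show ?thesis
    unfolding tri sq using pm.subspace_neg[OF subspace_deg_ge] by fastforce
qed simp

section \<open>Derivations prescribed on letters\<close>

primrec dword :: "('a \<Rightarrow> ('a, 'k::field) ncpoly) \<Rightarrow> 'a list \<Rightarrow> ('a, 'k) ncpoly" where
  "dword b [] = 0"
| "dword b (x # l) = b x * word l + indet x * dword b l"

definition deriv :: "('a \<Rightarrow> ('a, 'k::field) ncpoly) \<Rightarrow> ('a, 'k) ncpoly \<Rightarrow> ('a, 'k) ncpoly" where
  "deriv b = lin (\<lambda>w. dword b (letters w))"

lemma plinear_deriv: "plinear (deriv b)"
  by (simp add: deriv_def plinear_lin)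

lemma deriv_word [simp]: "deriv b (word l) = dword b l"
  by (simp add: deriv_def word_def)

lemma deriv_indet [simp]: "deriv b (indet x) = b x"
  by (simp add: indet_word)

lemma dword_append: "dword b (l @ m) = dword b l * word m + word l * dword b m"
  by (induction l) (simp_all add: word_append word_Cons distrib_left distrib_right mult.assoc add.assoc)

lemma deriv_mult: "deriv b (p * q) = deriv b p * q + p * deriv b q"
proof (rule plinear_eq_words[of "\<lambda>p. deriv b (p * q)" "\<lambda>p. deriv b p * q + p * deriv b q"])
  show "plinear (\<lambda>p. deriv b (p * q))"
    by (rule plinear_comp[OF plinear_deriv plinear_mult_const])
  show "plinear (\<lambda>p. deriv b p * q + p * deriv b q)"
    by (rule pmp.linear_compose_add[OF plinear_comp[OF plinear_mult_const plinear_deriv] plinear_mult_const])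
  show "deriv b (word l * q) = deriv b (word l) * q + word l * deriv b q" for l
  proof (rule plinear_eq_words[of "\<lambda>q. deriv b (word l * q)"
        "\<lambda>q. deriv b (word l) * q + word l * deriv b q"])
    show "plinear (\<lambda>q. deriv b (word l * q))"
      by (rule plinear_comp[OF plinear_deriv plinear_const_mult])
    show "plinear (\<lambda>q. deriv b (word l) * q + word l * deriv b q)"
      by (rule pmp.linear_compose_add[OF plinear_const_mult plinear_comp[OF plinear_const_mult plinear_deriv]])
    show "deriv b (word l * word m) = deriv b (word l) * word m + word l * deriv b (word m)" for m
      by (simp add: word_append[symmetric] dword_append)
  qed
qed

lemma deriv_deg_ge:
  assumes "\<And>x. b x \<in> deg_ge (Suc k)" "p \<in> deg_ge n"
  shows "deriv b p \<in> deg_ge (n + k)"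
proof (rule plinear_deg_ge[OF plinear_deriv subspace_deg_ge _ assms(2)])
  fix l :: "'a list" assume l: "n \<le> length l"
  have "dword b l \<in> deg_ge (length l + k)"
  proof (induction l)
    case (Cons x l)
    have "b x * word l \<in> deg_ge (Suc k + length l)"
      using assms(1) by (intro deg_ge_mult word_deg_ge) simp_all
    moreover have "indet x * dword b l \<in> deg_ge (1 + (length l + k))"
      using Cons by (intro deg_ge_mult indet_deg_ge)
    ultimately show ?case
      by (simp add: pm.subspace_add[OF subspace_deg_ge] add.commute)
  qed (simp add: pm.subspace_0[OF subspace_deg_ge])
  then show "deriv b (word l) \<in> deg_ge (n + k)"
    using l deg_ge_antimono[of "n + k" "length l + k"] by simp
qed

lemma raising_derivation_deriv:
  fixes b :: "'a \<Rightarrow> ('a, 'k::field_char_0) ncpoly"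
  assumes "\<And>x. b x \<in> deg_ge 2"
  shows "raising_derivation (deriv b)"
  using deriv_deg_ge[of b 1] assms
  by unfold_locales (auto simp: numeral_2_eq_2 deriv_mult pmp.linear_add[OF plinear_deriv] pmp.linear_scale[OF plinear_deriv])

section \<open>Lie ideals related by an exponential\<close>

lemma aug_idl_word_right: "p \<in> aug_idl R m \<Longrightarrow> p * word w \<in> aug_idl R m"
  using aug_idl_mult_right[of p R m "word w"] aug_idl_antimono[of m "Suc m"] word_deg_ge[of 1 w]
  by (cases w) auto

lemma deg_ge_mult_idl:
  assumes "a \<in> deg_ge i" "p \<in> idl (S \<union> deg_ge j)"
  shows "a * p \<in> idl (S \<union> deg_ge (i + j))" and "p * a \<in> idl (S \<union> deg_ge (i + j))"
proof -
  have *: "a * (c * s * d) \<in> idl (S \<union> deg_ge (i + j)) \<and> c * s * d * a \<in> idl (S \<union> deg_ge (i + j))"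
    if "s \<in> S \<union> deg_ge j" for c s d
    using that
  proof
    assume "s \<in> S"
    then show ?thesis
      using idl_gen[of s "S \<union> deg_ge (i + j)" "a * c" d] idl_gen[of s "S \<union> deg_ge (i + j)" c "d * a"]
      by (simp add: mult.assoc)
  next
    assume "s \<in> deg_ge j"
    then have "c * s * d \<in> deg_ge j" by (intro deg_ge_mult_left deg_ge_mult_right)
    then show ?thesis
      using deg_ge_mult[OF assms(1), of "c * s * d" j] deg_ge_mult[OF _ assms(1), of "c * s * d" j]
        idl_base[of _ "S \<union> deg_ge (i + j)"] by (simp add: add.commute)
  qed
  show "a * p \<in> idl (S \<union> deg_ge (i + j))"
    by (rule plinear_idl[OF plinear_const_mult subspace_idl _ assms(2)]) (simp add: *)
  show "p * a \<in> idl (S \<union> deg_ge (i + j))"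
    by (rule plinear_idl[OF plinear_mult_const subspace_idl _ assms(2)]) (simp add: *)
qed

lemma idl_deg_ge_antimono: "m \<le> n \<Longrightarrow> p \<in> idl (S \<union> deg_ge n) \<Longrightarrow> p \<in> idl (S \<union> deg_ge m)"
  by (erule idl_mono[rotated]) (auto intro: deg_ge_antimono)

text \<open>Agreement of the ideals at level \<open>m\<close> lets \<open>D\<close> act on the
  truncated ideal of \<open>R\<close>. The linear term \<open>D r\<close> is invisible to the
  projection, and the higher terms have already gained one letter; this is how level
  \<open>m\<close> yields level \<open>Suc m\<close>.\<close>

lemma (in raising_derivation) lie_ideal_step:
  assumes R: "lie_ideal R" and S: "lie_ideal S"
    and ker: "\<And>x. lie_proj N (D (indet x)) \<in> deg_ge N"
    and texp: "\<And>p. p \<in> idl (R \<union> deg_ge N) \<Longrightarrow> texp N p \<in> idl (S \<union> deg_ge N)"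
    and eq: "idl (R \<union> deg_ge m) = idl (S \<union> deg_ge m)" and m: "1 \<le> m" "m < N"
  shows "R \<subseteq> idl (S \<union> deg_ge (Suc m))"
proof -
  have RL: "R \<subseteq> lie_elems" using lie_idealD(2)[OF R] by blast
  have "texp N v \<in> idl (R \<union> deg_ge m)" if "v \<in> idl (R \<union> deg_ge m)" for v
  proof (rule plinear_idl[OF plinear_texp subspace_idl _ that])
    fix a r b :: "('a, 'k) ncpoly" assume "r \<in> R \<union> deg_ge m"
    then show "texp N (a * r * b) \<in> idl (R \<union> deg_ge m)"
    proof
      assume "r \<in> R"
      then have "texp N (a * r * b) \<in> idl (S \<union> deg_ge N)"
        by (intro texp idl_gen) simp
      then show ?thesis
        unfolding eq using idl_deg_ge_antimono m(2) less_imp_le by blast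
    next
      assume "r \<in> deg_ge m"
      then have "texp N (a * r * b) \<in> deg_ge m"
        by (intro texp_deg_ge deg_ge_mult_left deg_ge_mult_right)
      then show ?thesis by (simp add: idl_base)
    qed
  qed
  \<comment> \<open>\<open>D\<close> is the logarithm of its exponential, so it inherits the
    invariant subspace.\<close>
  then have D_idl: "D v \<in> idl (R \<union> deg_ge m)" if "v \<in> idl (R \<union> deg_ge m)" for v
    using texp_preserves_imp[of "idl (R \<union> deg_ge m)" m N v] that m(2)
    by (auto simp: subspace_idl intro: idl_base)
  have ker': "lie_proj N (D r) \<in> deg_ge N" if "r \<in> R" for r
    using lie_proj_lie_elems_deg_ge[OF ker] RL that by blast
  have D_R: "D r \<in> aug_idl R m" if r: "r \<in> R" for r
  proof -
    have "D r - lie_proj N (D r) \<in> aug_idl R m"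
      using r by (intro diff_lie_proj_aug_idl[OF R] D_idl idl_base) simp
    moreover have "lie_proj N (D r) \<in> aug_idl R m"
      using ker'[OF r] m(2) by (intro deg_ge_aug_idl) (erule deg_ge_antimono[rotated], simp)
    ultimately show ?thesis
      using pm.subspace_add[OF subspace_aug_idl] by fastforce
  qed
  \<comment> \<open>In the Leibniz rule the outer terms keep \<open>r\<close>, accompanied by
    letters from \<open>D u\<close> or \<open>D v\<close>. In the middle term \<open>D r\<close> is
    known at level \<open>m\<close>, and a letter of \<open>u\<close> or \<open>v\<close> raises
    this by one.\<close>
  have D_aug: "D p \<in> aug_idl R (Suc m)" if "p \<in> aug_idl R m" for p
  proof (rule plinear_aug_idl[OF linear subspace_aug_idl _ _ that])
    fix u v :: "'a list" and r assume r: "r \<in> R" and uv: "u \<noteq> [] \<or> v \<noteq> []"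
    have deg1: "D q \<in> deg_ge 1" for q using raising[of q 0] by simp
    have "word u * D r * word v \<in> aug_idl R (Suc m)"
    proof (cases "u = []")
      case True
      then have "word v \<in> (deg_ge 1 :: ('a, 'k) ncpoly set)"
        using uv by (cases v) (auto intro: word_deg_ge)
      then show ?thesis
        using aug_idl_mult_right[OF D_R[OF r]] True by simp
    next
      case False
      then have "word u \<in> (deg_ge 1 :: ('a, 'k) ncpoly set)"
        by (cases u) (auto intro: word_deg_ge)
      then show ?thesis
        by (intro aug_idl_word_right aug_idl_mult_left D_R r)
    qed
    moreover have "D (word u * r * word v) = D (word u) * r * word v + word u * D r * word v + word u * r * D (word v)"
      by (simp add: leibniz distrib_right)
    ultimately show "D (word u * r * word v) \<in> aug_idl R (Suc m)"
      using aug_idl_left[OF r deg1] aug_idl_right[OF r deg1]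
      by (simp add: pm.subspace_add[OF subspace_aug_idl])
  qed (simp add: deg_ge_aug_idl raising)
  have D_aug': "D p \<in> aug_idl R (Suc m)" if "p \<in> aug_idl R (Suc m)" for p
    by (rule D_aug[OF aug_idl_antimono[OF le_SucI[OF order_refl] that]])
  obtain N' where N: "N = Suc (Suc N')" using m by (metis Suc_le_D less_eq_Suc_le One_nat_def Suc_le_mono)
  \<comment> \<open>\<open>D r\<close> itself is known only at level \<open>m\<close>, but its
    projection is long. From \<open>D (D r)\<close> on, all terms are at level
    \<open>Suc m\<close>.\<close>
  have red: "r - lie_proj N (texp N r) \<in> aug_idl R (Suc m)" if r: "r \<in> R" for r
  proof -
    have "(D ^^ Suc (Suc n)) r \<in> aug_idl R (Suc m)" for n
      by (induction n) (simp_all add: D_aug' D_aug D_R r)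
    then have X: "(\<Sum>n<N'. dpow (Suc (Suc n)) r) \<in> aug_idl R (Suc m)" (is "?X \<in> _")
      unfolding dpow_def by (intro pm.subspace_sum pm.subspace_scale subspace_aug_idl)
    have "texp N r = r + D r + ?X"
      by (simp add: texp_def N sum.lessThan_Suc_shift dpow_1 del: sum.lessThan_Suc)
    then have "r - lie_proj N (texp N r) = - (lie_proj N (D r) + lie_proj N ?X)"
      using lie_proj_lie[of r N] RL r by (auto simp: pmp.linear_add[OF plinear_lie_proj])
    moreover have "lie_proj N (D r) \<in> aug_idl R (Suc m)"
      using ker'[OF r] m(2) by (intro deg_ge_aug_idl) (erule deg_ge_antimono[rotated], simp)
    ultimately show ?thesis
      using lie_proj_aug_idl[OF RL X] by (simp add: pm.subspace_add pm.subspace_neg subspace_aug_idl del: minus_add_distrib)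
  qed
  have proj: "lie_proj N (texp N r) \<in> idl (S \<union> deg_ge j)" if r: "r \<in> R" and "j \<le> Suc m" for r j
  proof -
    have t: "texp N r \<in> idl (S \<union> deg_ge N)"
      using r by (intro texp idl_base) simp
    have "texp N r - lie_proj N (texp N r) \<in> idl (S \<union> deg_ge N)"
      by (rule aug_idl_idl[OF diff_lie_proj_aug_idl[OF S t]])
    then have "lie_proj N (texp N r) \<in> idl (S \<union> deg_ge N)"
      using idl_diff[OF t] by fastforce
    then show ?thesis
      using that m(2) by (intro idl_deg_ge_antimono[of j N]) auto
  qed
  \<comment> \<open>Bootstrapping: \<open>r\<close> equals an element of the ideal of
    \<open>S\<close> plus an error in \<open>aug_idl R (Suc m)\<close>. In the error elements of
    \<open>R\<close> are multiplied by at least one letter, so control of \<open>R\<close> up to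
    length \<open>j\<close> controls the error up to length \<open>Suc j\<close>.\<close>
  have "R \<subseteq> idl (S \<union> deg_ge j)" if "j \<le> Suc m" for j
    using that
  proof (induction j)
    case 0
    then show ?case using idl_base[of _ "S \<union> deg_ge 0"] by auto
  next
    case (Suc j)
    have "p \<in> idl (S \<union> deg_ge (Suc j))" if "p \<in> aug_idl R (Suc m)" for p
    proof (rule plinear_aug_idl[OF plinear_id subspace_idl _ _ that])
      fix u v :: "'a list" and r assume "r \<in> R" and uv: "u \<noteq> [] \<or> v \<noteq> []"
      then have r: "r \<in> idl (S \<union> deg_ge j)" using Suc by auto
      show "word u * r * word v \<in> idl (S \<union> deg_ge (Suc j))"
      proof (cases "u = []")
        case True
        then have "word v \<in> (deg_ge 1 :: ('a, 'k) ncpoly set)"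
          using uv by (cases v) (auto intro: word_deg_ge)
        then show ?thesis
          using deg_ge_mult_idl(2)[of _ 1, OF _ r] True by simp
      next
        case False
        then have "word u \<in> (deg_ge 1 :: ('a, 'k) ncpoly set)"
          by (cases u) (auto intro: word_deg_ge)
        then show ?thesis
          using deg_ge_mult_idl(1)[of _ 1, OF _ r] idl_mult_right by fastforce
      qed
    next
      fix p :: "('a, 'k) ncpoly" assume "p \<in> deg_ge (Suc m)"
      then show "p \<in> idl (S \<union> deg_ge (Suc j))"
        using Suc.prems deg_ge_antimono by (intro idl_base) blast
    qed
    then show ?case
      using red proj[OF _ Suc.prems] idl_add by (metis diff_add_cancel subsetI)
  qed
  then show ?thesis by simp
qed

text \<open>\<open>D\<close> and its negative give the two inclusions in each step up to level
  \<open>N\<close>. There the projection recovers a Lie ideal from its truncated ideal up to long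
  Lie elements, and these belong to both ideals by \<open>nilp\<close>.\<close>

theorem lie_ideal_eq_if_texp:
  assumes D: "raising_derivation D" and R: "lie_ideal R" and S: "lie_ideal S"
    and ker: "\<And>x. lie_proj N (D (indet x)) \<in> deg_ge N"
    and texp: "\<And>p. p \<in> idl (R \<union> deg_ge N) \<longleftrightarrow> raising_derivation.texp D N p \<in> idl (S \<union> deg_ge N)"
    and nilp: "lie_elems \<inter> deg_ge N \<subseteq> R" "lie_elems \<inter> deg_ge N \<subseteq> S"
  shows "R = S"
proof -
  interpret raising_derivation D by fact
  interpret neg: raising_derivation "\<lambda>p. - D p" by (rule raising_derivation_uminus) fact
  have neg_texp: "neg.texp N s \<in> idl (R \<union> deg_ge N)" if s: "s \<in> idl (S \<union> deg_ge N)" for s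
  proof -
    have "texp N (neg.texp N s) - s \<in> deg_ge N"
      using texp_uminus_texp[OF neg.raising_derivation_axioms, of N s] by simp
    then have "texp N (neg.texp N s) - s \<in> idl (S \<union> deg_ge N)"
      by (intro idl_base) simp
    then show ?thesis
      using idl_add[OF _ s] assms(5)[of "neg.texp N s"] by fastforce
  qed
  have neg_ker: "lie_proj N (- D (indet x)) \<in> deg_ge N" for x
    using ker[of x] by (simp add: pmp.linear_neg[OF plinear_lie_proj] pm.subspace_neg[OF subspace_deg_ge])
  have sub: "idl (A \<union> deg_ge k) \<subseteq> idl (B \<union> deg_ge k)" if "A \<subseteq> idl (B \<union> deg_ge k)"
    for A B :: "('a, 'b) ncpoly set" and k
    using that by (intro idl_subset) (auto intro: idl_base)
  have step: "idl (R \<union> deg_ge m) = idl (S \<union> deg_ge m)" if "m \<le> N" for m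
    using that
  proof (induction m)
    case 0
    have "p \<in> idl (B \<union> deg_ge 0)" for p :: "('a, 'b) ncpoly" and B
      by (rule idl_base) simp
    then show ?case by blast
  next
    case (Suc m)
    show ?case
    proof (cases "m = 0")
      \<comment> \<open>The general step starts from level 1. Passing from 0 to 1 only needs that
        Lie elements have no constant term.\<close>
      case True
      have "A \<subseteq> idl (B \<union> deg_ge 1)" if "lie_ideal A" for A B :: "('a, 'b) ncpoly set"
        using lie_idealD(2)[OF that] lie_elems_deg_ge by (auto intro: idl_base)
      then show ?thesis
        using sub R S True by (metis One_nat_def subset_antisym)
    next
      case False
      have eq: "idl (R \<union> deg_ge m) = idl (S \<union> deg_ge m)" and m: "1 \<le> m" "m < N"
        using Suc False by auto
      have "R \<subseteq> idl (S \<union> deg_ge (Suc m))"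
        using lie_ideal_step[OF R S ker _ eq m] assms(5) by blast
      moreover have "S \<subseteq> idl (R \<union> deg_ge (Suc m))"
        by (rule neg.lie_ideal_step[OF S R neg_ker neg_texp eq[symmetric] m])
      ultimately show ?thesis using sub by blast
    qed
  qed
  have "A \<subseteq> B" if A: "lie_ideal A" and B: "lie_ideal B" "lie_elems \<inter> deg_ge N \<subseteq> B"
    and AB: "idl (A \<union> deg_ge N) = idl (B \<union> deg_ge N)" for A B :: "('a, 'b) ncpoly set"
  proof
    fix a assume a: "a \<in> A"
    then have "a \<in> idl (B \<union> deg_ge N)" using AB idl_base[of a "A \<union> deg_ge N"] by simp
    then obtain b where b: "b \<in> B" "lie_proj N a - b \<in> deg_ge N"
      using lie_proj_idl[OF B(1)] by blast
    have L: "a \<in> lie_elems" "b \<in> lie_elems" using a b A B lie_idealD(2) by auto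
    then have "a - b \<in> B"
      using b(2) B(2) lie_proj_lie[OF L(1), of N] pm.subspace_diff[OF subspace_lie_elems] by auto
    then show "a \<in> B"
      using pm.subspace_add[OF lie_idealD(1)[OF B(1)] _ b(1)] by fastforce
  qed
  then show ?thesis
    using R S nilp step[of N] by (metis order_refl subset_antisym)
qed

section \<open>Evaluating Lie elements in a Lie algebra\<close>

locale lie_algebra_char_0 = lie_algebra scale bracket
  for scale :: "'k::field_char_0 \<Rightarrow> 'g::ab_group_add \<Rightarrow> 'g" and bracket
begin

lemma bracket_0_left [simp]: "bracket 0 x = 0" and bracket_0_right [simp]: "bracket x 0 = 0"
  using bracket_add_left[of 0 0 x] bracket_add_right[of x 0 0] by simp_all

lemma bracket_neg: "bracket x y = - bracket y x"
proof -
  have "bracket x y + bracket y x = 0"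
    using bracket_self[of "x + y", unfolded bracket_add_left bracket_add_right]
    by (simp add: bracket_self add.commute)
  then show ?thesis by (simp only: eq_neg_iff_add_eq_0)
qed

lemma bracket_minus_right: "bracket x (- y) = - bracket x y"
  using bracket_add_right[of x y "- y"] by (simp add: add_eq_0_iff2)

lemma bracket_bracket_left: "bracket (bracket x y) z = bracket x (bracket y z) - bracket y (bracket x z)"
  using jacobi[of x y z] bracket_neg[of "bracket x y" z] bracket_neg[of z x]
  by (simp add: bracket_minus_right add_eq_0_iff algebra_simps)

primrec right_bracket :: "'g list \<Rightarrow> 'g" where
  "right_bracket [] = 0"
| "right_bracket (x # l) = (if l = [] then x else bracket x (right_bracket l))"

abbreviation ad :: "'g list \<Rightarrow> 'g \<Rightarrow> 'g" where
  "ad l y \<equiv> foldr bracket l y"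

lemma ad_add: "ad l (y + z) = ad l y + ad l z"
  by (induction l) (simp_all add: bracket_add_right)

lemma ad_scale: "ad l (scale c y) = scale c (ad l y)"
  by (induction l) (simp_all add: bracket_scale_right)

lemma ad_0 [simp]: "ad l 0 = 0"
  by (induction l) simp_all

lemma right_bracket_append: "m \<noteq> [] \<Longrightarrow> right_bracket (l @ m) = ad l (right_bracket m)"
  by (induction l) simp_all

definition dynkin :: "('g, 'k) ncpoly \<Rightarrow> 'g" where
  "dynkin = vlin scale (\<lambda>w. right_bracket (letters w))"

text \<open>The action of the free algebra on \<gg> in which letters act by \<open>bracket\<close>.
  It describes \<open>dynkin\<close> on products: the first factor acts on the right-normed
  bracketing of the second.\<close>

definition adp :: "('g, 'k) ncpoly \<Rightarrow> 'g \<Rightarrow> 'g" where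
  "adp p y = vlin scale (\<lambda>w. ad (letters w) y) p"

text \<open>The Dynkin operator divided by word length. On \<open>lie_elems\<close> it is the
  homomorphism to \<gg> that extends the identity on letters; the formula makes sense on all
  polynomials, so well-definedness is no issue. The empty word is sent to 0.\<close>

definition ev :: "('g, 'k) ncpoly \<Rightarrow> 'g" where
  "ev = vlin scale (\<lambda>w. scale (1 / of_nat (length (letters w))) (right_bracket (letters w)))"

lemma dynkin_add: "dynkin (p + q) = dynkin p + dynkin q" and dynkin_sc: "dynkin (sc c p) = scale c (dynkin p)"
  by (simp_all add: dynkin_def vlin_add vlin_sc)

lemma adp_add: "adp (p + q) y = adp p y + adp q y" and adp_sc: "adp (sc c p) y = scale c (adp p y)"
  by (simp_all add: adp_def vlin_add vlin_sc)

lemma ev_add: "ev (p + q) = ev p + ev q" and ev_sc: "ev (sc c p) = scale c (ev p)"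
  by (simp_all add: ev_def vlin_add vlin_sc)

lemma vlin_0: "vlin scale f 0 = 0"
  by (simp add: vlin_def)

lemma vlin_diff: "vlin scale f (p - q) = vlin scale f p - vlin scale f q" for p q :: "('g, 'k) ncpoly"
  using vlin_add[of f "p - q" q] by (simp add: eq_diff_eq)

lemma dynkin_diff: "dynkin (p - q) = dynkin p - dynkin q"
  and adp_diff: "adp (p - q) y = adp p y - adp q y"
  and ev_diff: "ev (p - q) = ev p - ev q"
  by (simp_all add: dynkin_def adp_def ev_def vlin_diff)

lemma ev_0 [simp]: "ev 0 = 0"
  by (simp add: ev_def vlin_0)

lemma ev_indet [simp]: "ev (indet x) = x"
  by (simp add: ev_def indet_def)

lemma adp_indet [simp]: "adp (indet x) y = bracket x y"
  by (simp add: adp_def indet_def)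

lemma adp_add_right: "adp p (y + z) = adp p y + adp p z"
  by (simp add: adp_def vlin_def ad_add scale_right_distrib sum.distrib)

lemma adp_scale_right: "adp p (scale c y) = scale c (adp p y)"
  by (simp add: adp_def vlin_def ad_scale scale_sum_right mult.commute)

lemma adp_word: "adp (word l) y = ad l y"
  by (simp add: adp_def word_def)

lemma adp_mult: "adp (p * q) y = adp p (adp q y)"
proof -
  have "adp (word l * q) y = adp (word l) (adp q y)" for l
  proof -
    have "q \<in> {q. adp (word l * q) y = adp (word l) (adp q y)}"
    proof (rule pm_subspace_induct[OF pm.subspaceI])
      show "single w 1 \<in> {q. adp (word l * q) y = adp (word l) (adp q y)}" for w
        by (simp add: single_word word_append[symmetric] adp_word)
    qed (auto simp: distrib_left sc_mult adp_add adp_sc adp_add_right adp_scale_right,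
        simp add: adp_def vlin_0 vlin_def)
    then show ?thesis by simp
  qed
  note * = this
  have "p \<in> {p. adp (p * q) y = adp p (adp q y)}"
    by (rule pm_subspace_induct[OF pm.subspaceI])
      (simp_all add: distrib_right sc_mult adp_add adp_sc single_word *, simp add: adp_def vlin_0)
  then show ?thesis by simp
qed

lemma dynkin_word: "dynkin (word l) = right_bracket l"
  by (simp add: dynkin_def word_def)

lemma dynkin_mult:
  assumes "q \<in> deg_ge 1"
  shows "dynkin (p * q) = adp p (dynkin q)"
proof -
  have "dynkin (word l * q) = adp (word l) (dynkin q)" for l
  proof -
    have "q \<in> {q. dynkin (word l * q) = adp (word l) (dynkin q)}"
    proof (rule pm_subspace_induct[OF pm.subspaceI])
      fix w assume "w \<in> keys q"
      then have "letters w \<noteq> []" using assms by (force simp: deg_ge_def)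
      then show "single w 1 \<in> {q. dynkin (word l * q) = adp (word l) (dynkin q)}"
        by (simp add: single_word word_append[symmetric] dynkin_word adp_word right_bracket_append)
    qed (auto simp: distrib_left sc_mult dynkin_add dynkin_sc adp_add_right adp_scale_right,
        simp add: dynkin_def vlin_0 adp_word)
    then show ?thesis by simp
  qed
  note * = this
  have "p \<in> {p. dynkin (p * q) = adp p (dynkin q)}"
    by (rule pm_subspace_induct[OF pm.subspaceI])
      (simp_all add: distrib_right sc_mult dynkin_add dynkin_sc adp_add adp_sc single_word *,
        simp add: dynkin_def adp_def vlin_0)
  then show ?thesis by simp
qed

lemma lie_mono_keys: "lie_mono n a \<Longrightarrow> w \<in> keys a \<Longrightarrow> length (letters w) = n"
proof (induction arbitrary: w rule: lie_mono.induct)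
  case (lie_mono_indet x)
  then show ?case by (simp add: indet_def)
next
  case (lie_mono_comm m a n b)
  then have "w \<in> keys (a * b) \<or> w \<in> keys (b * a)"
    by (metis diff_self in_keys_iff lookup_minus diff_0_right)
  then obtain u v where "w = u + v" "u \<in> keys a \<and> v \<in> keys b \<or> u \<in> keys b \<and> v \<in> keys a"
    using keys_mult[of a b] keys_mult[of b a] by blast
  then show ?case
    using lie_mono_comm.IH by (auto simp: plus_free_monoid_def)
qed

lemma ev_lie_mono: "lie_mono n a \<Longrightarrow> ev a = scale (1 / of_nat n) (dynkin a)"
  unfolding ev_def dynkin_def vlin_def scale_sum_right
  by (intro sum.cong refl) (simp add: lie_mono_keys mult.commute)

lemma dynkin_lie_mono:
  assumes "lie_mono n a"
  shows "dynkin a = scale (of_nat n) (ev a)"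
  using lie_mono_pos[OF assms] by (simp add: ev_lie_mono[OF assms])

text \<open>The Dynkin--Specht--Wever argument: the right-normed bracketing multiplies a
  homogeneous Lie element by its degree, so \<open>ev\<close> is well behaved on Lie elements.\<close>

lemma ev_comm_mono:
  assumes a: "lie_mono m a" "\<And>y. adp a y = bracket (ev a) y"
    and b: "lie_mono n b" "\<And>y. adp b y = bracket (ev b) y"
  shows "ev (comm a b) = bracket (ev a) (ev b)"
proof -
  have ab: "a \<in> deg_ge 1" "b \<in> deg_ge 1"
    using a(1) b(1) lie_elems_deg_ge lie_mono_lie_elems by auto
  \<comment> \<open>The degrees appear as separate weights \<open>n\<close> and \<open>m\<close>.
    Antisymmetry merges them into \<open>m + n\<close>, which is invertible in characteristic
    zero.\<close>
  have "dynkin (comm a b) = bracket (ev a) (scale (of_nat n) (ev b)) - bracket (ev b) (scale (of_nat m) (ev a))"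
    by (simp add: dynkin_diff dynkin_mult[OF ab(1)] dynkin_mult[OF ab(2)] a(2) b(2) dynkin_lie_mono[OF a(1)] dynkin_lie_mono[OF b(1)])
  also have "\<dots> = scale (of_nat (m + n)) (bracket (ev a) (ev b))"
    using bracket_neg[of "ev b" "ev a"] by (simp add: bracket_scale_right scale_left_distrib)
  finally have "scale (of_nat (m + n)) (ev (comm a b)) = scale (of_nat (m + n)) (bracket (ev a) (ev b))"
    using dynkin_lie_mono[OF lie_mono_comm[OF a(1) b(1)]] by simp
  moreover have "of_nat (m + n) \<noteq> (0::'k)"
    using lie_mono_pos[OF a(1)] by (simp add: of_nat_add[symmetric] del: of_nat_add)
  ultimately show ?thesis by (simp only: scale_cancel_left) blast
qed

lemma adp_lie_mono: "lie_mono n a \<Longrightarrow> adp a y = bracket (ev a) y"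
proof (induction arbitrary: y rule: lie_mono.induct)
  case (lie_mono_comm m a n b)
  then show ?case
    by (simp add: adp_diff adp_mult ev_comm_mono bracket_bracket_left)
qed simp

lemma ev_comm:
  assumes "a \<in> lie_elems" "b \<in> lie_elems"
  shows "ev (comm a b) = bracket (ev a) (ev b)"
  using assms(1)
proof (induction rule: lie_elems_induct)
  case (mono m a)
  note a = mono
  show ?case
    using assms(2)
  proof (induction rule: lie_elems_induct)
    case (mono n b)
    then show ?case using a by (simp add: ev_comm_mono adp_lie_mono)
  qed (simp_all add: algebra_simps ev_add ev_diff ev_sc sc_mult bracket_add_right bracket_scale_right)
next
  case (add a a')
  have "comm (a + a') b = comm a b + comm a' b" by (simp add: algebra_simps)
  then show ?case using add by (simp add: ev_add bracket_add_left)
next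
  case (scale c a)
  have "comm (sc c a) b = sc c (comm a b)" by (simp add: sc_mult pm.scale_right_diff_distrib)
  then show ?case using scale by (simp add: ev_sc bracket_scale_left)
qed

lemma ev_mult_diff:
  "a \<in> lie_elems \<Longrightarrow> b \<in> lie_elems \<Longrightarrow> ev (a * b) - ev (b * a) = bracket (ev a) (ev b)"
  by (simp add: ev_diff[symmetric] ev_comm)

lemma right_bracket_lower_central: "right_bracket (x # l) \<in> lower_central (length l)"
proof (induction l arbitrary: x)
  case (Cons y l)
  have "right_bracket (x # y # l) = bracket x (right_bracket (y # l))" by simp
  then show ?case
    using Cons[of y] by (auto simp del: right_bracket.simps intro!: span_base)
qed simp

lemma lower_central_Suc_subset: "lower_central (Suc n) \<subseteq> lower_central n"
proof (induction n)
  case (Suc n)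
  show ?case unfolding lower_central.simps(2)[of "Suc n"] lower_central.simps(2)[of n]
    by (rule span_mono) (use Suc in auto)
qed simp

lemma lower_central_antimono: "m \<le> n \<Longrightarrow> lower_central n \<subseteq> lower_central m"
  using lift_Suc_antimono_le[of lower_central] lower_central_Suc_subset by blast

text \<open>Nilpotency is used here: a right-normed bracket of \<open>c + 1\<close> or more elements
  lies in \<open>lower_central c\<close>, so words of length greater than \<open>c\<close> evaluate
  to 0.\<close>

lemma ev_deg_ge:
  assumes "lower_central c = {0}" "c < N" "p \<in> deg_ge N"
  shows "ev p = 0"
  unfolding ev_def vlin_def
proof (rule sum.neutral, rule)
  fix w assume "w \<in> keys p"
  then have "c < length (letters w)" using assms by (auto simp: deg_ge_def)
  then obtain x l where l: "letters w = x # l" "c \<le> length l" by (cases "letters w") auto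
  then have "right_bracket (letters w) = 0"
    using right_bracket_lower_central[of x l] lower_central_antimono[of c "length l"] assms(1) by auto
  then show "scale (lookup p w) (scale (1 / of_nat (length (letters w))) (right_bracket (letters w))) = 0"
    by simp
qed

subsection \<open>The enveloping ideal\<close>

abbreviation env :: "('g, 'k) ncpoly set" where
  "env \<equiv> idl (linear_relations scale \<union> commutator_relations bracket)"

lemma env_add: "indet (x + y) - indet x - indet y \<in> env"
  and env_scale: "indet (scale c x) - sc c (indet x) \<in> env"
  and env_comm: "comm (indet x) (indet y) - indet (bracket x y) \<in> env"
  by (rule idl_base, auto simp: linear_relations_def commutator_relations_def const_mult)+

lemma env_0: "indet 0 \<in> env"
  using idl_minus[OF env_add[of 0 0]] by simp

text \<open>In the enveloping algebra brackets and linear combinations of letters are letters again,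
  namely those of their values in \<gg>.\<close>

lemma lie_elems_env: "a \<in> lie_elems \<Longrightarrow> a - indet (ev a) \<in> env"
proof (induction rule: lie_elems_induct)
  case (mono n a)
  then show ?case
  proof (induction rule: lie_mono.induct)
    case (lie_mono_comm m a n b)
    have ev: "ev (comm a b) = bracket (ev a) (ev b)"
      using lie_mono_comm.hyps by (intro ev_comm lie_mono_lie_elems)
    have "comm a b - indet (ev (comm a b)) =
        (a - indet (ev a)) * b + indet (ev a) * (b - indet (ev b))
        - ((b - indet (ev b)) * a + indet (ev b) * (a - indet (ev a)))
        + (comm (indet (ev a)) (indet (ev b)) - indet (bracket (ev a) (ev b)))"
      by (simp add: ev algebra_simps)
    also have "\<dots> \<in> env"
      by (rule idl_add[OF idl_diff[OF
              idl_add[OF idl_mult_right[OF lie_mono_comm.IH(1)] idl_mult_left[OF lie_mono_comm.IH(2)]]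
              idl_add[OF idl_mult_right[OF lie_mono_comm.IH(2)] idl_mult_left[OF lie_mono_comm.IH(1)]]]
            env_comm])
    finally show ?case .
  qed (simp add: idl_zero)
next
  case (add a b)
  have "a + b - indet (ev (a + b)) = (a - indet (ev a)) + (b - indet (ev b))
      - (indet (ev a + ev b) - indet (ev a) - indet (ev b))"
    by (simp add: ev_add)
  also have "\<dots> \<in> env"
    by (rule idl_diff[OF idl_add[OF add(3,4)] env_add])
  finally show ?case .
next
  case (scale c a)
  have "sc c a - indet (ev (sc c a)) = sc c (a - indet (ev a)) - (indet (scale c (ev a)) - sc c (indet (ev a)))"
    by (simp add: ev_sc pm.scale_right_diff_distrib)
  also have "\<dots> \<in> env"
    by (rule idl_diff[OF pm.subspace_scale[OF subspace_idl scale(2)] env_scale])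
  finally show ?case .
qed

subsection \<open>Kernels of evaluation\<close>

text \<open>The letters may come from another type: with \<open>w\<close> from \<gg> to \<hh> the
  ideal \<open>S\<close> of \<hh> lies in the free algebra on \<gg>, next to \<open>R\<close>, for
  which \<open>w\<close> is the identity.\<close>

definition lie_kernel :: "('a \<Rightarrow> 'g) \<Rightarrow> ('a, 'k) ncpoly set" where
  "lie_kernel w = {a \<in> lie_elems. ev (subst (\<lambda>x. indet (w x)) a) = 0}"

lemma subst_indet_lie_elems: "a \<in> lie_elems \<Longrightarrow> subst (\<lambda>x. indet (w x)) a \<in> lie_elems"
proof (induction rule: lie_elems_induct)
  case (mono n a)
  then show ?case
    by (induction rule: lie_mono.induct)
      (auto simp: subst_mult subst_diff intro: comm_lie_elems indet_lie_elems)
qed (auto simp: subst_add subst_sc intro: pm.subspace_add pm.subspace_scale subspace_lie_elems)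

lemma lie_ideal_lie_kernel: "lie_ideal (lie_kernel w)"
  unfolding lie_ideal_def
proof (intro conjI ballI)
  show "pm.subspace (lie_kernel w)"
    by (rule pm.subspaceI)
      (auto simp: lie_kernel_def subst_add ev_add subst_sc ev_sc
        intro: pm.subspace_0 pm.subspace_add pm.subspace_scale subspace_lie_elems)
  show "lie_kernel w \<subseteq> lie_elems"
    by (auto simp: lie_kernel_def)
  show "comm r x \<in> lie_kernel w" if "r \<in> lie_kernel w" "x \<in> lie_elems" for r x
    using that
    by (simp add: lie_kernel_def comm_lie_elems subst_diff subst_mult ev_comm subst_indet_lie_elems)
qed

lemma deg_ge_lie_kernel:
  assumes "lower_central c = {0}" "c < N"
  shows "lie_elems \<inter> deg_ge N \<subseteq> lie_kernel w"
  using ev_deg_ge[OF assms subst_deg_ge[OF indet_deg_ge]] by (auto simp: lie_kernel_def)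

lemma lie_kernel_env: "a \<in> lie_kernel w \<Longrightarrow> subst (\<lambda>x. indet (w x)) a \<in> env"
  using lie_elems_env[OF subst_indet_lie_elems, of a w] idl_add[OF _ env_0]
  by (fastforce simp: lie_kernel_def)

text \<open>The defining relations are Lie elements of value 0. Conversely, a Lie element of value 0
  is congruent to the letter of 0, which is itself a consequence of additivity.\<close>

lemma lie_kernel_id_env: "idl (lie_kernel (\<lambda>x. x)) = env"
proof
  have "lie_kernel (\<lambda>x. x) \<subseteq> env"
    using lie_kernel_env[of _ "\<lambda>x. x"] by auto
  then show "idl (lie_kernel (\<lambda>x. x)) \<subseteq> env"
    by (rule idl_subset)
  have "linear_relations scale \<union> commutator_relations bracket \<subseteq> lie_kernel (\<lambda>x. x)"
    by (auto simp: linear_relations_def commutator_relations_def lie_kernel_def const_mult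
        ev_diff ev_sc ev_mult_diff indet_lie_elems
        intro!: pm.subspace_diff[OF subspace_lie_elems] pm.subspace_scale[OF subspace_lie_elems]
          indet_lie_elems comm_lie_elems)
  then show "env \<subseteq> idl (lie_kernel (\<lambda>x. x))"
    by (intro idl_subset) (auto intro: idl_base)
qed

text \<open>For the converse direction, choose Lie elements \<open>s y\<close> of value
  \<open>y\<close>. Substituting them maps the relations into the kernel, and \<open>s (w x)\<close>
  agrees with the letter \<open>x\<close> modulo the kernel, so \<open>subst s\<close> inverts the
  renaming of letters on the quotients.\<close>

lemma idl_lie_kernel_iff:
  assumes surj: "\<And>y. \<exists>a\<in>lie_elems. ev (subst (\<lambda>x. indet (w x)) a) = y"
  shows "p \<in> idl (lie_kernel w \<union> deg_ge N) \<longleftrightarrow> subst (\<lambda>x. indet (w x)) p \<in> idl (env \<union> deg_ge N)"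
proof
  assume "p \<in> idl (lie_kernel w \<union> deg_ge N)"
  then show "subst (\<lambda>x. indet (w x)) p \<in> idl (env \<union> deg_ge N)"
    by (rule subst_idl) (auto intro!: idl_base lie_kernel_env subst_deg_ge indet_deg_ge)
next
  let ?q = "subst (\<lambda>x. indet (w x)) :: ('a, 'k) ncpoly \<Rightarrow> ('g, 'k) ncpoly"
  let ?S = "lie_kernel w"
  assume p: "?q p \<in> idl (env \<union> deg_ge N)"
  obtain s where s: "\<And>y. s y \<in> lie_elems" "\<And>y. ev (?q (s y)) = y"
    using surj by metis
  have "subst s r \<in> ?S" if "r \<in> linear_relations scale \<union> commutator_relations bracket" for r
    using that s
    by (auto simp: linear_relations_def commutator_relations_def lie_kernel_def const_mult subst_diff
        subst_mult subst_sc ev_diff ev_sc ev_mult_diff subst_indet_lie_elems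
        intro!: pm.subspace_diff[OF subspace_lie_elems] pm.subspace_scale[OF subspace_lie_elems]
          comm_lie_elems)
  then have "subst s r \<in> idl ?S" if "r \<in> env" for r
    using that by (rule_tac subst_idl) (auto intro: idl_base)
  then have "subst s (?q p) \<in> idl (?S \<union> deg_ge N)"
    by (intro subst_idl[OF p])
      (auto intro: idl_mono[of ?S] idl_base subst_deg_ge lie_elems_deg_ge[OF s(1)])
  moreover have "p - subst s (?q p) \<in> idl ?S"
  proof -
    have "indet x - s (w x) \<in> ?S" for x
      using s by (auto simp: lie_kernel_def subst_diff ev_diff
          intro!: pm.subspace_diff[OF subspace_lie_elems] indet_lie_elems)
    then have "subst indet p - subst (\<lambda>x. s (w x)) p \<in> idl ?S"
      by (intro subst_diff_idl idl_base)
    then show ?thesis by (simp add: subst_subst)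
  qed
  ultimately show "p \<in> idl (?S \<union> deg_ge N)"
    using idl_add[of "subst s (?q p)" "?S \<union> deg_ge N" "p - subst s (?q p)"] idl_mono[of ?S "?S \<union> deg_ge N"]
    by auto
qed

end

section \<open>Factorising an algebra isomorphism\<close>

lemma idl_decompose:
  fixes A :: "('a, 'k::field) ncpoly set"
  assumes "p \<in> idl (A \<union> deg_ge n)"
  obtains z where "z \<in> deg_ge n" "p - z \<in> idl A"
proof -
  have "\<exists>z\<in>deg_ge n. p - z \<in> idl A"
    using assms
  proof (induction rule: idl.induct)
    case idl_zero
    show ?case by (rule bexI[of _ 0]) (simp_all add: idl.idl_zero pm.subspace_0[OF subspace_deg_ge])
  next
    case (idl_step x r a b)
    then obtain z where z: "z \<in> deg_ge n" "x - z \<in> idl A" by blast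
    from idl_step(2) show ?case
    proof
      assume "r \<in> A"
      then have "(x - z) + a * r * b \<in> idl A" by (rule idl.idl_step[OF z(2)])
      moreover have "x + a * r * b - z = (x - z) + a * r * b" by simp
      ultimately show ?thesis using z(1) by metis
    next
      assume "r \<in> deg_ge n"
      then have "z + a * r * b \<in> deg_ge n"
        by (intro pm.subspace_add[OF subspace_deg_ge] z deg_ge_mult_left deg_ge_mult_right)
      then show ?thesis using z(2) by (intro bexI[of _ "z + a * r * b"]) simp_all
    qed
  qed
  then show thesis using that by blast
qed

text \<open>Telescoping over a word: one letter becomes a difference of length at least
  \<open>Suc n\<close> modulo \<open>A\<close>, and each other letter contributes at least one more
  to the length.\<close>

lemma subst_diff_idl_deg_ge:
  fixes u v :: "'a \<Rightarrow> ('b, 'k::field) ncpoly"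
  assumes "\<And>x. u x \<in> deg_ge 1" "\<And>x. v x \<in> deg_ge 1"
    and "\<And>x. u x - v x \<in> idl (A \<union> deg_ge (Suc n))" "p \<in> deg_ge k"
  shows "subst u p - subst v p \<in> idl (A \<union> deg_ge (n + k))"
proof (rule plinear_deg_ge[of "\<lambda>p. subst u p - subst v p", OF _ subspace_idl _ assms(4)])
  show "plinear (\<lambda>p. subst u p - subst v p)"
    by (rule pmp.linear_compose_sub[OF plinear_subst plinear_subst])
  fix l :: "'a list" assume l: "k \<le> length l"
  have "subst u (word l) - subst v (word l) \<in> idl (A \<union> deg_ge (n + length l))"
  proof (induction l)
    case (Cons x l)
    have eq: "subst u (word (x # l)) - subst v (word (x # l))
        = (u x - v x) * subst u (word l) + v x * (subst u (word l) - subst v (word l))"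
      by (simp add: algebra_simps)
    have "subst u (word l) \<in> deg_ge (length l)"
      by (rule subst_deg_ge[OF assms(1) word_deg_ge]) simp
    from deg_ge_mult_idl(2)[OF this assms(3)]
    have "(u x - v x) * subst u (word l) \<in> idl (A \<union> deg_ge (n + length (x # l)))"
      by (simp add: add.commute)
    moreover have "v x * (subst u (word l) - subst v (word l)) \<in> idl (A \<union> deg_ge (n + length (x # l)))"
      using deg_ge_mult_idl(1)[OF assms(2) Cons] by simp
    ultimately show ?case unfolding eq by (rule idl_add)
  qed (simp add: idl_zero)
  then show "subst u (word l) - subst v (word l) \<in> idl (A \<union> deg_ge (n + k))"
    by (rule idl_deg_ge_antimono[rotated]) (use l in simp)
qed

lemma dword_diff: "dword b' l - dword b l = dword (\<lambda>x. b' x - b x) l"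
proof (induction l)
  case (Cons x l)
  then show ?case by (simp add: algebra_simps Cons[symmetric])
qed simp

lemma deriv_diff: "deriv b' p - deriv b p = deriv (\<lambda>x. b' x - b x) p"
  by (rule plinear_eq_words[of "\<lambda>p. deriv b' p - deriv b p"])
    (simp_all add: pmp.linear_compose_sub plinear_deriv dword_diff)

text \<open>To first order the exponential changes by \<open>b' - b\<close>, of length
  \<open>Suc k\<close>; in the higher powers each further application of a derivation lengthens the
  words by one.\<close>

lemma texp_deriv_diff:
  fixes b b' :: "'a \<Rightarrow> ('a, 'k::field_char_0) ncpoly"
  assumes b: "\<And>x. b x \<in> deg_ge 2" and b': "\<And>x. b' x \<in> deg_ge 2"
    and diff: "\<And>x. b' x - b x \<in> deg_ge (Suc k)" and k: "1 \<le> k" and N: "2 \<le> N"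
  shows "raising_derivation.texp (deriv b') N (indet x) - raising_derivation.texp (deriv b) N (indet x)
    - (b' x - b x) \<in> deg_ge (Suc (Suc k))"
proof -
  interpret raising_derivation "deriv b" by (rule raising_derivation_deriv[OF b])
  interpret b': raising_derivation "deriv b'" by (rule raising_derivation_deriv[OF b'])
  have pow: "(deriv b' ^^ Suc j) (indet x) - (deriv b ^^ Suc j) (indet x) \<in> deg_ge (Suc (k + j))" for j
  proof (induction j)
    case 0
    then show ?case using diff by simp
  next
    case (Suc j)
    let ?p = "(deriv b ^^ Suc j) (indet x)" and ?p' = "(deriv b' ^^ Suc j) (indet x)"
    have "deriv b' (?p' - ?p) \<in> deg_ge (Suc (Suc (k + j)))"
      by (rule b'.raising[OF Suc])
    moreover have "deriv (\<lambda>x. b' x - b x) ?p \<in> deg_ge (1 + Suc j + k)"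
      by (rule deriv_deg_ge[OF diff funpow_deg_ge[OF indet_deg_ge]])
    moreover have "deriv b' ?p' - deriv b ?p = deriv b' (?p' - ?p) + deriv (\<lambda>x. b' x - b x) ?p"
      by (simp only: pmp.linear_diff[OF plinear_deriv] deriv_diff[symmetric]) simp
    ultimately show ?case
      using pm.subspace_add[OF subspace_deg_ge, of "deriv b' (?p' - ?p)" "Suc (Suc (k + j))"]
      by (simp add: add.commute)
  qed
  obtain N' where N': "N = Suc (Suc N')" using N by (metis add_2_eq_Suc le_Suc_ex)
  have "b'.texp N (indet x) - texp N (indet x) - (b' x - b x)
      = (\<Sum>n<N'. b'.dpow (Suc (Suc n)) (indet x) - dpow (Suc (Suc n)) (indet x))"
    by (simp add: b'.texp_def texp_def N' sum.lessThan_Suc_shift sum_subtractf dpow_1 b'.dpow_1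
        del: sum.lessThan_Suc)
  also have "\<dots> \<in> deg_ge (Suc (Suc k))"
  proof (rule pm.subspace_sum[OF subspace_deg_ge])
    fix n
    show "b'.dpow (Suc (Suc n)) (indet x) - dpow (Suc (Suc n)) (indet x) \<in> deg_ge (Suc (Suc k))"
      unfolding b'.dpow_def dpow_def pm.scale_right_diff_distrib[symmetric]
      using deg_ge_antimono[OF _ pow[of "Suc n"]]
      by (intro pm.subspace_scale[OF subspace_deg_ge]) simp
  qed
  finally show ?thesis .
qed

text \<open>Lifts, given on letters, of mutually inverse isomorphisms of the enveloping algebras;
  values without constant term express compatibility with the augmentations.\<close>

locale augmented_isomorphism =
  g: lie_algebra_char_0 scale_g bracket_g + h: lie_algebra_char_0 scale_h bracket_h
  for scale_g :: "'k::field_char_0 \<Rightarrow> 'g::ab_group_add \<Rightarrow> 'g" and bracket_g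
    and scale_h :: "'k \<Rightarrow> 'h::ab_group_add \<Rightarrow> 'h" and bracket_h +
  fixes phi :: "'g \<Rightarrow> ('h, 'k) ncpoly" and psi :: "'h \<Rightarrow> ('g, 'k) ncpoly"
  assumes phi_deg: "phi x \<in> deg_ge 1" and psi_deg: "psi y \<in> deg_ge 1"
    and phi_env: "p \<in> g.env \<Longrightarrow> subst phi p \<in> h.env"
    and psi_env: "q \<in> h.env \<Longrightarrow> subst psi q \<in> g.env"
    and psi_phi: "subst psi (phi x) - indet x \<in> g.env"
    and phi_psi: "subst phi (psi y) - indet y \<in> h.env"
begin

abbreviation letterwise :: "('g \<Rightarrow> 'h) \<Rightarrow> ('g, 'k) ncpoly \<Rightarrow> ('h, 'k) ncpoly" where
  "letterwise w \<equiv> subst (\<lambda>x. indet (w x))"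

text \<open>As the letterwise map agrees with \<open>phi\<close> up to words of length 2, composing
  it with \<open>psi\<close> gives the identity up to words one letter longer. Thus
  \<open>subst psi\<close> pulls errors back along the letterwise map.\<close>

lemma letterwise_psi:
  assumes w: "\<And>x. indet (w x) - phi x \<in> idl (h.env \<union> deg_ge 2)" and z: "z \<in> deg_ge n"
  shows "letterwise w (subst psi z) - z \<in> idl (h.env \<union> deg_ge (Suc n))"
proof -
  have "letterwise w (psi y) - indet y \<in> idl (h.env \<union> deg_ge (Suc 1))" for y
  proof -
    have "letterwise w (psi y) - subst phi (psi y) \<in> idl (h.env \<union> deg_ge 2)"
      by (rule subst_diff_idl[OF w])
    moreover have "subst phi (psi y) - indet y \<in> idl (h.env \<union> deg_ge 2)"
      by (intro idl_base UnI1 phi_psi)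
    ultimately show ?thesis
      using idl_add by (fastforce simp: numeral_2_eq_2)
  qed
  from subst_diff_idl_deg_ge[of "\<lambda>y. letterwise w (psi y)" indet h.env 1 z n,
      OF subst_deg_ge[OF indet_deg_ge psi_deg] indet_deg_ge this z]
  show ?thesis
    by (simp add: subst_subst)
qed

text \<open>The condition on \<open>lie_proj\<close> says that \<open>b\<close> takes values in the complement of the Lie elements,
  up to words of length \<open>N\<close>.\<close>

definition factorises :: "nat \<Rightarrow> nat \<Rightarrow> ('g \<Rightarrow> 'h) \<Rightarrow> ('g \<Rightarrow> ('g, 'k) ncpoly) \<Rightarrow> bool" where
  "factorises N n w b \<longleftrightarrow> (\<forall>x. b x \<in> deg_ge 2 \<and> lie_proj N (b x) \<in> deg_ge N \<and>
     phi x - letterwise w (raising_derivation.texp (deriv b) N (indet x)) \<in> idl (h.env \<union> deg_ge n))"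

lemma factorises_letter:
  assumes "factorises N n w b" "2 \<le> n" "1 \<le> N"
  shows "indet (w x) - phi x \<in> idl (h.env \<union> deg_ge 2)"
proof -
  have b: "\<And>x. b x \<in> deg_ge 2" using assms(1) by (simp add: factorises_def)
  interpret raising_derivation "deriv b" by (rule raising_derivation_deriv[OF b])
  have "texp N (indet x) - indet x \<in> deg_ge 2"
    using texp_diff[OF indet_deg_ge assms(3), of x] by (simp add: numeral_2_eq_2)
  then have "letterwise w (texp N (indet x) - indet x) \<in> deg_ge 2"
    by (rule subst_deg_ge[OF indet_deg_ge])
  then have 1: "letterwise w (texp N (indet x)) - indet (w x) \<in> idl (h.env \<union> deg_ge 2)"
    by (intro idl_base) (simp add: subst_diff)
  have "phi x - letterwise w (texp N (indet x)) \<in> idl (h.env \<union> deg_ge 2)"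
    using assms by (intro idl_deg_ge_antimono[OF assms(2)]) (simp add: factorises_def)
  from idl_minus[OF idl_add[OF this 1]] show ?thesis by simp
qed

text \<open>Up to words of length 2, \<open>phi x\<close> is its own Lie part, and this equals a
  letter in the enveloping algebra; that letter is taken as \<open>w x\<close>, with
  \<open>D = 0\<close>.\<close>

lemma factorises_base:
  assumes "2 \<le> N"
  shows "\<exists>w b. factorises N 2 w b"
proof -
  have "\<exists>l. l \<in> lie_elems \<and> lie_proj N (phi x) - l \<in> deg_ge N" for x
    using lie_proj_lie_elems[of N "phi x"] by blast
  then obtain l where l: "\<And>x. l x \<in> lie_elems" "\<And>x. lie_proj N (phi x) - l x \<in> deg_ge N"
    by metis
  define w where "w x = h.ev (l x)" for x
  define b :: "'g \<Rightarrow> ('g, 'k) ncpoly" where "b x = 0" for x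
  have b: "b x \<in> deg_ge 2" "lie_proj N (b x) \<in> deg_ge N" for x
    by (simp_all add: b_def pm.subspace_0[OF subspace_deg_ge] pmp.linear_0[OF plinear_lie_proj])
  interpret raising_derivation "deriv b" by (rule raising_derivation_deriv[OF b(1)])
  have "phi x - letterwise w (texp N (indet x)) \<in> idl (h.env \<union> deg_ge 2)" for x
  proof -
    have "texp N (indet x) - indet x \<in> deg_ge 2"
      using texp_diff[OF indet_deg_ge, of N x] assms by (simp add: numeral_2_eq_2)
    then have t: "letterwise w (texp N (indet x) - indet x) \<in> deg_ge 2"
      by (rule subst_deg_ge[OF indet_deg_ge])
    have "phi x - lie_proj N (phi x) + (lie_proj N (phi x) - l x) - letterwise w (texp N (indet x) - indet x)
        \<in> deg_ge 2"
      by (rule pm.subspace_diff[OF subspace_deg_ge pm.subspace_add[OF subspace_deg_ge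
              diff_lie_proj_deg_ge_2[OF phi_deg] deg_ge_antimono[OF assms l(2)]] t])
    then have "phi x - l x - letterwise w (texp N (indet x) - indet x) \<in> idl (h.env \<union> deg_ge 2)"
      by (intro idl_base) simp
    moreover have "l x - indet (w x) \<in> idl (h.env \<union> deg_ge 2)"
      unfolding w_def by (intro idl_base UnI1 h.lie_elems_env l)
    ultimately show ?thesis
      using idl_add by (fastforce simp: subst_diff)
  qed
  then show ?thesis
    using b by (intro exI[of _ w] exI[of _ b]) (simp add: factorises_def)
qed

text \<open>The error of length \<open>Suc k\<close> is moved into the free algebra on \<gg>, where
  it is split into a Lie part, corrected through \<open>w\<close>, and a part in the complement,
  corrected through \<open>b\<close>. All interactions between these changes have length at least
  \<open>k + 2\<close>.\<close>

lemma factorises_step: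
  assumes fact: "factorises N (Suc k) w b" and k: "1 \<le> k" "Suc k < N"
  shows "\<exists>w b. factorises N (Suc (Suc k)) w b"
proof -
  let ?J = "idl (h.env \<union> deg_ge (Suc (Suc k))) :: ('h, 'k) ncpoly set"
  let ?q = "letterwise w"
  have b: "b x \<in> deg_ge 2" "lie_proj N (b x) \<in> deg_ge N" for x
    using fact by (simp_all add: factorises_def)
  interpret raising_derivation "deriv b" by (rule raising_derivation_deriv[OF b(1)])
  let ?t = "\<lambda>x. texp N (indet x)"
  have "\<exists>z. z \<in> deg_ge (Suc k) \<and> phi x - ?q (?t x) - z \<in> h.env" for x
    using fact by (auto simp: factorises_def elim!: allE[of _ x] idl_decompose)
  then obtain z where z: "\<And>x. z x \<in> deg_ge (Suc k)" "\<And>x. phi x - ?q (?t x) - z x \<in> h.env"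
    by metis
  \<comment> \<open>The derivation lives on the source, so the error \<open>z x\<close> needs a
    preimage there; \<open>psi\<close> provides one up to longer words.\<close>
  define d where "d x = subst psi (z x)" for x
  have d: "d x \<in> deg_ge (Suc k)" for x
    unfolding d_def by (rule subst_deg_ge[OF psi_deg z(1)])
  have "\<exists>l. l \<in> lie_elems \<and> lie_proj N (d x) - l \<in> deg_ge N" for x
    using lie_proj_lie_elems[of N "d x"] by blast
  then obtain l where l: "\<And>x. l x \<in> lie_elems" "\<And>x. lie_proj N (d x) - l x \<in> deg_ge N"
    by metis
  have l_deg: "l x \<in> deg_ge (Suc k)" for x
    using pm.subspace_diff[OF subspace_deg_ge lie_proj_deg_ge[OF d[of x], of N]
        deg_ge_antimono[OF less_imp_le[OF k(2)] l(2)[of x]]]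
    by simp
  \<comment> \<open>The Lie part \<open>l x\<close> is traded for a letter, its value in \<hh>; what
    remains of \<open>d x\<close> has long projection and may enter \<open>b'\<close>.\<close>
  define w' where "w' x = w x + h.ev (?q (l x))" for x
  define b' where "b' x = b x + (d x - l x)" for x
  let ?q' = "letterwise w'"
  have dl: "d x - l x \<in> deg_ge (Suc k)" for x
    by (rule pm.subspace_diff[OF subspace_deg_ge d l_deg])
  have b': "b' x \<in> deg_ge 2" for x
    unfolding b'_def using k by (intro pm.subspace_add[OF subspace_deg_ge] b deg_ge_antimono[OF _ dl]) simp
  have b'_ker: "lie_proj N (b' x) \<in> deg_ge N" for x
    using pm.subspace_add[OF subspace_deg_ge b(2)[of x] l(2)[of x]] lie_proj_lie[OF l(1), of N x]
    by (simp add: b'_def pmp.linear_add[OF plinear_lie_proj] pmp.linear_diff[OF plinear_lie_proj])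
  interpret b': raising_derivation "deriv b'" by (rule raising_derivation_deriv[OF b'])
  let ?t' = "\<lambda>x. b'.texp N (indet x)"
  have q_l: "?q (l x) \<in> lie_elems" for x
    by (rule h.subst_indet_lie_elems[OF l(1)])
  have w'_env: "indet (w' x) - indet (w x) - ?q (l x) \<in> h.env" for x
    using idl_diff[OF h.env_add[of "w x" "h.ev (?q (l x))"] h.lie_elems_env[OF q_l[of x]]]
    by (simp add: w'_def)
  have w'_J: "indet (w' x) - indet (w x) \<in> idl (h.env \<union> deg_ge (Suc k))" for x
    using idl_add[OF idl_base[OF UnI1[OF w'_env]] idl_base[OF UnI2[OF subst_deg_ge[OF indet_deg_ge l_deg]]], of x w x]
    by simp
  have "phi x - ?q' (?t' x) \<in> ?J" for x
  proof -
    have 1: "phi x - ?q (?t x) - z x \<in> ?J"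
      by (intro idl_base UnI1 z)
    have "?q (subst psi (z x)) - z x \<in> ?J"
      by (rule letterwise_psi[OF factorises_letter[OF fact] z(1)]) (use k in auto)
    then have 2: "z x - ?q (d x) \<in> ?J"
      using idl_minus by (fastforce simp: d_def)
    have "?t' x - indet x \<in> deg_ge 2"
      using b'.texp_diff[OF indet_deg_ge, of N x] k by (simp add: numeral_2_eq_2)
    from subst_diff_idl_deg_ge[OF indet_deg_ge indet_deg_ge w'_J this]
    have 3: "?q' (?t' x - indet x) - ?q (?t' x - indet x) \<in> ?J" by simp
    have 4: "indet (w' x) - indet (w x) - ?q (l x) \<in> ?J"
      by (intro idl_base UnI1 w'_env)
    have "?t' x - ?t x - (b' x - b x) \<in> deg_ge (Suc (Suc k))"
      using k by (intro texp_deriv_diff b b') (simp_all add: b'_def dl)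
    then have 5: "?q (?t' x - ?t x - (d x - l x)) \<in> ?J"
      by (intro idl_base UnI2 subst_deg_ge[OF indet_deg_ge]) (simp add: b'_def)
    have "phi x - ?q' (?t' x) = (phi x - ?q (?t x) - z x) + (z x - ?q (d x))
        - (?q' (?t' x - indet x) - ?q (?t' x - indet x))
        - (indet (w' x) - indet (w x) - ?q (l x)) - ?q (?t' x - ?t x - (d x - l x))"
      by (simp add: subst_diff)
    also have "\<dots> \<in> ?J"
      by (rule idl_diff[OF idl_diff[OF idl_diff[OF idl_add[OF 1 2] 3] 4] 5])
    finally show ?thesis .
  qed
  then show ?thesis
    using b' b'_ker by (intro exI[of _ w'] exI[of _ b']) (simp add: factorises_def)
qed

lemma factorises_exists: "2 \<le> N \<Longrightarrow> \<exists>w b. factorises N N w b"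
proof -
  assume N: "2 \<le> N"
  have "\<exists>w b. factorises N n w b" if "2 \<le> n" "n \<le> N" for n
    using that
  proof (induction n rule: dec_induct)
    case base
    then show ?case using factorises_base[OF N] by simp
  next
    case (step n)
    then obtain k where "n = Suc k" "1 \<le> k" by (cases n) auto
    then show ?case using step factorises_step[of N k] by auto
  qed
  then show ?thesis using N by blast
qed

lemma letterwise_surj:
  assumes "factorises N n w b" "2 \<le> n" "1 \<le> N"
  shows "\<exists>a. z - letterwise w a \<in> idl (h.env \<union> deg_ge m)"
proof (induction m)
  case 0
  have "z - letterwise w 0 \<in> idl (h.env \<union> deg_ge 0)"
    by (intro idl_base UnI2 deg_ge_0)
  then show ?case ..
next
  case (Suc m)
  then obtain a where "z - letterwise w a \<in> idl (h.env \<union> deg_ge m)" by blast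
  then obtain y where y: "y \<in> deg_ge m" "z - letterwise w a - y \<in> h.env"
    using idl_decompose by (metis idl_idl)
  have "letterwise w (subst psi y) - y \<in> idl (h.env \<union> deg_ge (Suc m))"
    by (rule letterwise_psi[OF factorises_letter[OF assms] y(1)])
  from idl_diff[OF idl_base[OF UnI1[OF y(2)]] this]
  have "z - letterwise w (a + subst psi y) \<in> idl (h.env \<union> deg_ge (Suc m))"
    by (simp add: subst_add algebra_simps)
  then show ?case by blast
qed

text \<open>The projection commutes with renaming letters and fixes letters, so it turns an
  approximate preimage of a letter into a Lie element. The remaining errors, in the kernel or long,
  have value 0.\<close>

lemma letterwise_lie_surj:
  assumes fact: "factorises N n w b" "2 \<le> n" "1 \<le> N"
    and nilp: "h.lower_central c = {0}" "c < N"
  shows "\<exists>a\<in>lie_elems. h.ev (letterwise w a) = y"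
proof -
  let ?R = "h.lie_kernel (\<lambda>x. x)"
  obtain a where "indet y - letterwise w a \<in> idl (h.env \<union> deg_ge N)"
    using letterwise_surj[OF fact] by blast
  moreover have "idl (h.env \<union> deg_ge N) \<subseteq> idl (?R \<union> deg_ge N)"
    unfolding h.lie_kernel_id_env[symmetric]
    by (rule idl_subset) (auto intro: idl_base idl_mono[of ?R])
  ultimately have "indet y - letterwise w a \<in> idl (?R \<union> deg_ge N)" by blast
  then obtain r where r: "r \<in> ?R" "lie_proj N (indet y - letterwise w a) - r \<in> deg_ge N"
    using lie_proj_idl[OF h.lie_ideal_lie_kernel] by blast
  obtain l where l: "l \<in> lie_elems" "lie_proj N a - l \<in> deg_ge N"
    using lie_proj_lie_elems by blast
  have "lie_proj N (indet y - letterwise w a) = indet y - letterwise w (lie_proj N a)"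
    by (simp add: pmp.linear_diff[OF plinear_lie_proj] lie_proj_lie[OF indet_lie_elems] lie_proj_subst_indet)
  then have "indet y - letterwise w (lie_proj N a) - r + letterwise w (lie_proj N a - l) \<in> deg_ge N"
    using r(2) subst_deg_ge[OF indet_deg_ge l(2), of w] by (intro pm.subspace_add[OF subspace_deg_ge]) simp_all
  then have "h.ev (indet y - letterwise w (lie_proj N a) - r + letterwise w (lie_proj N a - l)) = 0"
    by (rule h.ev_deg_ge[OF nilp])
  moreover have "h.ev r = 0"
    using r(1) by (simp add: h.lie_kernel_def)
  ultimately have "y = h.ev (letterwise w l)"
    by (simp add: subst_diff h.ev_diff h.ev_add)
  then show ?thesis using l(1) by blast
qed

text \<open>Both maps are multiplicative up to long words, so their agreement on letters extends to
  all words.\<close>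

lemma phi_eq_letterwise_texp:
  assumes fact: "factorises N N w b"
  shows "subst phi p - letterwise w (raising_derivation.texp (deriv b) N p) \<in> idl (h.env \<union> deg_ge N)"
proof -
  have b: "\<And>x. b x \<in> deg_ge 2" using fact by (simp add: factorises_def)
  interpret raising_derivation "deriv b" by (rule raising_derivation_deriv[OF b])
  let ?J = "idl (h.env \<union> deg_ge N) :: ('h, 'k) ncpoly set"
  let ?E = "\<lambda>p. letterwise w (texp N p)"
  have lin: "plinear (\<lambda>p. subst phi p - ?E p)"
    by (rule pmp.linear_compose_sub[OF plinear_subst plinear_comp[OF plinear_subst plinear_texp]])
  have "subst phi (word l) - ?E (word l) \<in> ?J" for l
  proof (induction l)
    case Nil
    have "(deriv b ^^ n) (1 :: ('g, 'k) ncpoly) = (if n = 0 then 1 else 0)" for n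
    proof (induction n)
      case (Suc n)
      have "deriv b 1 = 0" using deriv_word[of b "[]"] by (simp del: deriv_word)
      then show ?case using Suc by (simp add: pmp.linear_0[OF plinear_deriv])
    qed simp
    then have "dpow n (1 :: ('g, 'k) ncpoly) = (if n = 0 then 1 else 0)" for n
      by (simp add: dpow_def)
    then have "texp N 1 = (if N = 0 then 0 else 1)"
      by (simp add: texp_def)
    then show ?case
      by (cases "N = 0") (auto simp: idl_zero intro: idl_base)
  next
    case (Cons x l)
    have "texp N (word (x # l)) - texp N (indet x) * texp N (word l) \<in> deg_ge N"
      unfolding word_Cons by (rule texp_mult)
    then have 1: "?E (word (x # l)) - ?E (indet x) * ?E (word l) \<in> ?J"
      using subst_deg_ge[OF indet_deg_ge] by (intro idl_base UnI2) (fastforce simp: subst_diff subst_mult)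
    have 2: "phi x - ?E (indet x) \<in> ?J"
      using fact by (simp add: factorises_def)
    have eq: "subst phi (word (x # l)) - ?E (word (x # l))
        = (phi x - ?E (indet x)) * subst phi (word l) + ?E (indet x) * (subst phi (word l) - ?E (word l))
          - (?E (word (x # l)) - ?E (indet x) * ?E (word l))"
      by (simp add: algebra_simps)
    show ?case unfolding eq
      by (rule idl_diff[OF idl_add[OF idl_mult_right[OF 2] idl_mult_left[OF Cons]] 1])
  qed
  then show ?thesis
    by (intro plinear_deg_ge[of "\<lambda>p. subst phi p - ?E p" ?J 0 p, OF lin subspace_idl]) simp_all
qed

lemma subst_phi_env_iff:
  "subst phi p \<in> idl (h.env \<union> deg_ge N) \<longleftrightarrow> p \<in> idl (g.env \<union> deg_ge N)"
proof
  assume "p \<in> idl (g.env \<union> deg_ge N)"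
  then show "subst phi p \<in> idl (h.env \<union> deg_ge N)"
    by (rule subst_idl) (auto intro: idl_base phi_env subst_deg_ge phi_deg)
next
  assume "subst phi p \<in> idl (h.env \<union> deg_ge N)"
  then have 1: "subst psi (subst phi p) \<in> idl (g.env \<union> deg_ge N)"
    by (rule subst_idl) (auto intro: idl_base psi_env subst_deg_ge psi_deg)
  have "subst (\<lambda>x. subst psi (phi x)) p - subst indet p \<in> g.env"
    by (rule subst_diff_idl[OF psi_phi])
  then have 2: "subst psi (subst phi p) - p \<in> g.env"
    by (simp add: subst_subst)
  from idl_diff[OF 1 idl_base[OF UnI1[OF 2]]] show "p \<in> idl (g.env \<union> deg_ge N)" by simp
qed

theorem lie_isomorphic_if_nilpotent:
  assumes g: "g.lower_central c = {0}" and h: "h.lower_central c' = {0}"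
  shows "lie_isomorphic scale_g bracket_g scale_h bracket_h"
proof -
  \<comment> \<open>Large enough that long Lie elements have value 0 in both algebras, and at least
    2, where the construction of \<open>w\<close> starts.\<close>
  define N where "N = c + c' + 2"
  have N: "2 \<le> N" "1 \<le> N" "c < N" "c' < N" by (simp_all add: N_def)
  obtain w b where fact: "factorises N N w b"
    using factorises_exists[OF N(1)] by blast
  then have b: "\<And>x. b x \<in> deg_ge 2" "\<And>x. lie_proj N (b x) \<in> deg_ge N"
    by (simp_all add: factorises_def)
  note D = raising_derivation_deriv[OF b(1)]
  let ?R = "g.lie_kernel (\<lambda>x. x)" and ?S = "h.lie_kernel w :: ('g, 'k) ncpoly set"
  let ?E = "raising_derivation.texp (deriv b) N"
  have surj: "\<exists>a\<in>lie_elems. h.ev (letterwise w a) = y" for y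
    by (rule letterwise_lie_surj[OF fact N(1,2) h N(4)])
  have iff: "p \<in> idl (?R \<union> deg_ge N) \<longleftrightarrow> ?E p \<in> idl (?S \<union> deg_ge N)" for p
  proof -
    have "p \<in> idl (?R \<union> deg_ge N) \<longleftrightarrow> p \<in> idl (g.env \<union> deg_ge N)"
      using g.idl_lie_kernel_iff[of "\<lambda>x. x" p N] indet_lie_elems g.ev_indet by fastforce
    also have "\<dots> \<longleftrightarrow> subst phi p \<in> idl (h.env \<union> deg_ge N)"
      by (simp only: subst_phi_env_iff)
    also have "\<dots> \<longleftrightarrow> letterwise w (?E p) \<in> idl (h.env \<union> deg_ge N)"
    proof -
      note * = phi_eq_letterwise_texp[OF fact, of p]
      show ?thesis
        using idl_diff[OF _ *] idl_add[OF *] by fastforce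
    qed
    also have "\<dots> \<longleftrightarrow> ?E p \<in> idl (?S \<union> deg_ge N)"
      by (rule h.idl_lie_kernel_iff[OF surj, symmetric])
    finally show ?thesis .
  qed
  have RS: "?R = ?S"
    by (rule lie_ideal_eq_if_texp[OF D g.lie_ideal_lie_kernel h.lie_ideal_lie_kernel _ iff
        g.deg_ge_lie_kernel[OF g N(3)] h.deg_ge_lie_kernel[OF h N(4)]]) (simp add: b(2))
  \<comment> \<open>The equality of the kernels, in usable form: a Lie expression in elements of
    \<gg> vanishes exactly when its image under \<open>w\<close> does. Applied to the relations of
    \<gg>, it makes \<open>w\<close> a homomorphism.\<close>
  have transfer: "h.ev (letterwise w a) = 0 \<longleftrightarrow> g.ev a = 0" if "a \<in> lie_elems" for a
    using RS that by (auto simp: g.lie_kernel_def h.lie_kernel_def set_eq_iff)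
  have "w (x + y) = w x + w y" for x y
  proof -
    have "indet (x + y) - indet x - indet y \<in> lie_elems"
      by (intro pm.subspace_diff[OF subspace_lie_elems] indet_lie_elems)
    from transfer[OF this] have "w (x + y) - w x - w y = 0"
      by (simp add: subst_diff g.ev_diff h.ev_diff)
    then show ?thesis by (simp add: algebra_simps)
  qed
  moreover have "w (scale_g c x) = scale_h c (w x)" for c x
    using transfer[of "indet (scale_g c x) - sc c (indet x)"]
    by (simp add: pm.subspace_diff[OF subspace_lie_elems] pm.subspace_scale[OF subspace_lie_elems]
        indet_lie_elems subst_diff subst_sc g.ev_diff h.ev_diff g.ev_sc h.ev_sc)
  ultimately have lin: "Vector_Spaces.linear scale_g scale_h w"
    by unfold_locales
  then interpret w: Vector_Spaces.linear scale_g scale_h w .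
  have bracket: "w (bracket_g x y) = bracket_h (w x) (w y)" for x y
    using transfer[of "comm (indet x) (indet y) - indet (bracket_g x y)"]
    by (simp add: pm.subspace_diff[OF subspace_lie_elems] comm_lie_elems
        indet_lie_elems subst_diff subst_mult g.ev_diff h.ev_diff g.ev_mult_diff h.ev_mult_diff)
  have "w x = 0 \<Longrightarrow> x = 0" for x
    using transfer[OF indet_lie_elems, of x] by simp
  then have "inj w"
    by (intro injI) (metis w.diff eq_iff_diff_eq_0)
  moreover have "surj w"
  proof (rule surjI[of w "\<lambda>y. g.ev (SOME a. a \<in> lie_elems \<and> h.ev (letterwise w a) = y)"])
    fix y
    define a where "a = (SOME a. a \<in> lie_elems \<and> h.ev (letterwise w a) = y)"
    have a: "a \<in> lie_elems" "h.ev (letterwise w a) = y"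
      using someI_ex[of "\<lambda>a. a \<in> lie_elems \<and> h.ev (letterwise w a) = y"] surj[of y]
      by (auto simp: a_def)
    \<comment> \<open>The Lie element \<open>a\<close> and the letter of its value differ by an
      element of value 0, so they also have equal values in \<hh>.\<close>
    then show "w (g.ev a) = y"
      using transfer[of "a - indet (g.ev a)"]
      by (simp add: pm.subspace_diff[OF subspace_lie_elems] indet_lie_elems subst_diff g.ev_diff h.ev_diff)
  qed
  ultimately show ?thesis
    using lin bracket unfolding lie_isomorphic_def bij_def by blast
qed

end

section \<open>Isomorphisms of enveloping algebras as substitutions\<close>

lemma free_algebra_simps [simp]:
  "carrier free_algebra = UNIV" "mult free_algebra = (*)" "one free_algebra = 1"
  "zero free_algebra = 0" "add free_algebra = (+)"
  by (simp_all add: free_algebra_def)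

lemma genideal_free_algebra: "Idl\<^bsub>free_algebra\<^esub> A = idl (A :: ('a, 'k::field) ncpoly set)"
proof
  have R: "ring (free_algebra :: ('a, 'k) ncpoly ring)"
    by (rule ring_free_algebra)
  interpret ring "free_algebra :: ('a, 'k) ncpoly ring" by (rule R)
  have inv: "a_inv free_algebra x = - x" for x :: "('a, 'k) ncpoly"
    by (rule minus_equality) simp_all
  have "ideal (idl A) free_algebra"
  proof (rule idealI[OF R])
    show "subgroup (idl A) (add_monoid free_algebra)"
    proof (rule add.subgroupI)
      show "\<ominus>\<^bsub>free_algebra\<^esub> x \<in> idl A" if "x \<in> idl A" for x
        using idl_minus[OF that] by (simp add: inv)
    qed (use idl_zero in \<open>auto intro: idl_add\<close>)
  qed (auto intro: idl_mult_left idl_mult_right)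
  then show "Idl\<^bsub>free_algebra\<^esub> A \<subseteq> idl A"
    by (rule genideal_minimal) (auto intro: idl_base)
  interpret I: ideal "Idl\<^bsub>free_algebra\<^esub> A" "free_algebra :: ('a, 'k) ncpoly ring"
    by (rule genideal_ideal) simp
  show "idl A \<subseteq> Idl\<^bsub>free_algebra\<^esub> A"
  proof
    fix x assume "x \<in> idl A"
    then show "x \<in> Idl\<^bsub>free_algebra\<^esub> A"
    proof (induction rule: idl.induct)
      case idl_zero
      then show ?case using I.zero_closed by simp
    next
      case (idl_step x r a b)
      have "r \<in> Idl\<^bsub>free_algebra\<^esub> A"
        using genideal_self[of A] idl_step by auto
      then have "a * r * b \<in> Idl\<^bsub>free_algebra\<^esub> A"
        using I.I_l_closed[of r a] I.I_r_closed[of "a * r" b] by simp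
      then show ?case using I.a_closed idl_step by simp
    qed
  qed
qed

abbreviation enveloping_idl ::
  "('k::field \<Rightarrow> 'g::ab_group_add \<Rightarrow> 'g) \<Rightarrow> ('g \<Rightarrow> 'g \<Rightarrow> 'g) \<Rightarrow> ('g, 'k) ncpoly set" where
  "enveloping_idl s b \<equiv> idl (linear_relations s \<union> commutator_relations b)"

definition cls ::
  "('k::field \<Rightarrow> 'g::ab_group_add \<Rightarrow> 'g) \<Rightarrow> ('g \<Rightarrow> 'g \<Rightarrow> 'g) \<Rightarrow> ('g, 'k) ncpoly \<Rightarrow> ('g, 'k) ncpoly set" where
  "cls s b p = enveloping_ideal s b +>\<^bsub>free_algebra\<^esub> p"

lemma cls_eq_iff: "cls s b p = cls s b q \<longleftrightarrow> p - q \<in> enveloping_idl s b"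
proof -
  let ?I = "enveloping_idl s b"
  have cls: "cls s b p = {i + p | i. i \<in> ?I}" for p
    by (auto simp: cls_def enveloping_ideal_def genideal_free_algebra a_r_coset_def r_coset_def)
  show ?thesis
  proof
    assume "cls s b p = cls s b q"
    moreover have "p \<in> cls s b p"
      using idl_zero[of "linear_relations s \<union> commutator_relations b"] by (force simp: cls)
    ultimately obtain i where "i \<in> ?I" "p = i + q" by (auto simp: cls)
    then show "p - q \<in> ?I" by simp
  next
    have sub: "cls s b p \<subseteq> cls s b q" if "p - q \<in> ?I" for p q
    proof
      fix x assume "x \<in> cls s b p"
      then obtain i where i: "i \<in> ?I" "x = i + p" by (auto simp: cls)
      then have "x = (i + (p - q)) + q" "i + (p - q) \<in> ?I"
        using that by (auto intro: idl_add)
      then show "x \<in> cls s b q" unfolding cls by blast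
    qed
    assume "p - q \<in> ?I"
    then show "cls s b p = cls s b q"
      using sub[of p q] sub[of q p] idl_minus[of "p - q"] by auto
  qed
qed

context
  fixes s :: "'k::field \<Rightarrow> 'g::ab_group_add \<Rightarrow> 'g" and b :: "'g \<Rightarrow> 'g \<Rightarrow> 'g"
begin

interpretation ideal "enveloping_ideal s b" "free_algebra :: ('g, 'k) ncpoly ring"
  by (rule ideal_enveloping_ideal)

lemma carrier_uea: "carrier (universal_enveloping_algebra s b) = range (cls s b)"
  by (auto simp: universal_enveloping_algebra_simps FactRing_def A_RCOSETS_def' cls_def)

lemma mult_uea: "cls s b p \<otimes>\<^bsub>universal_enveloping_algebra s b\<^esub> cls s b q = cls s b (p * q)"
  using rcoset_mult_add[of p q] by (simp add: universal_enveloping_algebra_simps FactRing_def cls_def)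

lemma add_uea: "cls s b p \<oplus>\<^bsub>universal_enveloping_algebra s b\<^esub> cls s b q = cls s b (p + q)"
  using a_rcos_sum[of p q] by (simp add: universal_enveloping_algebra_simps FactRing_def cls_def)

lemma one_uea: "\<one>\<^bsub>universal_enveloping_algebra s b\<^esub> = cls s b 1"
  by (simp add: universal_enveloping_algebra_simps FactRing_def cls_def)

lemma smult_uea: "c \<odot>\<^bsub>universal_enveloping_algebra s b\<^esub> cls s b p = cls s b (sc c p)"
  by (simp add: universal_enveloping_algebra_simps cls_def const_mult)

end

text \<open>Freeness lifts a homomorphism of the quotients to a substitution of letters.
  Well-definedness and injectivity become the equivalence of memberships, surjectivity the
  solvability modulo the target ideal.\<close>

lemma algebra_isomorphic_iff_subst:
  fixes s :: "'k::field \<Rightarrow> 'g::ab_group_add \<Rightarrow> 'g" and s' :: "'k \<Rightarrow> 'h::ab_group_add \<Rightarrow> 'h"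
  shows "algebra_isomorphic (universal_enveloping_algebra s b) (universal_enveloping_algebra s' b')
    \<longleftrightarrow> (\<exists>u. (\<forall>p. subst u p \<in> enveloping_idl s' b' \<longleftrightarrow> p \<in> enveloping_idl s b) \<and>
          (\<forall>q. \<exists>p. subst u p - q \<in> enveloping_idl s' b'))"
    (is "algebra_isomorphic ?U ?U' \<longleftrightarrow> (\<exists>u. ?P u)")
proof
  let ?c = "cls s b" and ?c' = "cls s' b'"
  assume "algebra_isomorphic ?U ?U'"
  then obtain f where f: "f \<in> ring_iso ?U ?U'"
    and f_sc: "\<And>c x. x \<in> carrier ?U \<Longrightarrow> f (c \<odot>\<^bsub>?U\<^esub> x) = c \<odot>\<^bsub>?U'\<^esub> f x"
    by (auto simp: algebra_isomorphic_def)
  have hom: "f \<in> ring_hom ?U ?U'" and bij: "bij_betw f (range ?c) (range ?c')"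
    using f by (auto simp: ring_iso_def carrier_uea)
  have f_mult: "f (?c (p * q)) = f (?c p) \<otimes>\<^bsub>?U'\<^esub> f (?c q)" for p q
    using ring_hom_mult[OF hom, of "?c p" "?c q"] by (simp add: carrier_uea mult_uea)
  have f_add: "f (?c (p + q)) = f (?c p) \<oplus>\<^bsub>?U'\<^esub> f (?c q)" for p q
    using ring_hom_add[OF hom, of "?c p" "?c q"] by (simp add: carrier_uea add_uea)
  have f_1: "f (?c 1) = ?c' 1"
    using ring_hom_one[OF hom] by (simp add: one_uea)
  have f_sc: "f (?c (sc c p)) = c \<odot>\<^bsub>?U'\<^esub> f (?c p)" for c p
    using f_sc[of "?c p" c] by (simp add: carrier_uea smult_uea)
  have "\<exists>p. f (?c (indet x)) = ?c' p" for x
    using bij_betwE[OF bij] by blast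
  then obtain u where u: "\<And>x. f (?c (indet x)) = ?c' (u x)"
    by metis
  have f_word: "f (?c (word l)) = ?c' (subst u (word l))" for l
    by (induction l) (simp_all add: f_1 word_Cons f_mult u mult_uea subst_mult)
  have f_subst: "f (?c p) = ?c' (subst u p)" for p
  proof -
    have "p \<in> {p. f (?c p) = ?c' (subst u p)}"
    proof (rule pm_subspace_induct[OF pm.subspaceI])
      show "0 \<in> {p. f (?c p) = ?c' (subst u p)}"
        using f_sc[of 0 1] by (simp add: f_1 smult_uea)
    qed (simp_all add: f_add f_sc add_uea smult_uea subst_add subst_sc single_word f_word del: subst_word)
    then show ?thesis by simp
  qed
  have "subst u p \<in> enveloping_idl s' b' \<longleftrightarrow> p \<in> enveloping_idl s b" for p
  proof -
    have "subst u p \<in> enveloping_idl s' b' \<longleftrightarrow> f (?c p) = f (?c 0)"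
      by (simp add: f_subst cls_eq_iff)
    also have "\<dots> \<longleftrightarrow> ?c p = ?c 0"
      using bij by (auto simp: bij_betw_def inj_on_eq_iff)
    finally show ?thesis by (simp add: cls_eq_iff)
  qed
  moreover have "\<exists>p. subst u p - q \<in> enveloping_idl s' b'" for q
  proof -
    have "?c' q \<in> f ` range ?c"
      using bij by (simp add: bij_betw_def)
    then obtain p where "?c' q = f (?c p)" by blast
    then show ?thesis by (auto simp: f_subst cls_eq_iff[symmetric])
  qed
  ultimately show "\<exists>u. ?P u" by blast
next
  let ?c = "cls s b" and ?c' = "cls s' b'"
  assume "\<exists>u. ?P u"
  then obtain u where u: "\<And>p. subst u p \<in> enveloping_idl s' b' \<longleftrightarrow> p \<in> enveloping_idl s b"
    and surj: "\<And>q. \<exists>p. subst u p - q \<in> enveloping_idl s' b'"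
    by blast
  define f where "f X = ?c' (subst u (SOME p. ?c p = X))" for X
  have f: "f (?c p) = ?c' (subst u p)" for p
  proof -
    have "?c (SOME q. ?c q = ?c p) = ?c p" by (rule someI) simp
    then show ?thesis
      using u[of "(SOME q. ?c q = ?c p) - p"] by (simp add: f_def cls_eq_iff subst_diff)
  qed
  have "f \<in> ring_hom ?U ?U'"
    by (rule ring_hom_memI)
      (auto simp: carrier_uea mult_uea add_uea one_uea f subst_mult subst_add)
  moreover have "bij_betw f (carrier ?U) (carrier ?U')"
    unfolding bij_betw_def
  proof
    have "?c p = ?c q" if "f (?c p) = f (?c q)" for p q
      using that u[of "p - q"] by (simp add: f cls_eq_iff subst_diff)
    then show "inj_on f (carrier ?U)"
      unfolding carrier_uea inj_on_def by blast
    have "?c' q \<in> f ` range ?c" for q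
      using surj[of q] by (auto simp: cls_eq_iff[symmetric] f[symmetric])
    then show "f ` carrier ?U = carrier ?U'"
      by (auto simp: carrier_uea f)
  qed
  moreover have "f (c \<odot>\<^bsub>?U\<^esub> x) = c \<odot>\<^bsub>?U'\<^esub> f x" if "x \<in> carrier ?U" for c x
    using that by (auto simp: carrier_uea smult_uea f subst_sc)
  ultimately show "algebra_isomorphic ?U ?U'"
    by (auto simp: algebra_isomorphic_def ring_iso_def)
qed

section \<open>Making an isomorphism compatible with augmentations\<close>

lemma lookup_indet_0: "lookup (indet x) 0 = 0"
  by (rule deg_ge_1_iff[THEN iffD1, OF indet_deg_ge])

lemma lookup_mult_0:
  fixes p q :: "('a, 'k::field) ncpoly"
  shows "lookup (p * q) 0 = lookup p 0 * lookup q 0"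
proof -
  have "(p - sc (lookup p 0) 1) * q \<in> deg_ge 1"
    by (rule deg_ge_mult_right[OF diff_const_deg_ge_1])
  then show ?thesis
    by (simp add: deg_ge_1_iff[simplified] left_diff_distrib lookup_minus sc_mult)
qed

context lie_algebra_char_0
begin

lemma env_deg_ge: "p \<in> env \<Longrightarrow> p \<in> deg_ge 1"
proof (rule plinear_idl[OF plinear_id subspace_deg_ge])
  fix a r b :: "('g, 'k) ncpoly"
  assume "r \<in> linear_relations scale \<union> commutator_relations bracket"
  then have "r \<in> deg_ge 1"
    by (auto simp only: linear_relations_def commutator_relations_def const_mult
        intro!: pm.subspace_diff[OF subspace_deg_ge] pm.subspace_scale[OF subspace_deg_ge]
          deg_ge_mult_left indet_deg_ge)
  then show "a * r * b \<in> deg_ge 1"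
    by (intro deg_ge_mult_left deg_ge_mult_right)
qed

text \<open>A character of the Lie algebra defines a translation of letters. It fixes every defining
  relation, because the shifts are central, linear and zero on brackets.\<close>

lemma subst_character_env:
  assumes add: "\<And>x y. chi (x + y) = chi x + chi y" and scl: "\<And>c x. chi (scale c x) = c * chi x"
    and br: "\<And>x y. chi (bracket x y) = 0" and p: "p \<in> env"
  shows "subst (\<lambda>x. indet x - sc (chi x) 1) p \<in> env"
proof (rule subst_idl[OF p])
  fix r assume r: "r \<in> linear_relations scale \<union> commutator_relations bracket"
  then consider x y where "r = indet (x + y) - indet x - indet y"
    | c x where "r = indet (scale c x) - sc c (indet x)"
    | x y where "r = comm (indet x) (indet y) - indet (bracket x y)"
    by (auto simp: linear_relations_def commutator_relations_def const_mult)
  then have "subst (\<lambda>x. indet x - sc (chi x) 1) r = r"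
  proof cases
    case 1
    show ?thesis unfolding 1 by (simp add: subst_diff subst_add add algebra_simps)
  next
    case 2
    show ?thesis unfolding 2 by (simp add: subst_diff subst_sc scl algebra_simps)
  next
    case 3
    show ?thesis unfolding 3 by (simp add: subst_diff subst_add subst_mult br algebra_simps sc_mult)
  qed
  then show "subst (\<lambda>x. indet x - sc (chi x) 1) r \<in> env"
    using r by (simp only: idl_base)
qed

end

text \<open>An algebra isomorphism pulls the augmentation of \<open>U\<hh>\<close> back to some
  character of \<gg>; composing with the translation by this character corrects the
  difference.\<close>

lemma augmented_isomorphism_if_algebra_isomorphic:
  fixes scale_g :: "'k::field_char_0 \<Rightarrow> 'g::ab_group_add \<Rightarrow> 'g" and scale_h :: "'k \<Rightarrow> 'h::ab_group_add \<Rightarrow> 'h"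
  assumes g: "lie_algebra_char_0 scale_g bracket_g" and h: "lie_algebra_char_0 scale_h bracket_h"
    and iso: "algebra_isomorphic (universal_enveloping_algebra scale_g bracket_g)
      (universal_enveloping_algebra scale_h bracket_h)"
  shows "\<exists>phi psi. augmented_isomorphism scale_g bracket_g scale_h bracket_h phi psi"
proof -
  interpret g: lie_algebra_char_0 scale_g bracket_g by fact
  interpret h: lie_algebra_char_0 scale_h bracket_h by fact
  obtain u where u: "\<And>p. subst u p \<in> h.env \<longleftrightarrow> p \<in> g.env" and surj: "\<And>q. \<exists>p. subst u p - q \<in> h.env"
    using iso unfolding algebra_isomorphic_iff_subst by blast
  have "\<exists>p. subst u p - indet y \<in> h.env" for y
    by (rule surj)
  then obtain v where v: "\<And>y. subst u (v y) - indet y \<in> h.env"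
    by metis
  have uv: "subst u (subst v q) - q \<in> h.env" for q
    using subst_diff_idl[of "\<lambda>y. subst u (v y)" indet, OF v, of q] by (simp add: subst_subst)
  have v_env: "subst v q \<in> g.env" if "q \<in> h.env" for q
    using idl_add[OF uv[of q] that] u[of "subst v q"] by simp
  have vu: "subst v (subst u p) - p \<in> g.env" for p
    using uv[of "subst u p"] u[of "subst v (subst u p) - p"] by (simp add: subst_diff)
  \<comment> \<open>The pulled back augmentation on letters. It is a character because elements of
    the enveloping ideal have no constant term.\<close>
  define chi where "chi x = lookup (u x) 0" for x
  have u_env: "lookup (subst u p) 0 = 0" if "p \<in> g.env" for p
    using h.env_deg_ge[of "subst u p"] u that by (simp add: deg_ge_1_iff[simplified])
  have chi_add: "chi (x + y) = chi x + chi y" for x y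
    using u_env[OF g.env_add[of x y]]
    by (simp add: chi_def subst_diff subst_add lookup_minus lookup_add algebra_simps)
  have chi_scale: "chi (scale_g c x) = c * chi x" for c x
    using u_env[OF g.env_scale[of c x]] by (simp add: chi_def subst_diff subst_sc lookup_minus)
  have chi_bracket: "chi (bracket_g x y) = 0" for x y
    using u_env[OF g.env_comm[of x y]]
    by (simp add: chi_def subst_diff subst_mult lookup_minus lookup_mult_0)
  let ?t = "subst (\<lambda>x. indet x - sc (chi x) 1) :: ('g, 'k) ncpoly \<Rightarrow> ('g, 'k) ncpoly"
  let ?t' = "subst (\<lambda>x. indet x - sc (- chi x) 1) :: ('g, 'k) ncpoly \<Rightarrow> ('g, 'k) ncpoly"
  have t_env: "?t p \<in> g.env" if "p \<in> g.env" for p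
    by (rule g.subst_character_env[OF chi_add chi_scale chi_bracket that])
  have t'_env: "?t' p \<in> g.env" if "p \<in> g.env" for p
    by (rule g.subst_character_env[OF _ _ _ that]) (simp_all add: chi_add chi_scale chi_bracket)
  have tt': "?t (?t' p) = p" and t't: "?t' (?t p) = p" for p
    by (simp_all add: subst_subst subst_diff subst_add subst_sc)
  define phi where "phi x = u x - sc (chi x) 1" for x
  define psi where "psi y = ?t' (v y)" for y
  have phi: "subst phi p = subst u (?t p)" for p
    unfolding subst_subst by (rule arg_cong[of _ _ "\<lambda>f. subst f p"])
      (simp add: phi_def subst_diff subst_sc fun_eq_iff)
  have psi: "subst psi q = ?t' (subst v q)" for q
    by (simp add: subst_subst psi_def[abs_def])
  \<comment> \<open>Both sides are multiplicative and linear in \<open>p\<close> and give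
    \<open>chi x\<close> on the letter \<open>x\<close>; this shows that \<open>psi\<close> has no
    constant terms.\<close>
  have lookup_t': "lookup (?t' p) 0 = lookup (subst u p) 0" for p
  proof -
    have words: "lookup (?t' (word l)) 0 = lookup (subst u (word l)) 0" for l
    proof (induction l)
      case (Cons x l)
      then show ?case
        by (simp add: word_Cons subst_mult lookup_mult_0 lookup_minus lookup_add lookup_indet_0 chi_def)
    qed simp
    have "p \<in> {p. lookup (?t' p) 0 = lookup (subst u p) 0}"
    proof (rule pm_subspace_induct[OF pm.subspaceI])
      show "single w 1 \<in> {p. lookup (?t' p) 0 = lookup (subst u p) 0}" for w
        using words[of "letters w"] by (simp only: single_word mem_Collect_eq)
    qed (simp_all add: subst_add subst_sc lookup_add)
    then show ?thesis by simp
  qed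
  have "augmented_isomorphism scale_g bracket_g scale_h bracket_h phi psi"
  proof unfold_locales
    show "phi x \<in> deg_ge 1" for x
      unfolding phi_def chi_def by (rule diff_const_deg_ge_1)
    have "lookup (subst u (v y)) 0 = (0 :: 'k)" for y
      using h.env_deg_ge[OF v[of y]]
      unfolding deg_ge_1_iff lookup_minus lookup_indet_0 by simp
    then show "psi y \<in> deg_ge 1" for y
      unfolding deg_ge_1_iff psi_def lookup_t' .
    show "subst phi p \<in> h.env" if "p \<in> g.env" for p
      using t_env[OF that] u by (simp add: phi)
    show "subst psi q \<in> g.env" if "q \<in> h.env" for q
      unfolding psi by (intro t'_env v_env that)
    show "subst psi (phi x) - indet x \<in> g.env" for x
    proof -
      have "subst psi (phi x) - indet x = ?t' (subst v (subst u (?t (indet x))) - ?t (indet x))"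
        using phi[of "indet x"] t't[of "indet x"] by (simp add: psi subst_diff)
      then show ?thesis using t'_env[OF vu] by simp
    qed
    show "subst phi (psi y) - indet y \<in> h.env" for y
      using v[of y] by (simp only: phi psi_def tt')
  qed
  then show ?thesis by blast
qed

lemma algebra_isomorphic_if_lie_isomorphic:
  fixes scale_g :: "'k::field_char_0 \<Rightarrow> 'g::ab_group_add \<Rightarrow> 'g" and scale_h :: "'k \<Rightarrow> 'h::ab_group_add \<Rightarrow> 'h"
  assumes "lie_isomorphic scale_g bracket_g scale_h bracket_h"
  shows "algebra_isomorphic (universal_enveloping_algebra scale_g bracket_g)
    (universal_enveloping_algebra scale_h bracket_h)"
proof -
  obtain f where lin: "Vector_Spaces.linear scale_g scale_h f" and "bij f"
    and br: "\<And>x y. f (bracket_g x y) = bracket_h (f x) (f y)"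
    using assms by (auto simp: lie_isomorphic_def)
  define f' where "f' = inv_into UNIV f"
  have f': "f (f' y) = y" "f' (f x) = x" for x y
    using \<open>bij f\<close> by (auto simp: f'_def bij_is_surj surj_f_inv_f bij_is_inj)
  interpret f: Vector_Spaces.linear scale_g scale_h f by (rule lin)
  have f'_hom: "f' (x + y) = f' x + f' y" "f' (scale_h c x) = scale_g c (f' x)"
    "f' (bracket_h x y) = bracket_g (f' x) (f' y)" for x y c
    by (metis f' f.add, metis f' f.scale, metis f' br)
  let ?q = "subst (\<lambda>x. indet (f x)) :: ('g, 'k) ncpoly \<Rightarrow> ('h, 'k) ncpoly"
  let ?q' = "subst (\<lambda>x. indet (f' x)) :: ('h, 'k) ncpoly \<Rightarrow> ('g, 'k) ncpoly"
  have qq': "?q (?q' p) = p" and q'q: "?q' (?q r) = r" for p r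
    by (simp_all add: subst_subst f')
  have q: "?q p \<in> enveloping_idl scale_h bracket_h" if "p \<in> enveloping_idl scale_g bracket_g" for p
    using that by (rule subst_idl)
      (rule idl_base, fastforce simp: linear_relations_def commutator_relations_def const_mult
        subst_diff subst_sc subst_mult f.add f.scale br)
  have q': "?q' p \<in> enveloping_idl scale_g bracket_g" if "p \<in> enveloping_idl scale_h bracket_h" for p
    using that by (rule subst_idl)
      (rule idl_base, fastforce simp: linear_relations_def commutator_relations_def const_mult
        subst_diff subst_sc subst_mult f'_hom)
  show ?thesis
    unfolding algebra_isomorphic_iff_subst
  proof (intro exI conjI allI)
    show "?q p \<in> enveloping_idl scale_h bracket_h \<longleftrightarrow> p \<in> enveloping_idl scale_g bracket_g" for p
      using q[of p] q'[of "?q p"] by (auto simp: q'q)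
    show "?q (?q' p) - p \<in> enveloping_idl scale_h bracket_h" for p
      by (simp add: qq' idl_zero)
  qed
qed

theorem corollary0p12:
  fixes scale_g :: "'k::field_char_0 \<Rightarrow> 'g::ab_group_add \<Rightarrow> 'g"
    and bracket_g :: "'g \<Rightarrow> 'g \<Rightarrow> 'g"
    and scale_h :: "'k \<Rightarrow> 'h::ab_group_add \<Rightarrow> 'h"
    and bracket_h :: "'h \<Rightarrow> 'h \<Rightarrow> 'h"
  assumes "nilpotent_lie_algebra scale_g bracket_g"
    and "nilpotent_lie_algebra scale_h bracket_h"
  shows "algebra_isomorphic (universal_enveloping_algebra scale_g bracket_g)
           (universal_enveloping_algebra scale_h bracket_h)
         \<longleftrightarrow> lie_isomorphic scale_g bracket_g scale_h bracket_h"
proof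
  interpret g: nilpotent_lie_algebra scale_g bracket_g by fact
  interpret h: nilpotent_lie_algebra scale_h bracket_h by fact
  assume "algebra_isomorphic (universal_enveloping_algebra scale_g bracket_g)
           (universal_enveloping_algebra scale_h bracket_h)"
  then obtain phi psi where "augmented_isomorphism scale_g bracket_g scale_h bracket_h phi psi"
    using augmented_isomorphism_if_algebra_isomorphic g.lie_algebra_axioms h.lie_algebra_axioms
    by (metis lie_algebra_char_0.intro)
  then interpret augmented_isomorphism scale_g bracket_g scale_h bracket_h phi psi .
  show "lie_isomorphic scale_g bracket_g scale_h bracket_h"
    using g.nilpotent h.nilpotent lie_isomorphic_if_nilpotent by blast
qed (rule algebra_isomorphic_if_lie_isomorphic)

end
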